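(* Let $N\ge3$, $k>0$, and consider the spherically symmetric pressureless Euler–Poisson system with zero background, $$\rho_t+\frac{(\rho u r^{N-1})_r}{r^{N-1}}=0,\qquad u_t+uu_r=-k\phi_r,\qquad -(r^{N-1}\phi_r)_r=r^{N-1}\rho,\qquad t>0,\ r>0,$$ with smooth initial data $(\rho_0\ge0,u_0)$. For $r>0$ with $\rho_0(r)>0$ set $$A_0(r):=\frac{u_0(r)u_{0r}(r)+k\phi_{0r}(r)}{r\rho_0(r)} .$$ If there exists $r_c>0$ (with $\rho_0(r_c)>0$) such that $$A_0(r_c)\le-\frac{k}{N-2},$$ then finite-time breakdown occurs.
   Context: The system is the radial reduction ($r=|\mathbf x|$, $\mathbf u=u\,\mathbf x/r$) of $\rho_t+\nabla\cdot(\rho\mathbf u)=0$, $\mathbf u_t+(\mathbf u\cdot\nabla)\mathbf u=-k\nabla\phi$, $-\Delta\phi=\rho$ on $\mathbb R^N$. Local well-posedness is taken as known: for $\rho_0\in H^s(\mathbb R^N)$, $\mathbf u_0\in(H^{s+1}(\mathbb R^N))^N$, $s>N/2$, there is a unique smooth solution with $\rho\in C([0,T];H^s)$, $\mathbf u\in (C([0,T];H^{s+1}))^N$ for some $T>0$, continuable as long as $\int_0^T\|\nabla\mathbf u(t,\cdot)\|_\infty dt<\infty$. Boundary conditions at the origin: $r^{N-1}\phi_r\to0$ and $\rho u r^{N-1}\to0$ as $r\to0^+$; thus $-r^{N-1}\phi_{0r}(r)=\int_0^r\rho_0(\xi)\xi^{N-1}d\xi$. Here $u_{0r}$ is the derivative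 of $u_0$ and $\phi_{0r}=\phi_r(0,\cdot)$. Finite-time breakdown means: $\lim_{t\to t_c^-}|u_r|=\infty$ and $\lim_{t\to t_c^-}\rho=\infty$ (or $0$) at some location $r>0$ and finite time $t_c>0$, so smoothness is lost.
   Formalization: The breakdown location may be r=0 if the particle path starts in a vacuum core (ρ0=0 on [0,X(0)]); there r>0 can fail, e.g. ρ0=0, u0=-cr+r^3 near 0 with c large. Limits of u_r and ρ are taken along a particle path. *)

theory Defs
  imports "HOL-Analysis.Analysis"
begin

text \<open>
  The space dimension is \<open>N = CARD('n)\<close>. A radial profile is a function of \<open>r \<in> [0,\<infinity>)\<close>, represented
  as a function on \<open>real\<close> whose values at negative arguments are never used.
\<close>

definition radial_scalar :: "(real \<Rightarrow> real) \<Rightarrow> real ^ 'n::finite \<Rightarrow> real" where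
  "radial_scalar f x = f (norm x)"

text \<open>The field \<open>u(r) x / r\<close>; its value at the origin is \<open>0\<close>.\<close>

definition radial_field :: "(real \<Rightarrow> real) \<Rightarrow> real ^ 'n::finite \<Rightarrow> real ^ 'n" where
  "radial_field u x = (u (norm x) / norm x) *\<^sub>R x"

definition C1_on :: "('a::real_normed_vector \<Rightarrow> 'b::real_normed_vector) \<Rightarrow> 'a set \<Rightarrow> bool" where
  "C1_on f S \<longleftrightarrow>
     (\<exists>f' :: 'a \<Rightarrow> 'a \<Rightarrow>\<^sub>L 'b.
        (\<forall>z\<in>S. (f has_derivative blinfun_apply (f' z)) (at z within S)) \<and> continuous_on S f')"

text \<open>
  The Sobolev space \<open>H\<^sup>s(\<real>\<^sup>N)\<close> for real \<open>s \<ge> 0\<close>. A function \<open>g\<close> is the Fourier-Plancherel transform of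
  \<open>f \<in> L\<^sup>2\<close> iff the truncated inverse Fourier integrals of \<open>g\<close> converge to \<open>f\<close> in \<open>L\<^sup>2\<close>. Since \<open>s \<ge> 0\<close>,
  the weighted integrability puts \<open>g\<close> in \<open>L\<^sup>2\<close>, so it is integrable over balls.
\<close>

definition is_fourier_transform ::
    "(real ^ 'n::finite \<Rightarrow> real) \<Rightarrow> (real ^ 'n \<Rightarrow> complex) \<Rightarrow> bool" where
  "is_fourier_transform f g \<longleftrightarrow>
     ((\<lambda>R::real. \<integral>\<^sup>+ x. ennreal ((cmod (complex_of_real (f x)
          - complex_of_real ((2 * pi) powr (- real CARD('n) / 2))
              * (LINT \<xi>:cball 0 R|lborel. g \<xi> * cis (\<xi> \<bullet> x))))\<^sup>2) \<partial>lborel) \<longlongrightarrow> 0) at_top"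

definition sobolev :: "real \<Rightarrow> (real ^ 'n::finite \<Rightarrow> real) \<Rightarrow> bool" where
  "sobolev s f \<longleftrightarrow>
     f \<in> borel_measurable lborel \<and> integrable lborel (\<lambda>x. (f x)\<^sup>2) \<and>
     (\<exists>g. g \<in> borel_measurable lborel \<and>
          integrable lborel (\<lambda>\<xi>. (1 + (norm \<xi>)\<^sup>2) powr s * (cmod (g \<xi>))\<^sup>2) \<and>
          is_fourier_transform f g)"

text \<open>Data \<open>\<rho>\<^sub>0 \<in> H\<^sup>s\<close>, \<open>\<rho>\<^sub>0 \<ge> 0\<close>, and \<open>u\<^sub>0 x / r \<in> (H\<^sup>s\<^sup>+\<^sup>1)\<^sup>N\<close>.\<close>

definition admissible_data ::
    "'n::finite itself \<Rightarrow> real \<Rightarrow> (real \<Rightarrow> real) \<Rightarrow> (real \<Rightarrow> real) \<Rightarrow> bool" where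
  "admissible_data _ s \<rho>\<^sub>0 u\<^sub>0 \<longleftrightarrow>
     (\<forall>r\<ge>0. \<rho>\<^sub>0 r \<ge> 0) \<and>
     C1_on (radial_scalar \<rho>\<^sub>0 :: real ^ 'n \<Rightarrow> real) UNIV \<and>
     C1_on (radial_field u\<^sub>0 :: real ^ 'n \<Rightarrow> real ^ 'n) UNIV \<and>
     sobolev s (radial_scalar \<rho>\<^sub>0 :: real ^ 'n \<Rightarrow> real) \<and>
     (\<forall>i. sobolev (s + 1) (\<lambda>x :: real ^ 'n. radial_field u\<^sub>0 x $ i))"

definition time_interval :: "ereal \<Rightarrow> real set" where
  "time_interval T = {t. 0 \<le> t \<and> ereal t < T}"

text \<open>
  Classical solutions on \<open>[0,T)\<close>, \<open>0 < T \<le> \<infinity>\<close>: density and velocity are continuously differentiable as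
  functions of time and of the space variable in \<open>\<real>\<^sup>N\<close>, up to \<open>t = 0\<close> and across the origin, so the
  smooth solutions given by the local theory belong to this class. The normalisation \<open>u t 0 = 0\<close> is
  forced by continuity of \<open>u x / r\<close> at the origin.
\<close>

definition euler_poisson_solution ::
    "'n::finite itself \<Rightarrow> real \<Rightarrow> ereal \<Rightarrow> (real \<Rightarrow> real \<Rightarrow> real) \<Rightarrow> (real \<Rightarrow> real \<Rightarrow> real)
       \<Rightarrow> (real \<Rightarrow> real \<Rightarrow> real) \<Rightarrow> bool" where
  "euler_poisson_solution _ k T \<rho> u \<phi> \<longleftrightarrow>
     T > 0 \<and>
     C1_on (\<lambda>(t, x :: real ^ 'n). radial_scalar (\<rho> t) x) (time_interval T \<times> UNIV) \<and>
     C1_on (\<lambda>(t, x :: real ^ 'n). radial_field (u t) x) (time_interval T \<times> UNIV) \<and>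
     (\<forall>t\<in>time_interval T. u t 0 = 0) \<and>
     (\<forall>t\<in>time_interval T. \<forall>r>0. t > 0 \<longrightarrow>
        deriv (\<lambda>\<tau>. \<rho> \<tau> r) t
          + deriv (\<lambda>\<xi>. \<rho> t \<xi> * u t \<xi> * \<xi> ^ (CARD('n) - 1)) r / r ^ (CARD('n) - 1) = 0 \<and>
        deriv (\<lambda>\<tau>. u \<tau> r) t + u t r * deriv (u t) r = - k * deriv (\<phi> t) r) \<and>
     (\<forall>t\<in>time_interval T. \<forall>r>0.
        \<phi> t differentiable at r \<and>
        ((\<lambda>\<xi>. \<xi> ^ (CARD('n) - 1) * deriv (\<phi> t) \<xi>)
            has_real_derivative - (r ^ (CARD('n) - 1) * \<rho> t r)) (at r)) \<and>
     (\<forall>t\<in>time_interval T.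
        ((\<lambda>r. r ^ (CARD('n) - 1) * deriv (\<phi> t) r) \<longlongrightarrow> 0) (at_right 0) \<and>
        ((\<lambda>r. \<rho> t r * u t r * r ^ (CARD('n) - 1)) \<longlongrightarrow> 0) (at_right 0))"

text \<open>\<open>\<parallel>\<nabla>u\<parallel>\<^sub>\<infinity>\<close> for the vector field \<open>u x / r\<close> on \<open>\<real>\<^sup>N\<close>.\<close>

definition gradient_sup :: "'n::finite itself \<Rightarrow> (real \<Rightarrow> real) \<Rightarrow> ennreal" where
  "gradient_sup _ v =
     (SUP x :: real ^ 'n. ennreal (onorm (frechet_derivative (radial_field v) (at x))))"

text \<open>
  By the continuation criterion of the local theory, a solution that cannot be continued beyond a
  finite \<open>T\<close> has \<open>\<integral>\<^sub>0\<^sup>T \<parallel>\<nabla>u\<parallel>\<^sub>\<infinity> dt = \<infinity>\<close>; this is the form in which maximality is expressed.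
\<close>

definition maximal_solution ::
    "'n::finite itself \<Rightarrow> real \<Rightarrow> ereal \<Rightarrow> (real \<Rightarrow> real \<Rightarrow> real) \<Rightarrow> (real \<Rightarrow> real \<Rightarrow> real)
       \<Rightarrow> (real \<Rightarrow> real \<Rightarrow> real) \<Rightarrow> bool" where
  "maximal_solution N k T \<rho> u \<phi> \<longleftrightarrow>
     euler_poisson_solution N k T \<rho> u \<phi> \<and>
     (T = \<infinity> \<or> (\<integral>\<^sup>+ t\<in>time_interval T. gradient_sup N (u t) \<partial>lborel) = \<infinity>)"

text \<open>The quantity \<open>A\<^sub>0\<close>, in terms of the initial profiles.\<close>

definition A0 :: "real \<Rightarrow> (real \<Rightarrow> real) \<Rightarrow> (real \<Rightarrow> real) \<Rightarrow> (real \<Rightarrow> real) \<Rightarrow> real \<Rightarrow> real" where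
  "A0 k \<rho>\<^sub>0 u\<^sub>0 \<phi>\<^sub>0 r = (u\<^sub>0 r * deriv u\<^sub>0 r + k * deriv \<phi>\<^sub>0 r) / (r * \<rho>\<^sub>0 r)"

text \<open>One-sided at \<open>r = 0\<close>, the usual derivative for \<open>r > 0\<close>.\<close>

definition radial_deriv :: "(real \<Rightarrow> real) \<Rightarrow> real \<Rightarrow> real" where
  "radial_deriv v r = vector_derivative v (at r within {0..})"

text \<open>
  Breakdown at the finite lifespan \<open>t\<^sub>c\<close>: along a particle path \<open>X\<close> arriving at the location \<open>r\<close> at time
  \<open>t\<^sub>c\<close>, the velocity gradient blows up and the density tends to \<open>\<infinity>\<close> or to \<open>0\<close>. The location satisfies
  \<open>r > 0\<close>, except that a vacuum core (no initial mass inside the starting radius \<open>X 0\<close>) may be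
  transported freely into the origin. That exception cannot be removed: if \<open>\<rho>\<^sub>0\<close> vanishes near the
  origin and \<open>u\<^sub>0 = - c r + r\<^sup>3\<close> there with \<open>c\<close> large, the first singularity can form at \<open>t = 1/c\<close>
  at the origin only.
\<close>

definition finite_time_breakdown ::
    "ereal \<Rightarrow> (real \<Rightarrow> real \<Rightarrow> real) \<Rightarrow> (real \<Rightarrow> real \<Rightarrow> real) \<Rightarrow> bool" where
  "finite_time_breakdown T \<rho> u \<longleftrightarrow>
     (\<exists>t\<^sub>c X r. t\<^sub>c > 0 \<and> T = ereal t\<^sub>c \<and>
        (\<forall>t\<in>{0..<t\<^sub>c}. X t \<ge> 0 \<and> (X has_real_derivative u t (X t)) (at t within {0..<t\<^sub>c})) \<and>
        (X \<longlongrightarrow> r) (at_left t\<^sub>c) \<and>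
        (r > 0 \<or> r = 0 \<and> (\<forall>\<xi>\<in>{0..X 0}. \<rho> 0 \<xi> = 0)) \<and>
        filterlim (\<lambda>t. \<bar>radial_deriv (u t) (X t)\<bar>) at_top (at_left t\<^sub>c) \<and>
        (filterlim (\<lambda>t. \<rho> t (X t)) at_top (at_left t\<^sub>c) \<or>
         ((\<lambda>t. \<rho> t (X t)) \<longlongrightarrow> 0) (at_left t\<^sub>c)))"

end

theory Submission
  imports Defs
begin

text \<open>
  Follow the shell of initial radius \<open>a\<close>: its radius is \<open>X = a \<eta>\<close>, the mass \<open>m\<close> inside it is conserved,
  and \<open>X'' = k m / X\<^sup>N\<^sup>-\<^sup>1\<close>. Its energy \<open>E(a) = u\<^sub>0\<^sup>2 / 2 + k m a\<^sup>2\<^sup>-\<^sup>N / (N - 2)\<close> is conserved too, and the condition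
  on \<open>A\<^sub>0\<close> says exactly that \<open>E'(r\<^sub>c) \<le> 0\<close>. Differentiating the energy identity in \<open>a\<close> shows that
  \<open>\<Gamma> / X'\<close>, where \<open>\<Gamma> = \<partial>X/\<partial>a\<close>, has time derivative at most \<open>E'(a) / (2 E(a)) < 0\<close> once \<open>X' > 0\<close> if \<open>E'(a) < 0\<close>,
  so \<open>\<Gamma>\<close> vanishes in finite time. If \<open>E'(r\<^sub>c) = 0\<close> and \<open>N = 3\<close>, the remaining term \<open>- k a\<^sup>2 \<rho>\<^sub>0 / X\<close> still
  forces \<open>\<Gamma> / X'\<close> to decrease logarithmically; if \<open>N \<ge> 4\<close>, the data are in Sobolev spaces, so \<open>E\<close>
  tends to \<open>0\<close> at infinity and \<open>E' < 0\<close> at some larger radius. Hence the lifespan \<open>T\<close> is finite.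

  If neither \<open>\<eta>\<close> nor \<open>\<Gamma>\<close> tended to \<open>0\<close> along any shell as \<open>t \<rightarrow> T\<close>, then by compactness, and by the decay of
  \<open>\<rho>\<^sub>0\<close>, \<open>u\<^sub>0\<close> and \<open>u\<^sub>0'\<close> at infinity, the velocity gradient would stay bounded, against maximality. A shell
  with \<open>\<eta> \<rightarrow> 0\<close> encloses vacuum, which then collapses onto the origin; one with \<open>\<Gamma> \<rightarrow> 0\<close> arrives at a
  positive radius, and there \<open>u\<^sub>r = \<Gamma>' / \<Gamma>\<close> blows up while \<open>\<rho> = \<rho>\<^sub>0 / (\<eta>\<^sup>N\<^sup>-\<^sup>1 \<Gamma>)\<close>.
\<close>

section \<open>Decay at infinity of Sobolev functions\<close>

text \<open>Two difficulties shape the proof. The solution is only \<open>C^1\<close>, so the label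
  derivative of the flow cannot be obtained by differentiating the equations freely, and the centre
  \<open>a = 0\<close> does not allow division by \<open>a\<close>. Both are met by one divided
  difference \<open>W\<close>, an exponential of averaged velocity gradients, with
  \<open>\<Gamma> = W t a a\<close> and \<open>\<eta> = W t a 0\<close>: it is positive by
  construction and continuous in time and labels. Newton's law is kept in integral form, and that
  form is differentiated in the label.

  The split by dimension in the borderline case has two causes. As \<open>\<eta>\<close> grows at
  most linearly, the term \<open>k \<rho> / \<eta>^(N - 2)\<close> is at least of order
  \<open>1 / t\<close> when \<open>N = 3\<close>, with divergent integral; for
  \<open>N \<ge> 4\<close> it may be integrable and then forces nothing. On the other hand, square
  integrability of the density gives an enclosed mass \<open>o(a^(N/2))\<close>, and
  \<open>N / 2 \<le> N - 2\<close>, which is what the decay of \<open>E\<close> asks for, holds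
  exactly when \<open>N \<ge> 4\<close>.\<close>

lemma nn_integral_one_plus_square_powr_finite:
  fixes p :: real
  assumes "p > 1 / 2"
  shows "(\<integral>\<^sup>+x. ennreal ((1 + x\<^sup>2) powr (- p)) \<partial>lborel) < \<infinity>"
proof -
  \<comment> \<open>\<open>h\<close> comes from
    \<open>(1 + \<bar>x\<bar>)\<^sup>2 \<le> 2 * (1 + x\<^sup>2)\<close>; unlike the integrand it
    has an explicit primitive on the half-line, namely \<open>H\<close>.\<close>
  define h where "h x = 2 powr p * (1 + x) powr (- 2 * p)" for x :: real
  define H where "H x = - (2 powr p * (1 + x) powr (1 - 2 * p) / (2 * p - 1))" for x :: real
  have [measurable]: "h \<in> borel_measurable borel"
    unfolding h_def by measurable
  have lim: "((\<lambda>x. H x) \<longlongrightarrow> 0) at_top"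
  proof -
    have "((\<lambda>x::real. (1 + x) powr (1 - 2 * p)) \<longlongrightarrow> 0) at_top"
      using assms
      by (intro tendsto_neg_powr filterlim_tendsto_add_at_top[OF tendsto_const filterlim_ident]) auto
    then have "((\<lambda>x. - (2 powr p * (1 + x) powr (1 - 2 * p) / (2 * p - 1)))
        \<longlongrightarrow> - (2 powr p * 0 / (2 * p - 1))) at_top"
      using assms by (intro tendsto_intros) auto
    then show ?thesis unfolding H_def by simp
  qed
  have der: "DERIV H x :> h x" if "x \<ge> 0" for x
  proof -
    have "(H has_real_derivative - (2 powr p * ((1 - 2 * p) * (1 + x) powr (1 - 2 * p - 1)) / (2 * p - 1))) (at x)"
      unfolding H_def using that assms
      by (auto intro!: derivative_eq_intros)
    moreover have "- (2 powr p * ((1 - 2 * p) * (1 + x) powr (1 - 2 * p - 1)) / (2 * p - 1)) = h x"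
      unfolding h_def using assms by (simp add: field_simps)
    ultimately show ?thesis by simp
  qed
  have half: "(\<integral>\<^sup>+x. ennreal (h x) * indicator {0 ..} x \<partial>lborel) = ennreal (0 - H 0)"
    by (rule nn_integral_FTC_atLeast[OF _ der _ lim]) (auto simp: h_def)
  have refl: "(\<integral>\<^sup>+x. ennreal (h (-x)) * indicator {0 ..} (-x) \<partial>lborel) = (\<integral>\<^sup>+x. ennreal (h x) * indicator {0 ..} x \<partial>lborel)"
    using nn_integral_real_affine[of "\<lambda>x. ennreal (h x) * indicator {0 ..} x" "-1" 0] by simp
  have "ennreal ((1 + x\<^sup>2) powr (- p)) \<le> ennreal (h x) * indicator {0 ..} x + ennreal (h (-x)) * indicator {0 ..} (-x)"
    for x :: real
  proof -
    have "(1 + \<bar>x\<bar>)\<^sup>2 / 2 \<le> 1 + x\<^sup>2"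
      using sum_squares_bound[of 1 "\<bar>x\<bar>"] by (simp add: power2_eq_square algebra_simps)
    then have "(1 + x\<^sup>2) powr (- p) \<le> ((1 + \<bar>x\<bar>)\<^sup>2 / 2) powr (- p)"
      using assms by (intro powr_mono2') (auto intro: divide_pos_pos add_pos_nonneg)
    also have "\<dots> = h \<bar>x\<bar>"
      unfolding h_def by (simp add: powr_divide powr_minus_divide powr_power[symmetric] powr_powr flip: powr_numeral)
    finally have "(1 + x\<^sup>2) powr (- p) \<le> h \<bar>x\<bar>" .
    then have le: "ennreal ((1 + x\<^sup>2) powr (- p)) \<le> ennreal (h \<bar>x\<bar>)"
      by (rule ennreal_leI)
    have "ennreal (h \<bar>x\<bar>) \<le> ennreal (h x) * indicator {0 ..} x + ennreal (h (-x)) * indicator {0 ..} (-x)"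
      by (cases "x \<ge> 0") (auto simp: indicator_def)
    with le show ?thesis by (rule order_trans)
  qed
  then have "(\<integral>\<^sup>+x. ennreal ((1 + x\<^sup>2) powr (- p)) \<partial>lborel)
      \<le> (\<integral>\<^sup>+x. (ennreal (h x) * indicator {0 ..} x + ennreal (h (-x)) * indicator {0 ..} (-x)) \<partial>lborel)"
    by (intro nn_integral_mono) auto
  also have "\<dots> = ennreal (0 - H 0) + ennreal (0 - H 0)"
    by (subst nn_integral_add) (auto simp: half refl)
  also have "\<dots> < \<infinity>" by simp
  finally show ?thesis .
qed

text \<open>Spreading the exponent evenly over the coordinates, with
  \<open>p = s / N > 1 / 2\<close>, bounds the integrand by a product of functions of one variable:
  each \<open>(x \<bullet> b)\<^sup>2\<close> is at most \<open>(norm x)\<^sup>2\<close>, and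
  negative powers reverse the order.\<close>

lemma integrable_one_plus_norm_square_powr:
  fixes s :: real
  assumes "s > real DIM('a::euclidean_space) / 2"
  shows "integrable lborel (\<lambda>x::'a. (1 + (norm x)\<^sup>2) powr (- s))"
proof -
  define N where "N = real DIM('a)"
  define p where "p = s / N"
  have N: "N > 0" unfolding N_def by simp
  have p: "p > 1 / 2" "s = p * N"
    using assms N unfolding p_def N_def by (auto simp: field_simps)
  have bound: "(1 + (norm x)\<^sup>2) powr (- s) \<le> (\<Prod>b\<in>Basis. (1 + (x \<bullet> b)\<^sup>2) powr (- p))" for x :: 'a
  proof -
    have "(1 + (norm x)\<^sup>2) powr (- s) = (\<Prod>b\<in>(Basis::'a set). (1 + (norm x)\<^sup>2) powr (- p))"
    proof -
      have "1 + (norm x)\<^sup>2 > 0" by (simp add: add_pos_nonneg)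
      then show ?thesis
        using p(2) by (simp add: N_def powr_powr flip: powr_realpow)
    qed
    also have "\<dots> \<le> (\<Prod>b\<in>Basis. (1 + (x \<bullet> b)\<^sup>2) powr (- p))"
    proof (intro prod_mono conjI powr_mono2')
      fix b :: 'a assume b: "b \<in> Basis"
      have "\<bar>x \<bullet> b\<bar> \<le> norm x" using Basis_le_norm[OF b] .
      then show "1 + (x \<bullet> b)\<^sup>2 \<le> 1 + (norm x)\<^sup>2"
        by (metis abs_ge_zero add_left_mono power2_abs power_mono)
    qed (use p in \<open>auto simp: add_pos_nonneg\<close>)
    finally show ?thesis .
  qed
  have "(\<integral>\<^sup>+x. ennreal ((1 + (norm x)\<^sup>2) powr (- s)) \<partial>(lborel::'a measure))
      \<le> (\<integral>\<^sup>+x. (\<Prod>b\<in>Basis. ennreal ((1 + (x \<bullet> b)\<^sup>2) powr (- p))) \<partial>(lborel::'a measure))"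
    by (intro nn_integral_mono) (simp add: prod_ennreal ennreal_leI bound)
  also have "\<dots> = (\<Prod>b\<in>(Basis::'a set). (\<integral>\<^sup>+x. ennreal ((1 + x\<^sup>2) powr (- p)) \<partial>lborel))"
    by (rule nn_integral_lborel_prod) auto
  also have "\<dots> < \<infinity>"
    using nn_integral_one_plus_square_powr_finite[OF p(1)] by (simp add: power_less_top_ennreal)
  finally show ?thesis
    by (intro integrableI_nonneg) auto
qed

text \<open>If \<open>F\<close> is at least \<open>\<epsilon>\<close> at a point, it is at least \<open>\<epsilon>/2\<close> on a ball of fixed radius about it.\<close>

lemma lipschitz_square_integrable_tendsto_0:
  fixes F :: "'a::euclidean_space \<Rightarrow> 'b::euclidean_space"
  assumes lip: "L-lipschitz_on UNIV F" and int: "integrable lborel (\<lambda>x. (norm (F x))\<^sup>2)"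
  shows "(F \<longlongrightarrow> 0) at_infinity"
proof (rule tendstoI)
  fix \<epsilon> :: real assume \<epsilon>: "\<epsilon> > 0"
  have L: "L \<ge> 0" using lip by (rule lipschitz_on_nonneg)
  define \<delta> where "\<delta> = \<epsilon> / (2 * (L + 1))"
  have \<delta>: "\<delta> > 0" using \<epsilon> L by (simp add: \<delta>_def)
  \<comment> \<open>Such a ball contributes at least \<open>c\<close> to the integral of the square,
    so it cannot lie in a region where the tail \<open>tl n\<close> is below
    \<open>c\<close>.\<close>
  define c where "c = (\<epsilon> / 2)\<^sup>2 * measure lborel (ball (0::'a) \<delta>)"
  have c: "c > 0" unfolding c_def using \<epsilon> \<delta> by (simp add: content_ball_pos)
  define tl where "tl n = (LINT x|lborel. indicator {x::'a. norm x \<ge> real n} x * (norm (F x))\<^sup>2)" for n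
  have "tl \<longlonglongrightarrow> (LINT x|(lborel::'a measure). 0)"
    unfolding tl_def
  proof (rule integral_dominated_convergence[where w="\<lambda>x. (norm (F x))\<^sup>2"])
    show "AE x in (lborel::'a measure). (\<lambda>n. indicator {x. norm x \<ge> real n} x * (norm (F x))\<^sup>2) \<longlonglongrightarrow> 0"
    proof (rule AE_I2, rule tendsto_eventually)
      fix x :: 'a
      have "eventually (\<lambda>n. real n > norm x) sequentially"
        using filterlim_real_sequentially by (rule filterlim_at_top_dense[THEN iffD1, rule_format])
      then show "eventually (\<lambda>n. indicator {x. norm x \<ge> real n} x * (norm (F x))\<^sup>2 = 0) sequentially"
        by eventually_elim (auto simp: indicator_def)
    qed
  qed (use int in \<open>auto simp: indicator_def\<close>)
  then have "eventually (\<lambda>n. tl n < c) sequentially"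
    using c by (simp add: order_tendsto_iff)
  then obtain n where n: "tl n < c" by (auto simp: eventually_sequentially)
  have small: "norm (F x) < \<epsilon>" if x: "norm x \<ge> real n + \<delta>" for x
  proof (rule ccontr)
    assume "\<not> norm (F x) < \<epsilon>"
    then have Fx: "norm (F x) \<ge> \<epsilon>" by simp
    have pointwise: "(\<epsilon> / 2)\<^sup>2 * indicator (ball x \<delta>) y \<le> indicator {x. norm x \<ge> real n} y * (norm (F y))\<^sup>2" for y
    proof (cases "y \<in> ball x \<delta>")
      case True
      have "dist (F x) (F y) \<le> L * dist x y" using lip by (auto simp: lipschitz_on_def)
      also have "\<dots> \<le> (L + 1) * \<delta>" using True L by (intro mult_mono) auto
      also have "\<dots> = \<epsilon> / 2" using L by (simp add: \<delta>_def divide_simps)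
      finally have "norm (F x - F y) \<le> \<epsilon> / 2" by (simp add: dist_norm)
      then have "norm (F y) \<ge> \<epsilon> / 2"
        using Fx norm_triangle_ineq2[of "F x" "F y"] by linarith
      moreover have "norm y \<ge> real n"
        using x True norm_triangle_ineq2[of x y] by (auto simp: dist_norm)
      ultimately show ?thesis using True \<epsilon> by (auto intro: power_mono)
    qed (auto simp: indicator_def)
    then have "(LINT y|lborel. (\<epsilon> / 2)\<^sup>2 * indicator (ball x \<delta>) y) \<le> tl n"
      unfolding tl_def
    proof (intro integral_mono)
      have "(\<lambda>y. indicator {x. norm x \<ge> real n} y * (norm (F y))\<^sup>2) \<in> borel_measurable lborel"
        using borel_measurable_integrable[OF int] by measurable
      then show "integrable lborel (\<lambda>y. indicator {x. norm x \<ge> real n} y * (norm (F y))\<^sup>2)"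
        by (rule Bochner_Integration.integrable_bound[OF int]) (auto simp: indicator_def)
      have "emeasure lborel (ball x \<delta>) < \<infinity>" by (rule emeasure_bounded_finite) auto
      then show "integrable lborel (\<lambda>y. (\<epsilon> / 2)\<^sup>2 * indicator (ball x \<delta>) y)" by simp
    qed (rule pointwise)
    also have "(LINT y|lborel. (\<epsilon> / 2)\<^sup>2 * indicator (ball x \<delta>) y) = c"
      unfolding c_def using content_ball_conv_unit_ball[of \<delta> x] content_ball_conv_unit_ball[of \<delta> "0::'a"] \<delta>
      by simp
    finally show False using n by simp
  qed
  show "eventually (\<lambda>x. dist (F x) 0 < \<epsilon>) at_infinity"
    unfolding eventually_at_infinity using small by auto
qed

lemma norm_cis_diff_le: "cmod (cis a - cis b) \<le> \<bar>a - b\<bar>"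
proof -
  have "cis a - cis b = cis b * (exp (\<i> * of_real (a - b)) - 1)"
    by (simp add: cis_conv_exp exp_diff ring_distribs exp_add field_simps)
  then have "cmod (cis a - cis b) = 2 * \<bar>sin ((a - b) / 2)\<bar>"
    using dist_exp_i_1[of "a - b"] by (simp add: norm_mult)
  also have "\<dots> \<le> 2 * \<bar>(a - b) / 2\<bar>"
    using abs_sin_x_le_abs_x[of "(a - b) / 2"] by simp
  finally show ?thesis by simp
qed

text \<open>The Sobolev weight puts the transform \<open>g\<close> in \<open>L^1\<close>, so the
  truncated inversion integrals \<open>FR R\<close> converge uniformly to the full one,
  \<open>F\<close>. Each \<open>FR R\<close> is Lipschitz and, for large \<open>R\<close>, square
  integrable, so \<open>lipschitz_square_integrable_tendsto_0\<close> applies to it, and the uniform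
  limit also tends to 0. With one more order of decay of \<open>g\<close> the difference quotients
  along \<open>e\<close> converge uniformly, and the derivative inherits the limit.\<close>

lemma sobolev_tendsto_0:
  fixes f :: "real ^ 'n::finite \<Rightarrow> real"
  assumes s: "s > real CARD('n) / 2" and f: "sobolev s f" and cont: "continuous_on UNIV f"
  shows "(f \<longlongrightarrow> 0) at_infinity"
    and "\<lbrakk>s > real CARD('n) / 2 + 1; norm e = 1; \<And>y::real. ((\<lambda>y. f (y *\<^sub>R e)) has_real_derivative h' y) (at y)\<rbrakk>
      \<Longrightarrow> (h' \<longlongrightarrow> 0) at_top"
proof -
  obtain g where g [measurable]: "g \<in> borel_measurable lborel"
    and gs: "integrable lborel (\<lambda>\<xi>. (1 + (norm \<xi>)\<^sup>2) powr s * (cmod (g \<xi>))\<^sup>2)"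
    and ft: "is_fourier_transform f g"
    using f by (auto simp: sobolev_def)
  have fm [measurable]: "f \<in> borel_measurable borel" and f2: "integrable lborel (\<lambda>x. (f x)\<^sup>2)"
    using f by (auto simp: sobolev_def)
  have cis_meas [measurable]: "cis \<in> borel_measurable borel"
    by (intro borel_measurable_continuous_onI continuous_intros)
  define c where "c = (2 * pi) powr (- real CARD('n) / 2)"
  have c: "c > 0" by (simp add: c_def)
  \<comment> \<open>With the factors \<open>A\<close> and \<open>B\<close> below,
    \<open>A * B \<le> A\<^sup>2 + B\<^sup>2\<close> separates the Sobolev weight from an integrable
    power. The case \<open>p = 0\<close> gives the integrability of \<open>g\<close>, the case
    \<open>p = 1\<close> that of its first moment.\<close>
  have weighted: "integrable lborel (\<lambda>\<xi>. (1 + (norm \<xi>)\<^sup>2) powr (p / 2) * cmod (g \<xi>))"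
    if p: "s - p > real CARD('n) / 2" for p
  proof (rule Bochner_Integration.integrable_bound)
    show "integrable lborel (\<lambda>\<xi>. (1 + (norm \<xi>)\<^sup>2) powr s * (cmod (g \<xi>))\<^sup>2 + (1 + (norm \<xi>)\<^sup>2) powr (- (s - p)))"
      using gs integrable_one_plus_norm_square_powr[of "s - p", where 'a="real^'n"] p by simp
    show "AE \<xi> in lborel. norm ((1 + (norm \<xi>)\<^sup>2) powr (p / 2) * cmod (g \<xi>))
        \<le> norm ((1 + (norm \<xi>)\<^sup>2) powr s * (cmod (g \<xi>))\<^sup>2 + (1 + (norm \<xi>)\<^sup>2) powr (- (s - p)))"
    proof (rule AE_I2)
      fix \<xi> :: "real^'n"
      define w where "w = 1 + (norm \<xi>)\<^sup>2"
      have w: "w > 0" by (simp add: w_def add_pos_nonneg)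
      define A B where "A = w powr (s / 2) * cmod (g \<xi>)" and "B = w powr (- (s - p) / 2)"
      have "w powr (p / 2) * cmod (g \<xi>) = A * B"
        using w by (simp add: A_def B_def field_simps flip: powr_add)
      also have "A * B \<le> A\<^sup>2 + B\<^sup>2"
      proof -
        have "A * B \<ge> 0" by (simp add: A_def B_def)
        then show ?thesis using sum_squares_bound[of A B] by linarith
      qed
      also have "\<dots> = w powr s * (cmod (g \<xi>))\<^sup>2 + w powr (- (s - p))"
        using w by (simp add: A_def B_def power_mult_distrib power2_eq_square flip: powr_add)
      finally show "norm ((1 + (norm \<xi>)\<^sup>2) powr (p / 2) * cmod (g \<xi>))
        \<le> norm ((1 + (norm \<xi>)\<^sup>2) powr s * (cmod (g \<xi>))\<^sup>2 + (1 + (norm \<xi>)\<^sup>2) powr (- (s - p)))"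
        by (simp add: w_def)
    qed
  qed measurable
  have gn: "integrable lborel (\<lambda>\<xi>. cmod (g \<xi>))"
  proof -
    have "1 + (norm \<xi>)\<^sup>2 \<noteq> 0" for \<xi> :: "real^'n"
      using zero_le_power2[of "norm \<xi>"] by linarith
    then show ?thesis using weighted[of 0] s by simp
  qed
  have gi: "integrable lborel g"
    using gn by (subst (asm) integrable_norm_iff) auto
  define K where "K = (LINT \<xi>|lborel. cmod (g \<xi>))"
  have K: "K \<ge> 0" unfolding K_def by simp
  have gci: "integrable lborel (\<lambda>\<xi>. g \<xi> * cis (\<xi> \<bullet> x))" for x
    by (rule Bochner_Integration.integrable_bound[OF gi]) (auto simp: norm_mult)
  have gcR: "integrable lborel (\<lambda>\<xi>. indicator (cball 0 R) \<xi> *\<^sub>R (g \<xi> * cis (\<xi> \<bullet> x)))" for R x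
    by (rule Bochner_Integration.integrable_bound[OF gci[of x]]) (auto simp: norm_mult indicator_def)
  define F where "F x = c * (LINT \<xi>|lborel. g \<xi> * cis (\<xi> \<bullet> x))" for x
  define FR where "FR R x = c * (LINT \<xi>:cball 0 R|lborel. g \<xi> * cis (\<xi> \<bullet> x))" for R x
  have FR_alt: "FR R x = c * (LINT \<xi>|lborel. indicator (cball 0 R) \<xi> *\<^sub>R (g \<xi> * cis (\<xi> \<bullet> x)))" for R x
    by (simp add: FR_def set_lebesgue_integral_def)
  have FR_lip: "(c * (\<bar>R\<bar> * K))-lipschitz_on UNIV (FR R)" for R
  proof (rule lipschitz_onI)
    fix x y
    have "norm ((LINT \<xi>|lborel. indicator (cball 0 R) \<xi> *\<^sub>R (g \<xi> * cis (\<xi> \<bullet> x)))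
        - (LINT \<xi>|lborel. indicator (cball 0 R) \<xi> *\<^sub>R (g \<xi> * cis (\<xi> \<bullet> y))))
      = norm (LINT \<xi>|lborel. indicator (cball 0 R) \<xi> *\<^sub>R (g \<xi> * cis (\<xi> \<bullet> x)) - indicator (cball 0 R) \<xi> *\<^sub>R (g \<xi> * cis (\<xi> \<bullet> y)))"
      by (subst Bochner_Integration.integral_diff) (use gcR in auto)
    also have "\<dots> \<le> (LINT \<xi>|lborel. (\<bar>R\<bar> * dist x y) * cmod (g \<xi>))"
    proof (rule order_trans[OF integral_norm_bound integral_mono])
      fix \<xi> :: "real^'n"
      show "norm (indicator (cball 0 R) \<xi> *\<^sub>R (g \<xi> * cis (\<xi> \<bullet> x)) - indicator (cball 0 R) \<xi> *\<^sub>R (g \<xi> * cis (\<xi> \<bullet> y)))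
         \<le> (\<bar>R\<bar> * dist x y) * cmod (g \<xi>)"
      proof (cases "\<xi> \<in> cball 0 R")
        case True
        have "cmod (cis (\<xi> \<bullet> x) - cis (\<xi> \<bullet> y)) \<le> \<bar>\<xi> \<bullet> (x - y)\<bar>"
          using norm_cis_diff_le[of "\<xi> \<bullet> x" "\<xi> \<bullet> y"] by (simp add: inner_diff_right)
        also have "\<dots> \<le> norm \<xi> * norm (x - y)" by (rule Cauchy_Schwarz_ineq2)
        also have "\<dots> \<le> \<bar>R\<bar> * dist x y" using True by (auto simp: dist_norm intro!: mult_right_mono)
        finally show ?thesis using True
          by (simp add: norm_mult mult.commute mult_left_mono flip: right_diff_distrib)
      qed simp
    qed (use gn gcR in auto)
    also have "\<dots> = (\<bar>R\<bar> * K) * dist x y" by (simp add: K_def)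
    finally show "dist (FR R x) (FR R y) \<le> c * (\<bar>R\<bar> * K) * dist x y"
      using c by (simp add: FR_alt dist_norm norm_mult flip: right_diff_distrib)
  qed (use c K in simp)
  have FR_meas [measurable]: "FR R \<in> borel_measurable borel" for R
    using lipschitz_on_continuous_on[OF FR_lip] by (rule borel_measurable_continuous_onI)
  have FRlim: "((\<lambda>R. \<integral>\<^sup>+ x. ennreal ((cmod (complex_of_real (f x) - FR R x))\<^sup>2) \<partial>lborel) \<longlongrightarrow> 0) at_top"
    using ft by (simp add: is_fourier_transform_def FR_def c_def)
  \<comment> \<open>The error is at most a multiple of the \<open>L^1\<close> norm of
    \<open>g\<close> outside the ball of radius \<open>R\<close>, whatever \<open>x\<close>
    is.\<close>
  have unif: "\<exists>R0. \<forall>R\<ge>R0. \<forall>x. cmod (F x - FR R x) < \<epsilon>" if \<epsilon>: "\<epsilon> > 0" for \<epsilon>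
  proof -
    have "((\<lambda>R. LINT \<xi>|lborel. indicator (- cball 0 R) \<xi> * cmod (g \<xi>)) \<longlongrightarrow> (LINT \<xi>|(lborel::(real^'n) measure). 0)) at_top"
    proof (rule integral_dominated_convergence_at_top[where w="\<lambda>\<xi>. cmod (g \<xi>)"])
      show "AE \<xi> in (lborel::(real^'n) measure). ((\<lambda>R. indicator (- cball 0 R) \<xi> * cmod (g \<xi>)) \<longlongrightarrow> 0) at_top"
      proof (rule AE_I2, rule tendsto_eventually)
        fix \<xi> :: "real^'n"
        show "eventually (\<lambda>R. indicator (- cball 0 R) \<xi> * cmod (g \<xi>) = 0) at_top"
          using eventually_ge_at_top[of "norm \<xi>"] by eventually_elim (auto simp: indicator_def)
      qed
      show "\<forall>\<^sub>F R in at_top. AE \<xi> in lborel. norm (indicator (- cball 0 R) \<xi> * cmod (g \<xi>)) \<le> cmod (g \<xi>)"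
        by (intro always_eventually allI AE_I2) (auto simp: indicator_def)
    qed (use gn in auto)
    then have "((\<lambda>R. c * (LINT \<xi>|lborel. indicator (- cball 0 R) \<xi> * cmod (g \<xi>))) \<longlongrightarrow> c * 0) at_top"
      by (intro tendsto_mult tendsto_const) simp
    then have "eventually (\<lambda>R. c * (LINT \<xi>|lborel. indicator (- cball 0 R) \<xi> * cmod (g \<xi>)) < \<epsilon>) at_top"
      using \<epsilon> by (simp add: order_tendsto_iff)
    then obtain R0 where R0: "\<And>R. R \<ge> R0 \<Longrightarrow> c * (LINT \<xi>|lborel. indicator (- cball 0 R) \<xi> * cmod (g \<xi>)) < \<epsilon>"
      by (auto simp: eventually_at_top_linorder)
    have "cmod (F x - FR R x) < \<epsilon>" if "R \<ge> R0" for R x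
    proof -
      have "F x - FR R x = c * (LINT \<xi>|lborel. g \<xi> * cis (\<xi> \<bullet> x) - indicator (cball 0 R) \<xi> *\<^sub>R (g \<xi> * cis (\<xi> \<bullet> x)))"
        unfolding F_def FR_alt by (subst Bochner_Integration.integral_diff[OF gci gcR]) (simp add: right_diff_distrib)
      also have "cmod \<dots> = c * cmod (LINT \<xi>|lborel. g \<xi> * cis (\<xi> \<bullet> x) - indicator (cball 0 R) \<xi> *\<^sub>R (g \<xi> * cis (\<xi> \<bullet> x)))"
        using c by (simp add: norm_mult)
      also have "\<dots> \<le> c * (LINT \<xi>|lborel. indicator (- cball 0 R) \<xi> * cmod (g \<xi>))"
      proof (intro mult_left_mono order_trans[OF integral_norm_bound integral_mono])
        show "integrable lborel (\<lambda>\<xi>. indicator (- cball 0 R) \<xi> * cmod (g \<xi>))"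
          by (rule Bochner_Integration.integrable_bound[OF gn]) (auto simp: indicator_def)
      qed (use c gci gcR in \<open>auto simp: indicator_def norm_mult\<close>)
      finally show ?thesis using R0[OF that] by simp
    qed
    then show ?thesis by blast
  qed
  \<comment> \<open>Once the \<open>L^2\<close> distance from \<open>f\<close> to
    \<open>FR R\<close> is finite, square integrability passes from \<open>f\<close> to
    \<open>FR R\<close>.\<close>
  have FR_0: "\<exists>R0. \<forall>R\<ge>R0. (FR R \<longlongrightarrow> 0) at_infinity"
  proof -
    have "eventually (\<lambda>R. (\<integral>\<^sup>+ x. ennreal ((cmod (complex_of_real (f x) - FR R x))\<^sup>2) \<partial>lborel) < 1) at_top"
      using FRlim by (simp add: order_tendsto_iff)
    then obtain R0 where R0: "\<And>R. R \<ge> R0 \<Longrightarrow> (\<integral>\<^sup>+ x. ennreal ((cmod (complex_of_real (f x) - FR R x))\<^sup>2) \<partial>lborel) < 1"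
      by (auto simp: eventually_at_top_linorder)
    have "(FR R \<longlongrightarrow> 0) at_infinity" if R: "R \<ge> R0" for R
    proof (rule lipschitz_square_integrable_tendsto_0[OF FR_lip])
      have d: "integrable lborel (\<lambda>x. (cmod (complex_of_real (f x) - FR R x))\<^sup>2)"
        using R0[OF R] by (intro integrableI_nonneg) (auto intro: order.strict_trans)
      show "integrable lborel (\<lambda>x. (cmod (FR R x))\<^sup>2)"
      proof (rule Bochner_Integration.integrable_bound)
        show "integrable lborel (\<lambda>x. 2 * (f x)\<^sup>2 + 2 * (cmod (complex_of_real (f x) - FR R x))\<^sup>2)"
          using f2 d by simp
        show "AE x in lborel. norm ((cmod (FR R x))\<^sup>2) \<le> norm (2 * (f x)\<^sup>2 + 2 * (cmod (complex_of_real (f x) - FR R x))\<^sup>2)"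
        proof (rule AE_I2)
          fix x
          define A B where "A = \<bar>f x\<bar>" and "B = cmod (complex_of_real (f x) - FR R x)"
          have "cmod (FR R x) \<le> A + B"
            unfolding A_def B_def
            using norm_triangle_ineq4[of "complex_of_real (f x)" "complex_of_real (f x) - FR R x"] by simp
          then have "(cmod (FR R x))\<^sup>2 \<le> (A + B)\<^sup>2" by (intro power_mono) auto
          also have "\<dots> \<le> 2 * A\<^sup>2 + 2 * B\<^sup>2"
            using sum_squares_bound[of A B] by (simp add: power2_sum)
          finally show "norm ((cmod (FR R x))\<^sup>2) \<le> norm (2 * (f x)\<^sup>2 + 2 * (cmod (complex_of_real (f x) - FR R x))\<^sup>2)"
            by (simp add: A_def B_def)
        qed
      qed measurable
    qed
    then show ?thesis by blast
  qed
  have feq: "complex_of_real (f x) = F x" for x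
  proof (rule ccontr)
    assume "complex_of_real (f x) \<noteq> F x"
    \<comment> \<open>The factor 5 leaves room for four errors below \<open>\<epsilon>\<close>. On a
      whole ball about \<open>x\<close> the distance from \<open>f\<close> to \<open>FR R\<close> is
      then at least \<open>\<epsilon>\<close> for every large \<open>R\<close>, against convergence
      in \<open>L^2\<close>.\<close>
    define \<epsilon> where "\<epsilon> = cmod (complex_of_real (f x) - F x) / 5"
    have \<epsilon>: "\<epsilon> > 0" using \<open>complex_of_real (f x) \<noteq> F x\<close> by (simp add: \<epsilon>_def)
    obtain R0 where R0: "\<And>R x. R \<ge> R0 \<Longrightarrow> cmod (F x - FR R x) < \<epsilon>" using unif[OF \<epsilon>] by blast
    have "continuous_on UNIV (\<lambda>y. complex_of_real (f y) - FR R0 y)"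
      by (intro continuous_intros cont lipschitz_on_continuous_on[OF FR_lip])
    then obtain \<delta> where \<delta>: "\<delta> > 0"
      "\<And>y. dist y x < \<delta> \<Longrightarrow> dist (complex_of_real (f y) - FR R0 y) (complex_of_real (f x) - FR R0 x) < \<epsilon>"
      using \<epsilon> unfolding continuous_on_iff by blast
    have big: "cmod (complex_of_real (f y) - FR R y) \<ge> \<epsilon>" if y: "dist y x < \<delta>" and R: "R \<ge> R0" for y R
    proof -
      have "5 * \<epsilon> = cmod (complex_of_real (f x) - F x)" by (simp add: \<epsilon>_def)
      also have "complex_of_real (f x) - F x = (complex_of_real (f y) - FR R y) - (F y - FR R y) + (F y - FR R0 y)
         - (F x - FR R0 x) - ((complex_of_real (f y) - FR R0 y) - (complex_of_real (f x) - FR R0 x))"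
        by simp
      also have "cmod \<dots> \<le> cmod (complex_of_real (f y) - FR R y) + cmod (F y - FR R y) + cmod (F y - FR R0 y)
         + cmod (F x - FR R0 x) + cmod ((complex_of_real (f y) - FR R0 y) - (complex_of_real (f x) - FR R0 x))"
        by (intro order_trans[OF norm_triangle_ineq4] order_trans[OF norm_triangle_ineq] add_mono order_refl)
      finally show ?thesis
        using \<delta>(2)[OF y] R0[of R y] R0[of R0 y] R0[of R0 x] R by (simp add: dist_norm)
    qed
    define C where "C = ennreal (\<epsilon>\<^sup>2) * emeasure lborel (ball x \<delta>)"
    have "0 < measure lborel (ball x \<delta>)" using \<delta>(1) by (simp add: content_ball_pos)
    then have "C > 0"
      unfolding C_def using \<epsilon> by (auto simp: ennreal_zero_less_mult_iff measure_def zero_less_iff_neq_zero)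
    then have "eventually (\<lambda>R. (\<integral>\<^sup>+ x. ennreal ((cmod (complex_of_real (f x) - FR R x))\<^sup>2) \<partial>lborel) < C) at_top"
      using FRlim by (simp add: order_tendsto_iff)
    then obtain R where R: "R \<ge> R0" "(\<integral>\<^sup>+ x. ennreal ((cmod (complex_of_real (f x) - FR R x))\<^sup>2) \<partial>lborel) < C"
      using eventually_happens'[OF _ eventually_conj[OF eventually_ge_at_top[of R0]]] by fastforce
    have "C = (\<integral>\<^sup>+ y. ennreal (\<epsilon>\<^sup>2) * indicator (ball x \<delta>) y \<partial>lborel)"
      by (simp add: C_def nn_integral_cmult_indicator)
    also have "\<dots> \<le> (\<integral>\<^sup>+ x. ennreal ((cmod (complex_of_real (f x) - FR R x))\<^sup>2) \<partial>lborel)"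
    proof (rule nn_integral_mono)
      fix y :: "real^'n"
      show "ennreal (\<epsilon>\<^sup>2) * indicator (ball x \<delta>) y \<le> ennreal ((cmod (complex_of_real (f y) - FR R y))\<^sup>2)"
      proof (cases "y \<in> ball x \<delta>")
        case True
        then have "\<epsilon> \<le> cmod (complex_of_real (f y) - FR R y)"
          using R(1) by (intro big) (auto simp: dist_commute)
        then show ?thesis using True \<epsilon> by (auto intro!: ennreal_leI power_mono)
      qed simp
    qed
    finally show False using R(2) by simp
  qed
  show lim0: "(f \<longlongrightarrow> 0) at_infinity"
  proof (rule tendstoI)
    fix \<epsilon> :: real assume \<epsilon>: "\<epsilon> > 0"
    obtain R0 where R0: "\<And>R x. R \<ge> R0 \<Longrightarrow> cmod (F x - FR R x) < \<epsilon> / 2"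
      using unif[of "\<epsilon> / 2"] \<epsilon> by auto
    obtain R1 where R1: "\<And>R. R \<ge> R1 \<Longrightarrow> (FR R \<longlongrightarrow> 0) at_infinity" using FR_0 by blast
    define R where "R = max R0 R1"
    have "(FR R \<longlongrightarrow> 0) at_infinity" using R1[of R] by (simp add: R_def)
    then have "eventually (\<lambda>x. dist (FR R x) 0 < \<epsilon> / 2) at_infinity"
      using \<epsilon> by (intro tendstoD) auto
    then show "eventually (\<lambda>x. dist (f x) 0 < \<epsilon>) at_infinity"
    proof eventually_elim
      case (elim x)
      have "\<bar>f x\<bar> = cmod (F x)" using feq[of x] by (metis norm_of_real)
      also have "F x = (F x - FR R x) + FR R x" by simp
      also have "cmod \<dots> \<le> cmod (F x - FR R x) + cmod (FR R x)" by (rule norm_triangle_ineq)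
      finally show ?case using R0[of R x] elim by (simp add: R_def)
    qed
  qed
  assume s1: "s > real CARD('n) / 2 + 1" and e: "norm e = 1"
    and h': "\<And>y::real. ((\<lambda>y. f (y *\<^sub>R e)) has_real_derivative h' y) (at y)"
  \<comment> \<open>Up to a factor of modulus one, \<open>D \<delta> \<xi>\<close> is the error of
    the difference quotient in \<open>y\<close> of \<open>cis (y * (\<xi> \<bullet> e))\<close>.
    Integrated against \<open>cmod (g \<xi>)\<close> it gives \<open>\<omega> \<delta>\<close>, an
    error bound independent of \<open>y\<close>. The majorant \<open>2 * norm \<xi>\<close> also
    holds at \<open>\<delta> = 0\<close>, where the quotient is 0.\<close>
  define D where "D \<delta> \<xi> = (cis (\<delta> * (\<xi> \<bullet> e)) - 1) / of_real \<delta> - \<i> * of_real (\<xi> \<bullet> e)" for \<delta> and \<xi> :: "real^'n"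
  define \<omega> where "\<omega> \<delta> = c * (LINT \<xi>|lborel. cmod (g \<xi>) * cmod (D \<delta> \<xi>))" for \<delta>
  have D_meas [measurable]: "D \<delta> \<in> borel_measurable borel" for \<delta>
    unfolding D_def by measurable
  have \<xi>e: "\<bar>\<xi> \<bullet> e\<bar> \<le> norm \<xi>" for \<xi>
    using Cauchy_Schwarz_ineq2[of \<xi> e] e by simp
  have gx: "integrable lborel (\<lambda>\<xi>. 2 * (norm \<xi> * cmod (g \<xi>)))"
  proof -
    have "integrable lborel (\<lambda>\<xi>. norm \<xi> * cmod (g \<xi>))"
    proof (rule Bochner_Integration.integrable_bound[OF weighted[of 1]])
      have "norm \<xi> \<le> (1 + (norm \<xi>)\<^sup>2) powr (1 / 2)" for \<xi> :: "real^'n"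
        by (simp add: powr_half_sqrt real_le_rsqrt)
      then show "AE \<xi> in lborel. norm (norm \<xi> * cmod (g \<xi>)) \<le> norm ((1 + (norm \<xi>)\<^sup>2) powr (1 / 2) * cmod (g \<xi>))"
        by (intro AE_I2) (auto simp: abs_mult intro!: mult_right_mono)
    qed (use s1 in auto)
    then show ?thesis by simp
  qed
  have D_bound: "cmod (D \<delta> \<xi>) \<le> 2 * norm \<xi>" for \<delta> \<xi>
  proof -
    have "cmod ((cis (\<delta> * (\<xi> \<bullet> e)) - 1) / of_real \<delta>) \<le> \<bar>\<xi> \<bullet> e\<bar>"
      using norm_cis_diff_le[of "\<delta> * (\<xi> \<bullet> e)" 0]
      by (cases "\<delta> = 0") (auto simp: norm_divide abs_mult field_simps)
    then show ?thesis
      unfolding D_def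
      using norm_triangle_ineq4[of "(cis (\<delta> * (\<xi> \<bullet> e)) - 1) / of_real \<delta>" "\<i> * of_real (\<xi> \<bullet> e)"] \<xi>e[of \<xi>]
      by (simp add: norm_mult)
  qed
  have gD_bound: "cmod (g \<xi>) * cmod (D \<delta> \<xi>) \<le> 2 * (norm \<xi> * cmod (g \<xi>))" for \<delta> \<xi>
    using mult_left_mono[OF D_bound[of \<delta> \<xi>], of "cmod (g \<xi>)"] by (simp add: mult_ac)
  have gD: "integrable lborel (\<lambda>\<xi>. cmod (g \<xi>) * cmod (D \<delta> \<xi>))" for \<delta>
  proof (rule Bochner_Integration.integrable_bound[OF gx])
    show "AE \<xi> in lborel. norm (cmod (g \<xi>) * cmod (D \<delta> \<xi>)) \<le> norm (2 * (norm \<xi> * cmod (g \<xi>)))"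
      using gD_bound by (intro AE_I2) simp
  qed measurable
  have D_lim: "((\<lambda>\<delta>. D \<delta> \<xi>) \<longlongrightarrow> 0) (at 0)" for \<xi>
  proof -
    have "((\<lambda>z. exp (\<i> * of_real (\<xi> \<bullet> e) * z)) has_field_derivative \<i> * of_real (\<xi> \<bullet> e)) (at 0)"
      by (auto intro!: derivative_eq_intros)
    then have "((\<lambda>z. (exp (\<i> * of_real (\<xi> \<bullet> e) * z) - 1) / z) \<longlongrightarrow> \<i> * of_real (\<xi> \<bullet> e)) (at 0)"
      by (simp add: DERIV_def)
    moreover have "filterlim complex_of_real (at 0) (at 0)"
      by (auto simp: filterlim_at eventually_at_filter intro!: tendsto_eq_intros)
    ultimately have "((\<lambda>\<delta>. (exp (\<i> * of_real (\<xi> \<bullet> e) * of_real \<delta>) - 1) / of_real \<delta>) \<longlongrightarrow> \<i> * of_real (\<xi> \<bullet> e)) (at 0)"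
      by (rule filterlim_compose)
    then show ?thesis unfolding D_def by (simp add: cis_conv_exp mult_ac LIM_zero)
  qed
  have \<omega>_lim: "((\<lambda>n. \<omega> (1 / real (Suc n))) \<longlonglongrightarrow> 0)"
  proof -
    have "(\<lambda>n. LINT \<xi>|lborel. cmod (g \<xi>) * cmod (D (1 / real (Suc n)) \<xi>)) \<longlonglongrightarrow> (LINT \<xi>|(lborel::(real^'n) measure). 0)"
    proof (rule integral_dominated_convergence[where w="\<lambda>\<xi>. 2 * (norm \<xi> * cmod (g \<xi>))"])
      show "AE \<xi> in lborel. (\<lambda>n. cmod (g \<xi>) * cmod (D (1 / real (Suc n)) \<xi>)) \<longlonglongrightarrow> 0"
      proof (rule AE_I2)
        fix \<xi> :: "real^'n"
        have "filterlim (\<lambda>n. 1 / real (Suc n)) (at 0) sequentially"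
          using LIMSEQ_inverse_real_of_nat by (auto simp: filterlim_at divide_inverse)
        from filterlim_compose[OF D_lim this, of \<xi>]
        show "(\<lambda>n. cmod (g \<xi>) * cmod (D (1 / real (Suc n)) \<xi>)) \<longlonglongrightarrow> 0"
          by (intro tendsto_mult_right_zero tendsto_norm_zero)
      qed
      show "AE \<xi> in lborel. norm (cmod (g \<xi>) * cmod (D (1 / real (Suc n)) \<xi>)) \<le> 2 * (norm \<xi> * cmod (g \<xi>))" for n
        using gD_bound by (intro AE_I2) simp
    qed (use gx in auto)
    then show ?thesis
      unfolding \<omega>_def using tendsto_mult_right_zero by fastforce
  qed
  define G where "G y = c * (LINT \<xi>|lborel. g \<xi> * cis (y * (\<xi> \<bullet> e)) * (\<i> * of_real (\<xi> \<bullet> e)))" for y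
  have gie: "integrable lborel (\<lambda>\<xi>. g \<xi> * cis (y * (\<xi> \<bullet> e)) * (\<i> * of_real (\<xi> \<bullet> e)))" for y
  proof (rule Bochner_Integration.integrable_bound[OF gx])
    show "AE \<xi> in lborel. norm (g \<xi> * cis (y * (\<xi> \<bullet> e)) * (\<i> * of_real (\<xi> \<bullet> e))) \<le> norm (2 * (norm \<xi> * cmod (g \<xi>)))"
    proof (rule AE_I2)
      fix \<xi>
      have "cmod (g \<xi>) * \<bar>\<xi> \<bullet> e\<bar> \<le> cmod (g \<xi>) * norm \<xi>" by (intro mult_left_mono \<xi>e) auto
      then show "norm (g \<xi> * cis (y * (\<xi> \<bullet> e)) * (\<i> * of_real (\<xi> \<bullet> e))) \<le> norm (2 * (norm \<xi> * cmod (g \<xi>)))"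
        using mult_nonneg_nonneg[of "cmod (g \<xi>)" "norm \<xi>"]
        by (simp add: norm_mult mult.commute[of "norm \<xi>"] del: mult_nonneg_nonneg)
    qed
  qed measurable
  have quot: "cmod (of_real ((f ((y + \<delta>) *\<^sub>R e) - f (y *\<^sub>R e)) / \<delta>) - G y) \<le> \<omega> \<delta>" if \<delta>: "\<delta> \<noteq> 0" for y \<delta>
  proof -
    have "of_real ((f ((y + \<delta>) *\<^sub>R e) - f (y *\<^sub>R e)) / \<delta>) = (F ((y + \<delta>) *\<^sub>R e) - F (y *\<^sub>R e)) / of_real \<delta>"
      by (simp add: feq)
    also have "\<dots> = c * (LINT \<xi>|lborel. (g \<xi> * cis (\<xi> \<bullet> ((y + \<delta>) *\<^sub>R e)) - g \<xi> * cis (\<xi> \<bullet> (y *\<^sub>R e))) / of_real \<delta>)"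
      unfolding F_def by (simp only: Bochner_Integration.integral_diff[OF gci gci] integral_divide_zero) (simp add: right_diff_distrib)
    also have "\<dots> - G y = c * (LINT \<xi>|lborel. (g \<xi> * cis (\<xi> \<bullet> ((y + \<delta>) *\<^sub>R e)) - g \<xi> * cis (\<xi> \<bullet> (y *\<^sub>R e))) / of_real \<delta>
        - g \<xi> * cis (y * (\<xi> \<bullet> e)) * (\<i> * of_real (\<xi> \<bullet> e)))"
      unfolding G_def
      by (subst Bochner_Integration.integral_diff[OF integrable_divide_zero[OF Bochner_Integration.integrable_diff[OF gci gci]] gie])
        (simp add: right_diff_distrib)
    also have "(\<lambda>\<xi>. (g \<xi> * cis (\<xi> \<bullet> ((y + \<delta>) *\<^sub>R e)) - g \<xi> * cis (\<xi> \<bullet> (y *\<^sub>R e))) / of_real \<delta>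
        - g \<xi> * cis (y * (\<xi> \<bullet> e)) * (\<i> * of_real (\<xi> \<bullet> e))) = (\<lambda>\<xi>. g \<xi> * cis (y * (\<xi> \<bullet> e)) * D \<delta> \<xi>)"
    proof -
      have "cis (\<xi> \<bullet> ((y + \<delta>) *\<^sub>R e)) = cis (y * (\<xi> \<bullet> e)) * cis (\<delta> * (\<xi> \<bullet> e))" for \<xi>
        by (simp add: cis_mult ring_distribs)
      then show ?thesis
        using \<delta> by (simp add: D_def fun_eq_iff field_simps)
    qed
    finally have "cmod (of_real ((f ((y + \<delta>) *\<^sub>R e) - f (y *\<^sub>R e)) / \<delta>) - G y)
       = c * cmod (LINT \<xi>|lborel. g \<xi> * cis (y * (\<xi> \<bullet> e)) * D \<delta> \<xi>)"
      using c by (simp add: norm_mult)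
    also have "\<dots> \<le> \<omega> \<delta>"
      unfolding \<omega>_def using c integral_norm_bound[of lborel "\<lambda>\<xi>. g \<xi> * cis (y * (\<xi> \<bullet> e)) * D \<delta> \<xi>"]
      by (intro mult_left_mono) (auto simp: norm_mult)
    finally show ?thesis .
  qed
  have G: "of_real (h' y) = G y" for y
  proof -
    have "((\<lambda>\<delta>. (f ((y + \<delta>) *\<^sub>R e) - f (y *\<^sub>R e)) / \<delta>) \<longlongrightarrow> h' y) (at 0)"
      using h'[of y] by (simp add: DERIV_def)
    moreover have lim: "filterlim (\<lambda>n. 1 / real (Suc n)) (at 0) sequentially"
      using LIMSEQ_inverse_real_of_nat by (auto simp: filterlim_at divide_inverse)
    ultimately have "(\<lambda>n. complex_of_real ((f ((y + 1 / real (Suc n)) *\<^sub>R e) - f (y *\<^sub>R e)) / (1 / real (Suc n)))) \<longlonglongrightarrow> of_real (h' y)"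
      by (intro tendsto_of_real filterlim_compose[OF _ lim])
    moreover have "(\<lambda>n. complex_of_real ((f ((y + 1 / real (Suc n)) *\<^sub>R e) - f (y *\<^sub>R e)) / (1 / real (Suc n))) - G y) \<longlonglongrightarrow> 0"
      by (rule Lim_null_comparison[OF always_eventually \<omega>_lim]) (intro allI quot, simp)
    then have "(\<lambda>n. complex_of_real ((f ((y + 1 / real (Suc n)) *\<^sub>R e) - f (y *\<^sub>R e)) / (1 / real (Suc n)))) \<longlonglongrightarrow> G y"
      by (rule LIM_zero_cancel)
    ultimately show ?thesis by (rule LIMSEQ_unique)
  qed
  \<comment> \<open>At a fixed step \<open>\<delta>\<close> the difference quotient tends to 0
    together with \<open>f\<close>, and it is within \<open>\<omega> \<delta>\<close> of
    \<open>h'\<close> everywhere.\<close>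
  show "(h' \<longlongrightarrow> 0) at_top"
  proof (rule tendstoI)
    fix \<epsilon> :: real assume \<epsilon>: "\<epsilon> > 0"
    have "eventually (\<lambda>n. \<omega> (1 / real (Suc n)) < \<epsilon> / 2) sequentially"
      using \<omega>_lim \<epsilon> by (intro order_tendstoD(2)[OF \<omega>_lim]) auto
    then obtain n where n: "\<omega> (1 / real (Suc n)) < \<epsilon> / 2" by (auto simp: eventually_sequentially)
    define \<delta> where "\<delta> = 1 / real (Suc n)"
    have \<delta>: "\<delta> > 0" "\<omega> \<delta> < \<epsilon> / 2" using n by (auto simp: \<delta>_def)
    have axis: "filterlim (\<lambda>y. (y + a) *\<^sub>R e) at_infinity at_top" for a :: real
    proof -
      have "filterlim (\<lambda>y::real. norm ((y + a) *\<^sub>R e)) at_top at_top"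
      proof (rule filterlim_at_top_mono)
        show "filterlim (\<lambda>y. a + y) at_top at_top"
          by (rule filterlim_tendsto_add_at_top[OF tendsto_const filterlim_ident])
        show "eventually (\<lambda>y. a + y \<le> norm ((y + a) *\<^sub>R e)) at_top"
          using e by (intro always_eventually allI) simp
      qed
      then show ?thesis by (simp add: filterlim_at_infinity_conv_norm_at_top)
    qed
    have "((\<lambda>y. (f ((y + \<delta>) *\<^sub>R e) - f ((y + 0) *\<^sub>R e)) / \<delta>) \<longlongrightarrow> (0 - 0) / \<delta>) at_top"
      using \<delta> by (intro tendsto_intros filterlim_compose[OF lim0] axis) auto
    then have "eventually (\<lambda>y. dist ((f ((y + \<delta>) *\<^sub>R e) - f (y *\<^sub>R e)) / \<delta>) 0 < \<epsilon> / 2) at_top"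
      using tendstoD[of _ "(0 - 0) / \<delta>" _ "\<epsilon> / 2"] \<epsilon> by fastforce
    then show "eventually (\<lambda>y. dist (h' y) 0 < \<epsilon>) at_top"
    proof eventually_elim
      case (elim y)
      have "cmod (of_real ((f ((y + \<delta>) *\<^sub>R e) - f (y *\<^sub>R e)) / \<delta>) - of_real (h' y)) \<le> \<omega> \<delta>"
        using quot[of \<delta> y] \<delta> by (simp add: G)
      then have "\<bar>(f ((y + \<delta>) *\<^sub>R e) - f (y *\<^sub>R e)) / \<delta> - h' y\<bar> \<le> \<omega> \<delta>"
        by (metis norm_of_real of_real_diff)
      moreover have "\<bar>(f ((y + \<delta>) *\<^sub>R e) - f (y *\<^sub>R e)) / \<delta>\<bar> < \<epsilon> / 2" using elim by (simp only: dist_real_def diff_0_right)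
      ultimately have "\<bar>h' y\<bar> < \<epsilon>" using \<delta>(2) by linarith
      then show ?case by simp
    qed
  qed
qed

section \<open>Radial integrals in polar coordinates\<close>

lemma nn_integral_norm_eq:
  fixes g :: "real \<Rightarrow> ennreal"
  assumes [measurable]: "g \<in> borel_measurable borel"
  defines "w \<equiv> (\<lambda>r. real DIM('a::euclidean_space) * unit_ball_vol (real DIM('a)) * r ^ (DIM('a) - 1))"
  shows "(\<integral>\<^sup>+x. g (norm x) \<partial>(lborel::'a measure)) = (\<integral>\<^sup>+r. ennreal (w r) * indicator {0..} r * g r \<partial>lborel)"
proof -
  have [measurable]: "w \<in> borel_measurable borel" unfolding w_def by measurable
  define M where "M = distr (lborel::'a measure) borel norm"
  define L where "L = density lborel (\<lambda>r. ennreal (w r) * indicator {0..} r)"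
  \<comment> \<open>The image of Lebesgue measure under the norm and the measure with density
    \<open>w\<close> give the same finite value to each \<open>{..a}\<close>, a ball volume. These
    sets are stable under intersection and generate the Borel sets, so the measures agree.\<close>
  have eq: "emeasure M {..a} = emeasure L {..a}"
    and fin: "emeasure M {..a} \<noteq> \<infinity>" for a
  proof -
    have M: "emeasure M {..a} = emeasure lborel {x::'a. norm x \<le> a}"
      unfolding M_def by (subst emeasure_distr) (auto simp: vimage_def)
    have L: "emeasure L {..a} = (\<integral>\<^sup>+r. ennreal (w r) * indicator {0..a} r \<partial>lborel)"
      unfolding L_def by (subst emeasure_density) (auto intro!: nn_integral_cong simp: indicator_def)
    have "emeasure M {..a} = emeasure L {..a} \<and> emeasure M {..a} \<noteq> \<infinity>"
    proof (cases "a \<ge> 0")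
      case True
      have "{x::'a. norm x \<le> a} = cball 0 a" by auto
      then have "emeasure M {..a} = ennreal (unit_ball_vol DIM('a) * a ^ DIM('a))"
        using True by (simp add: M emeasure_cball)
      moreover have "emeasure L {..a} = ennreal (unit_ball_vol DIM('a) * a ^ DIM('a) - unit_ball_vol DIM('a) * 0 ^ DIM('a))"
        unfolding L using True
        by (intro nn_integral_FTC_Icc) (auto simp: w_def intro!: derivative_eq_intros)
      moreover have "(0::real) ^ DIM('a) = 0" by (rule zero_power) simp
      ultimately show ?thesis by simp
    next
      case False
      then have "{x::'a. norm x \<le> a} = {}" by (auto simp: not_le intro: less_le_trans)
      then show ?thesis using False by (simp add: M L)
    qed
    then show "emeasure M {..a} = emeasure L {..a}" "emeasure M {..a} \<noteq> \<infinity>" by auto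
  qed
  have "M = L"
  proof (rule measure_eqI_generator_eq[where E="range atMost" and \<Omega>=UNIV and A="\<lambda>n. {..real n}"])
    show "Int_stable (range (atMost :: real \<Rightarrow> _))"
      by (auto simp: Int_stable_def intro: range_eqI)
    show "(\<Union>i. {..real i}) = UNIV" using real_arch_simple by blast
  qed (use eq fin in \<open>auto simp: M_def L_def borel_eq_atMost\<close>)
  have "(\<integral>\<^sup>+x. g (norm x) \<partial>(lborel::'a measure)) = (\<integral>\<^sup>+r. g r \<partial>M)"
    unfolding M_def by (simp add: nn_integral_distr)
  also have "\<dots> = (\<integral>\<^sup>+r. ennreal (w r) * indicator {0..} r * g r \<partial>lborel)"
    unfolding \<open>M = L\<close> L_def by (simp add: nn_integral_density)
  finally show ?thesis .
qed

lemma radial_integral_bounded: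
  fixes g :: "real \<Rightarrow> real"
  assumes cont: "continuous_on UNIV g" and nonneg: "\<And>r. r \<ge> 0 \<Longrightarrow> g r \<ge> 0"
    and int: "integrable lborel (\<lambda>x::'a::euclidean_space. g (norm x))"
  shows "\<exists>C. \<forall>a\<ge>0. integral {0..a} (\<lambda>r. r ^ (DIM('a) - 1) * g r) \<le> C"
proof -
  define V where "V = real DIM('a) * unit_ball_vol (real DIM('a))"
  have V: "V > 0" unfolding V_def by (simp add: unit_ball_vol_pos)
  have [measurable]: "g \<in> borel_measurable borel" using cont by (rule borel_measurable_continuous_onI)
  define C where "C = (LINT x|lborel. g (norm (x::'a)))"
  have C0: "C \<ge> 0" unfolding C_def using nonneg by simp
  have C: "(\<integral>\<^sup>+r. ennreal (V * r ^ (DIM('a) - 1)) * indicator {0..} r * ennreal (g r) \<partial>lborel) = ennreal C"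
    unfolding C_def V_def
    using nn_integral_norm_eq[of "\<lambda>r. ennreal (g r)", where 'a='a]
      nn_integral_eq_integral[OF int] nonneg by simp
  have "V * integral {0..a} (\<lambda>r. r ^ (DIM('a) - 1) * g r) \<le> C" if a: "a \<ge> 0" for a
  proof -
    let ?f = "\<lambda>r. V * (r ^ (DIM('a) - 1) * g r)"
    have si: "set_integrable lborel {0..a} ?f"
      by (intro borel_integrable_atLeastAtMost' continuous_intros continuous_on_subset[OF cont]) auto
    have "ennreal (integral {0..a} ?f) = ennreal (LINT r:{0..a}|lborel. ?f r)"
      by (simp only: set_borel_integral_eq_integral(2)[OF si])
    also have "\<dots> = (\<integral>\<^sup>+r. ennreal (indicator {0..a} r *\<^sub>R ?f r) \<partial>lborel)"
      unfolding set_lebesgue_integral_def using si V nonneg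
      by (intro nn_integral_eq_integral[symmetric]) (auto simp: set_integrable_def indicator_def)
    also have "\<dots> \<le> (\<integral>\<^sup>+r. ennreal (V * r ^ (DIM('a) - 1)) * indicator {0..} r * ennreal (g r) \<partial>lborel)"
      using V nonneg by (intro nn_integral_mono) (auto simp: indicator_def ennreal_mult'[symmetric] mult_ac)
    also have "\<dots> = ennreal C" by (rule C)
    finally have "integral {0..a} ?f \<le> C" using C0 by simp
    then show ?thesis by simp
  qed
  then show ?thesis using V by (intro exI[of _ "C / V"]) (simp add: field_simps)
qed

section \<open>The flow of a radial velocity field\<close>

lemma continuous_on_compact_abs_bound:
  fixes f :: "'a::topological_space \<Rightarrow> real"
  assumes "compact S" "continuous_on S f"
  shows "\<exists>K>0. \<forall>x\<in>S. \<bar>f x\<bar> \<le> K"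
proof -
  have "bounded (f ` S)" using assms by (intro compact_imp_bounded compact_continuous_image)
  then show ?thesis by (simp add: bounded_pos)
qed

text \<open>Moves the endpoint into the integrand, so that joint continuity in \<open>t\<close> and
  in further parameters becomes a statement about an integral over a fixed interval.\<close>

lemma integral_eq_scaled_unit:
  fixes g :: "real \<Rightarrow> real"
  assumes t: "t \<ge> 0" and g: "continuous_on {0..t} g"
  shows "integral {0..t} g = t * integral {0..1} (\<lambda>\<theta>. g (t * \<theta>))"
proof (cases "t = 0")
  case False
  then have t: "t > 0" using t by simp
  have "(g has_integral integral {0..t} g) {0..t}"
    using g by (intro integrable_integral integrable_continuous_real)
  from has_integral_stretch_real[OF this, of t] t
  have "((\<lambda>\<theta>. g (t * \<theta>)) has_integral integral {0..t} g / t) ((\<lambda>x. x / t) ` {0..t})" by simp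
  moreover have "(\<lambda>x. x / t) ` {0..t} = {0..1}"
    using t by (auto simp: image_iff field_simps intro!: bexI[of _ "t * _"])
  ultimately have "integral {0..1} (\<lambda>\<theta>. g (t * \<theta>)) = integral {0..t} g / t"
    by (metis integral_unique)
  then show ?thesis using t by simp
qed simp

lemma has_real_derivative_along_path:
  fixes F :: "real \<Rightarrow> real \<Rightarrow> real"
  assumes F: "((\<lambda>p. F (fst p) (snd p)) has_derivative (\<lambda>h. Ft * fst h + Fx * snd h)) (at (t, X t) within I \<times> A)"
    and J: "J \<subseteq> I" "X ` J \<subseteq> A" and X: "(X has_real_derivative X') (at t within J)"
  shows "((\<lambda>s. F s (X s)) has_real_derivative Ft + Fx * X') (at t within J)"
proof -
  have p: "((\<lambda>s. (s, X s)) has_derivative (\<lambda>h. (h, X' * h))) (at t within J)"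
    using X by (intro has_derivative_Pair has_derivative_ident) (simp add: has_field_derivative_def)
  have "(\<lambda>s. (s, X s)) ` J \<subseteq> I \<times> A" using J by auto
  then have "((\<lambda>s. F s (X s)) has_derivative (\<lambda>h. Ft * h + Fx * (X' * h))) (at t within J)"
    using has_derivative_in_compose[OF p has_derivative_subset[OF F]] by simp
  moreover have "(\<lambda>h. Ft * h + Fx * (X' * h)) = (*) (Ft + Fx * X')" by (auto simp: algebra_simps)
  ultimately show ?thesis by (simp add: has_field_derivative_def)
qed

lemma has_real_derivative_slice:
  fixes F :: "real \<Rightarrow> real \<Rightarrow> real"
  assumes F: "((\<lambda>p. F (fst p) (snd p)) has_derivative (\<lambda>h. Ft * fst h + Fx * snd h)) (at (t, x) within S \<times> UNIV)"
    and t: "t \<in> S"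
  shows "(F t has_real_derivative Fx) (at x)"
proof -
  have p: "((\<lambda>x. (t, x)) has_derivative (\<lambda>h. (0, h))) (at x)"
    by (intro has_derivative_Pair has_derivative_ident has_derivative_const)
  have "range (\<lambda>x. (t, x)) \<subseteq> S \<times> UNIV" using t by auto
  from has_derivative_in_compose[OF p has_derivative_subset[OF F this]]
  show ?thesis by (simp add: has_field_derivative_def mult.commute[of _ Fx])
qed

text \<open>A fixed point argument in the norm \<open>sup\<^sub>t e\<^sup>-\<^sup>2\<^sup>K\<^sup>t |X t|\<close>, which gives the whole interval at once.\<close>

lemma picard_lindelof_lipschitz:
  fixes f :: "real \<Rightarrow> real \<Rightarrow> real"
  assumes \<tau>: "\<tau> \<ge> 0" and cont: "continuous_on ({0..\<tau>} \<times> UNIV) (\<lambda>(t, x). f t x)"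
    and lip: "\<And>t x y. t \<in> {0..\<tau>} \<Longrightarrow> \<bar>f t x - f t y\<bar> \<le> K * \<bar>x - y\<bar>" and K: "K > 0"
  shows "\<exists>X. X 0 = a \<and> (\<forall>t\<in>{0..\<tau>}. (X has_real_derivative f t (X t)) (at t within {0..\<tau>}))"
proof -
  \<comment> \<open>Times are clamped to \<open>{0..\<tau>}\<close>, so that the iteration acts on
    bounded continuous functions on the whole line, which form a complete space.\<close>
  define c where "c t = max 0 (min \<tau> t)" for t
  have c: "c t \<in> {0..\<tau>}" for t using \<tau> by (auto simp: c_def)
  have c_id: "t \<in> {0..\<tau>} \<Longrightarrow> c t = t" for t by (auto simp: c_def)
  have c_cont: "continuous_on UNIV c" unfolding c_def by (intro continuous_intros)
  \<comment> \<open>The unknown \<open>h\<close> is the path multiplied by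
    \<open>exp (- 2 * K * t)\<close>. With this weight the contraction constant is
    \<open>1 / 2\<close> for every \<open>\<tau>\<close>, since \<open>K\<close> times the integral
    of \<open>exp (2 * K * s)\<close> over \<open>{0..t}\<close> is at most
    \<open>exp (2 * K * t) / 2\<close>.\<close>
  define X where "X h t = exp (2 * K * t) * apply_bcontfun h t" for h :: "real \<Rightarrow>\<^sub>C real" and t
  have X_cont: "continuous_on A (X h)" for h A
    unfolding X_def using apply_bcontfun[of h]
    by (intro continuous_intros) (auto simp: bcontfun_def intro: continuous_on_subset)
  have f_cont: "continuous_on {0..\<tau>} (\<lambda>s. f s (Y s))" if "continuous_on {0..\<tau>} Y" for Y
  proof -
    have "continuous_on {0..\<tau>} (\<lambda>s. case (s, Y s) of (t, x) \<Rightarrow> f t x)"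
      by (rule continuous_on_compose2[OF cont continuous_on_Pair[OF continuous_on_id that]]) auto
    then show ?thesis by simp
  qed
  have f_int: "(\<lambda>s. f s (X h s)) integrable_on {0..t}" if "t \<in> {0..\<tau>}" for h t
    using that by (intro integrable_continuous_real continuous_on_subset[OF f_cont[OF X_cont]]) auto
  define P where "P h t = exp (- 2 * K * t) * (a + integral {0..t} (\<lambda>s. f s (X h s)))" for h t
  have P_cont: "continuous_on {0..\<tau>} (P h)" for h
    unfolding P_def
    by (intro continuous_intros indefinite_integral_continuous_1 integrable_continuous_real f_cont X_cont)
  have Pc: "(\<lambda>t. P h (c t)) \<in> bcontfun" for h
  proof -
    have "bounded (P h ` {0..\<tau>})"
      by (intro compact_imp_bounded compact_continuous_image P_cont) auto
    then have "bounded (range (\<lambda>t. P h (c t)))"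
      by (rule bounded_subset) (use c in auto)
    moreover have "continuous_on UNIV (\<lambda>t. P h (c t))"
      by (rule continuous_on_compose2[OF P_cont c_cont]) (use c in auto)
    ultimately show ?thesis by (simp add: bcontfun_def)
  qed
  define \<Phi> where "\<Phi> h = Bcontfun (\<lambda>t. P h (c t))" for h
  have \<Phi>: "apply_bcontfun (\<Phi> h) t = P h (c t)" for h t
    unfolding \<Phi>_def using Pc by (simp add: Bcontfun_inverse)
  have contr: "dist (\<Phi> g) (\<Phi> h) \<le> 1 / 2 * dist g h" for g h
  proof (rule dist_bound)
    fix t'
    define t where "t = c t'"
    define d where "d = dist g h"
    have t: "t \<in> {0..\<tau>}" using c by (simp add: t_def)
    have exp_int: "((\<lambda>s. K * d * exp (2 * K * s)) has_integral (d / 2 * exp (2 * K * t) - d / 2 * exp (2 * K * 0))) {0..t}"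
      using t K by (intro fundamental_theorem_of_calculus)
        (auto intro!: derivative_eq_intros simp flip: has_real_derivative_iff_has_vector_derivative)
    have "\<bar>integral {0..t} (\<lambda>s. f s (X g s)) - integral {0..t} (\<lambda>s. f s (X h s))\<bar>
        = \<bar>integral {0..t} (\<lambda>s. f s (X g s) - f s (X h s))\<bar>"
      by (simp add: integral_diff f_int[OF t])
    also have "\<dots> \<le> integral {0..t} (\<lambda>s. K * d * exp (2 * K * s))"
    proof (subst real_norm_def[symmetric], rule integral_norm_bound_integral)
      fix s assume s: "s \<in> {0..t}"
      have "\<bar>f s (X g s) - f s (X h s)\<bar> \<le> K * \<bar>X g s - X h s\<bar>" using s t by (intro lip) auto
      also have "\<dots> = K * (exp (2 * K * s) * dist (apply_bcontfun g s) (apply_bcontfun h s))"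
        by (simp add: X_def dist_real_def abs_mult flip: right_diff_distrib)
      also have "\<dots> \<le> K * (exp (2 * K * s) * d)"
        unfolding d_def using K by (intro mult_left_mono dist_bounded) auto
      finally show "norm (f s (X g s) - f s (X h s)) \<le> K * d * exp (2 * K * s)" by (simp add: mult_ac)
    qed (use exp_int f_int[OF t] in \<open>auto intro: integrable_diff\<close>)
    also have "\<dots> \<le> d / 2 * exp (2 * K * t)"
      using integral_unique[OF exp_int] by (simp add: d_def)
    finally have *: "\<bar>integral {0..t} (\<lambda>s. f s (X g s)) - integral {0..t} (\<lambda>s. f s (X h s))\<bar> \<le> d / 2 * exp (2 * K * t)" .
    have "dist (apply_bcontfun (\<Phi> g) t') (apply_bcontfun (\<Phi> h) t')
        = exp (- 2 * K * t) * \<bar>integral {0..t} (\<lambda>s. f s (X g s)) - integral {0..t} (\<lambda>s. f s (X h s))\<bar>"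
      by (simp add: \<Phi> P_def dist_real_def abs_mult flip: t_def right_diff_distrib)
    also have "\<dots> \<le> exp (- 2 * K * t) * (d / 2 * exp (2 * K * t))"
      by (intro mult_left_mono *) auto
    also have "\<dots> = 1 / 2 * d" by (simp add: exp_minus field_simps)
    finally show "dist (apply_bcontfun (\<Phi> g) t') (apply_bcontfun (\<Phi> h) t') \<le> 1 / 2 * dist g h"
      by (simp add: d_def)
  qed
  obtain h where h: "\<Phi> h = h"
    using banach_fix_type[of "1 / 2" \<Phi>] contr by auto
  have Xh: "X h t = a + integral {0..t} (\<lambda>s. f s (X h s))" if "t \<in> {0..\<tau>}" for t
  proof -
    have "apply_bcontfun h t = P h t" using \<Phi>[of h t] c_id[OF that] by (simp add: h)
    then show ?thesis by (simp add: X_def P_def exp_minus)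
  qed
  have "(X h has_real_derivative f t (X h t)) (at t within {0..\<tau>})" if t: "t \<in> {0..\<tau>}" for t
  proof -
    have "((\<lambda>t. a + integral {0..t} (\<lambda>s. f s (X h s))) has_real_derivative 0 + f t (X h t)) (at t within {0..\<tau>})"
      by (intro DERIV_add DERIV_const integral_has_real_derivative f_cont X_cont t)
    then have "((\<lambda>t. a + integral {0..t} (\<lambda>s. f s (X h s))) has_real_derivative f t (X h t)) (at t within {0..\<tau>})"
      by simp
    then show ?thesis
      by (rule has_field_derivative_transform_within[OF _ zero_less_one t]) (simp add: Xh)
  qed
  moreover have "X h 0 = a" using Xh[of 0] \<tau> by simp
  ultimately show ?thesis by blast
qed

section \<open>Half-open time intervals, finite or infinite\<close>

locale time_domain =
  fixes I :: "real set"
  assumes zero_mem: "0 \<in> I" and Icc_subset: "t \<in> I \<Longrightarrow> {0..t} \<subseteq> I"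
    and nonneg: "t \<in> I \<Longrightarrow> 0 \<le> t" and later: "t \<in> I \<Longrightarrow> \<exists>\<sigma>\<in>I. t < \<sigma>"
begin

text \<open>A later element of \<open>I\<close> is always available, so derivatives within
  \<open>I\<close> are derivatives within a compact interval and the results for
  \<open>{0..\<sigma>}\<close> carry over.\<close>

lemma at_within_Icc:
  assumes "\<sigma> \<in> I" "t < \<sigma>"
  shows "at t within I = at t within {0..\<sigma>}"
proof (rule at_within_nhd[of _ "{..<\<sigma>}"])
  show "I \<inter> {..<\<sigma>} - {t} = {0..\<sigma>} \<inter> {..<\<sigma>} - {t}"
    using Icc_subset[OF assms(1)] nonneg by auto
qed (use assms in auto)

lemma integral_has_derivative:
  fixes g :: "real \<Rightarrow> real"
  assumes g: "continuous_on I g" and t: "t \<in> I"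
  shows "((\<lambda>t. integral {0..t} g) has_real_derivative g t) (at t within I)"
proof -
  obtain \<sigma> where \<sigma>: "\<sigma> \<in> I" "t < \<sigma>" using later[OF t] by blast
  have "((\<lambda>t. integral {0..t} g) has_real_derivative g t) (at t within {0..\<sigma>})"
    using \<sigma> nonneg[OF t] continuous_on_subset[OF g Icc_subset[OF \<sigma>(1)]]
    by (intro integral_has_real_derivative) auto
  then show ?thesis by (simp add: at_within_Icc[OF \<sigma>])
qed

end

section \<open>Paths of a radial velocity field\<close>

locale radial_velocity = time_domain +
  fixes v vx vt :: "real \<Rightarrow> real \<Rightarrow> real"
  assumes v_deriv: "t \<in> I \<Longrightarrow>
      ((\<lambda>p. v (fst p) (snd p)) has_derivative (\<lambda>h. vt t x * fst h + vx t x * snd h)) (at (t, x) within I \<times> UNIV)"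
    and vx_cont: "continuous_on (I \<times> UNIV) (\<lambda>(t, x). vx t x)"
    and v_origin: "t \<in> I \<Longrightarrow> v t 0 = 0"
begin

lemma v_cont: "continuous_on (I \<times> UNIV) (\<lambda>(t, x). v t x)"
  unfolding continuous_on_eq_continuous_within
  by (auto simp: case_prod_unfold intro!: has_derivative_continuous[OF v_deriv])

lemma v_compose_cont:
  assumes "continuous_on A f" "continuous_on A g" "\<And>a. a \<in> A \<Longrightarrow> f a \<in> I"
  shows "continuous_on A (\<lambda>a. v (f a) (g a))"
  using continuous_on_compose2[OF v_cont, of A "\<lambda>a. (f a, g a)"] assms
  by (auto intro!: continuous_intros)

lemma vx_compose_cont:
  assumes "continuous_on A f" "continuous_on A g" "\<And>a. a \<in> A \<Longrightarrow> f a \<in> I"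
  shows "continuous_on A (\<lambda>a. vx (f a) (g a))"
  using continuous_on_compose2[OF vx_cont, of A "\<lambda>a. (f a, g a)"] assms
  by (auto intro!: continuous_intros)

lemma v_deriv_x: "t \<in> I \<Longrightarrow> (v t has_real_derivative vx t x) (at x)"
  by (rule has_real_derivative_slice[OF v_deriv])

text \<open>Hadamard's form of the difference quotient of \<open>v t\<close>. It is continuous
  across the diagonal \<open>x = y\<close>, where it equals \<open>vx\<close>, while division by
  \<open>x - y\<close> would leave a gap there.\<close>

definition slope where "slope t x y = integral {0..1} (\<lambda>\<theta>. vx t (y + \<theta> * (x - y)))"

lemma v_diff: "t \<in> I \<Longrightarrow> v t x - v t y = (x - y) * slope t x y"
proof -
  assume t: "t \<in> I"
  have "((\<lambda>\<theta>. vx t (y + \<theta> * (x - y)) * (x - y)) has_integral (v t (y + 1 * (x - y)) - v t (y + 0 * (x - y)))) {0..1}"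
  proof (rule fundamental_theorem_of_calculus)
    fix \<theta> :: real
    show "((\<lambda>\<theta>. v t (y + \<theta> * (x - y))) has_vector_derivative vx t (y + \<theta> * (x - y)) * (x - y)) (at \<theta> within {0..1})"
      unfolding has_real_derivative_iff_has_vector_derivative[symmetric]
      by (rule DERIV_chain2[OF v_deriv_x[OF t]]) (auto intro!: derivative_eq_intros)
  qed simp
  then have "integral {0..1} (\<lambda>\<theta>. vx t (y + \<theta> * (x - y)) * (x - y)) = v t x - v t y"
    by (rule integral_unique[THEN trans]) simp
  then show ?thesis by (simp add: slope_def mult.commute)
qed

lemma slope_same: "slope t x x = vx t x"
  by (simp add: slope_def)

lemma slope_compose_cont:
  fixes f g h :: "'a::topological_space \<Rightarrow> real"
  assumes "continuous_on A f" "continuous_on A g" "continuous_on A h" "\<And>a. a \<in> A \<Longrightarrow> f a \<in> I"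
  shows "continuous_on A (\<lambda>a. slope (f a) (g a) (h a))"
proof -
  have "continuous_on A (\<lambda>a. integral (cbox 0 1) (\<lambda>\<theta>. vx (f a) (h a + \<theta> * (g a - h a))))"
  proof (rule integral_continuous_on_param)
    have "continuous_on (A \<times> cbox 0 1) (\<lambda>p. vx (f (fst p)) (h (fst p) + snd p * (g (fst p) - h (fst p))))"
      using assms by (intro vx_compose_cont continuous_intros continuous_on_compose2[of A _ "A \<times> cbox 0 1" fst]) auto
    then show "continuous_on (A \<times> cbox 0 1) (\<lambda>(a, \<theta>). vx (f a) (h a + \<theta> * (g a - h a)))"
      by (simp add: case_prod_unfold)
  qed
  then show ?thesis by (simp add: slope_def)
qed

definition path_on :: "real \<Rightarrow> real \<Rightarrow> (real \<Rightarrow> real) \<Rightarrow> bool" where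
  "path_on \<sigma> a Y \<longleftrightarrow> Y 0 = a \<and> (\<forall>t\<in>{0..\<sigma>}. (Y has_real_derivative v t (Y t)) (at t within {0..\<sigma>}))"

lemma path_on_cont: "path_on \<sigma> a Y \<Longrightarrow> continuous_on {0..\<sigma>} Y"
  unfolding path_on_def by (auto intro: DERIV_continuous_on)

lemma path_on_subset: "path_on \<sigma> a Y \<Longrightarrow> \<sigma>' \<le> \<sigma> \<Longrightarrow> path_on \<sigma>' a Y"
  unfolding path_on_def
proof (elim conjE, intro conjI ballI, assumption)
  fix t assume "\<forall>t\<in>{0..\<sigma>}. (Y has_real_derivative v t (Y t)) (at t within {0..\<sigma>})" "\<sigma>' \<le> \<sigma>" "t \<in> {0..\<sigma>'}"
  then show "(Y has_real_derivative v t (Y t)) (at t within {0..\<sigma>'})"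
    using DERIV_subset[of Y "v t (Y t)" t "{0..\<sigma>}" "{0..\<sigma>'}"] by auto
qed

lemma path_on_zero: "\<sigma> \<in> I \<Longrightarrow> path_on \<sigma> 0 (\<lambda>_. 0)"
  using Icc_subset[of \<sigma>] v_origin unfolding path_on_def by auto

text \<open>The difference of two paths solves a linear equation with coefficient
  \<open>slope\<close>. From this one formula come uniqueness, order preservation, positivity (by
  comparison with the zero path) and later the function \<open>W\<close>.\<close>

lemma path_diff:
  assumes \<sigma>: "\<sigma> \<in> I" and X: "path_on \<sigma> a X" and Y: "path_on \<sigma> b Y" and t: "t \<in> {0..\<sigma>}"
  shows "X t - Y t = (a - b) * exp (integral {0..t} (\<lambda>s. slope s (X s) (Y s)))"
proof -
  define E where "E t = integral {0..t} (\<lambda>s. slope s (X s) (Y s))" for t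
  have "continuous_on {0..\<sigma>} (\<lambda>s. slope s (X s) (Y s))"
    using X Y Icc_subset[OF \<sigma>] by (intro slope_compose_cont path_on_cont continuous_on_id) auto
  then have E: "(E has_real_derivative slope t (X t) (Y t)) (at t within {0..\<sigma>})" if "t \<in> {0..\<sigma>}" for t
    unfolding E_def using that by (intro integral_has_real_derivative)
  have "((\<lambda>t. (X t - Y t) * exp (- E t)) has_real_derivative 0) (at t within {0..\<sigma>})" if t: "t \<in> {0..\<sigma>}" for t
  proof -
    have XY: "(X has_real_derivative v t (X t)) (at t within {0..\<sigma>})" "(Y has_real_derivative v t (Y t)) (at t within {0..\<sigma>})"
      using X Y t by (auto simp: path_on_def)
    have "((\<lambda>t. (X t - Y t) * exp (- E t)) has_real_derivative
        (v t (X t) - v t (Y t)) * exp (- E t) + exp (- E t) * (- slope t (X t) (Y t)) * (X t - Y t)) (at t within {0..\<sigma>})"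
    proof (intro DERIV_mult DERIV_diff XY)
      show "((\<lambda>t. exp (- E t)) has_real_derivative exp (- E t) * (- slope t (X t) (Y t))) (at t within {0..\<sigma>})"
        using E[OF t] by (auto intro!: derivative_eq_intros)
    qed
    moreover have "t \<in> I" using t Icc_subset[OF \<sigma>] by auto
    ultimately show ?thesis by (simp add: v_diff algebra_simps)
  qed
  then obtain c where c: "\<And>t. t \<in> {0..\<sigma>} \<Longrightarrow> (X t - Y t) * exp (- E t) = c"
    using has_field_derivative_zero_constant[of "{0..\<sigma>}" "\<lambda>t. (X t - Y t) * exp (- E t)"] convex_real_interval(5) by blast
  have "c = a - b" using c[of 0] t X Y by (auto simp: path_on_def E_def)
  with c[OF t] have "(X t - Y t) * exp (- E t) = a - b" by simp
  then show ?thesis by (simp add: E_def exp_minus field_simps)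
qed

lemma path_pos:
  assumes "\<sigma> \<in> I" "path_on \<sigma> a X" "t \<in> {0..\<sigma>}"
  shows "a > 0 \<Longrightarrow> X t > 0" and "a \<ge> 0 \<Longrightarrow> X t \<ge> 0"
  using path_diff[OF assms(1,2) path_on_zero[OF assms(1)] assms(3)] by simp_all

text \<open>The field is only locally Lipschitz. Clamping the position to \<open>{-C..C}\<close>
  makes it globally Lipschitz, and \<open>C\<close> exceeds the a priori bound by at least 1, so the
  solution of the clamped equation never meets the barrier and solves the original one.\<close>

lemma path_exists:
  assumes \<tau>: "\<tau> \<in> I" and a: "a \<ge> 0"
    and bound: "\<And>\<sigma> X. \<sigma> \<in> {0..\<tau>} \<Longrightarrow> path_on \<sigma> a X \<Longrightarrow> \<forall>t\<in>{0..\<sigma>}. X t \<le> B"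
  shows "\<exists>X. path_on \<tau> a X"
proof -
  define C where "C = max a B + 1"
  define cl where "cl x = max (- C) (min C x)" for x
  have C: "C > 0" "C > B" "C > a" using a by (auto simp: C_def)
  have \<tau>0: "\<tau> \<ge> 0" using nonneg[OF \<tau>] .
  have "continuous_on ({0..\<tau>} \<times> {-C..C}) (\<lambda>(t, x). vx t x)"
    using Icc_subset[OF \<tau>] by (intro continuous_on_subset[OF vx_cont]) auto
  from continuous_on_compact_abs_bound[OF compact_Times[OF compact_Icc compact_Icc] this]
  obtain K where K: "K > 0" "\<And>t x. t \<in> {0..\<tau>} \<Longrightarrow> x \<in> {-C..C} \<Longrightarrow> \<bar>vx t x\<bar> \<le> K"
    by auto
  have lip: "\<bar>v t (cl x) - v t (cl y)\<bar> \<le> K * \<bar>x - y\<bar>" if t: "t \<in> {0..\<tau>}" for t x y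
  proof -
    have cl: "cl z \<in> {-C..C}" for z using C by (auto simp: cl_def)
    have "\<bar>v t (cl x) - v t (cl y)\<bar> \<le> K * \<bar>cl x - cl y\<bar>"
      using t Icc_subset[OF \<tau>] K(2)[OF t] cl
      by (intro field_differentiable_bound[of "{-C..C}" "v t" "vx t", simplified])
        (auto intro!: has_field_derivative_at_within v_deriv_x)
    also have "\<dots> \<le> K * \<bar>x - y\<bar>"
      using K(1) by (intro mult_left_mono) (auto simp: cl_def)
    finally show ?thesis .
  qed
  have "continuous_on ({0..\<tau>} \<times> UNIV) (\<lambda>p. v (fst p) (cl (snd p)))"
    unfolding cl_def using Icc_subset[OF \<tau>] by (intro v_compose_cont continuous_intros) auto
  then have cont: "continuous_on ({0..\<tau>} \<times> UNIV) (\<lambda>(t, x). v t (cl x))"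
    by (simp add: case_prod_unfold)
  obtain Y where Y0: "Y 0 = a"
    and Y: "\<And>t. t \<in> {0..\<tau>} \<Longrightarrow> (Y has_real_derivative v t (cl (Y t))) (at t within {0..\<tau>})"
    using picard_lindelof_lipschitz[OF \<tau>0 cont lip K(1), of a] by blast
  have Yc: "continuous_on {0..\<tau>} Y" by (rule DERIV_continuous_on[OF Y])
  have path: "path_on \<sigma> a Y" if "\<sigma> \<in> {0..\<tau>}" "\<And>t. t \<in> {0..\<sigma>} \<Longrightarrow> \<bar>Y t\<bar> \<le> C" for \<sigma>
    unfolding path_on_def
  proof (intro conjI ballI Y0)
    fix t assume t: "t \<in> {0..\<sigma>}"
    have "cl (Y t) = Y t" using that(2)[OF t] by (auto simp: cl_def)
    then show "(Y has_real_derivative v t (Y t)) (at t within {0..\<sigma>})"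
      using Y[of t] t that(1) DERIV_subset[of Y "v t (Y t)" t "{0..\<tau>}" "{0..\<sigma>}"] by auto
  qed
  have small: "\<bar>Y t\<bar> < C" if t: "t \<in> {0..\<tau>}" for t
  proof (rule ccontr)
    assume big: "\<not> \<bar>Y t\<bar> < C"
    define Z where "Z = {s\<in>{0..\<tau>}. \<bar>Y s\<bar> \<in> {C..}}"
    have "compact Z"
    proof -
      have "closed ({0..\<tau>} \<inter> (\<lambda>s. \<bar>Y s\<bar>) -` {C..})"
        by (intro continuous_closed_preimage continuous_intros Yc closed_atLeast closed_atLeastAtMost)
      moreover have "{0..\<tau>} \<inter> (\<lambda>s. \<bar>Y s\<bar>) -` {C..} = Z" by (auto simp: Z_def)
      moreover have "bounded Z" by (rule bounded_subset[of "{0..\<tau>}"]) (auto simp: Z_def)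
      ultimately show ?thesis by (simp add: compact_eq_bounded_closed)
    qed
    have ne: "Z \<noteq> {}" using big t by (auto simp: Z_def)
    \<comment> \<open>At the first time \<open>\<sigma>\<close> at which the barrier is met,
      \<open>Y\<close> is still a genuine path on \<open>{0..\<sigma>}\<close>, hence nonnegative
      and at most \<open>B < C\<close>.\<close>
    obtain \<sigma> where \<sigma>: "\<sigma> \<in> Z" "\<And>s. s \<in> Z \<Longrightarrow> \<sigma> \<le> s"
      using compact_attains_inf[OF \<open>compact Z\<close> ne] by blast
    have "\<sigma> \<le> \<tau>" "0 \<le> \<sigma>" "C \<le> \<bar>Y \<sigma>\<bar>" using \<sigma>(1) by (auto simp: Z_def)
    then have "\<exists>s\<ge>0. s \<le> \<sigma> \<and> \<bar>Y s\<bar> = C"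
      using IVT'[of "\<lambda>s. \<bar>Y s\<bar>" 0 C \<sigma>] Y0 C a continuous_on_rabs[OF continuous_on_subset[OF Yc, of "{0..\<sigma>}"]] by auto
    then obtain s where s: "0 \<le> s" "s \<le> \<sigma>" "\<bar>Y s\<bar> = C" by blast
    then have "s \<in> Z" using \<sigma>(1) by (auto simp: Z_def)
    then have eq: "\<bar>Y \<sigma>\<bar> = C" using \<sigma>(2)[of s] s by auto
    have "\<bar>Y s\<bar> \<le> C" if "s \<in> {0..\<sigma>}" for s
    proof (rule ccontr)
      assume "\<not> \<bar>Y s\<bar> \<le> C"
      then have "s \<in> Z" using that \<sigma>(1) by (auto simp: Z_def)
      then have "s = \<sigma>" using \<sigma>(2)[of s] that by auto
      then show False using eq \<open>\<not> \<bar>Y s\<bar> \<le> C\<close> by simp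
    qed
    then have p: "path_on \<sigma> a Y" using \<sigma>(1) by (intro path) (auto simp: Z_def)
    have \<sigma>\<tau>: "\<sigma> \<in> {0..\<tau>}" using \<sigma>(1) by (auto simp: Z_def)
    then have "\<sigma> \<in> I" using Icc_subset[OF \<tau>] by auto
    then have "Y \<sigma> \<ge> 0" using path_pos(2)[OF _ p _ a, of \<sigma>] \<sigma>\<tau> by auto
    moreover have "Y \<sigma> \<le> B" using bound[OF \<sigma>\<tau> p] \<sigma>\<tau> by auto
    ultimately show False using eq C by auto
  qed
  show ?thesis using path[of \<tau>] small \<tau>0 by (auto intro: less_imp_le)
qed

end

section \<open>The flow map and its divided differences\<close>

locale radial_flow = radial_velocity +
  assumes growth: "\<tau> \<in> I \<Longrightarrow> a \<ge> 0 \<Longrightarrow>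
    \<exists>B. \<forall>\<sigma>\<in>{0..\<tau>}. \<forall>X. path_on \<sigma> a X \<longrightarrow> (\<forall>t\<in>{0..\<sigma>}. X t \<le> B)"
begin

text \<open>The path is chosen anew for each endpoint \<open>t\<close>; by uniqueness the choices
  fit together, see \<open>flow_eq\<close>.\<close>

definition flow where "flow t a = (SOME Y. path_on t a Y) t"

lemma flow_eq:
  assumes "\<sigma> \<in> I" "path_on \<sigma> a Y" "t \<in> {0..\<sigma>}"
  shows "flow t a = Y t"
proof -
  have t: "t \<in> I" using subsetD[OF Icc_subset[OF assms(1)] assms(3)] .
  have Y: "path_on t a Y" using path_on_subset[OF assms(2)] assms(3) by auto
  then have "path_on t a (SOME Y. path_on t a Y)" by (rule someI[of "path_on t a"])
  from path_diff[OF t this Y, of t] show ?thesis using nonneg[OF t] by (simp add: flow_def)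
qed

lemma flow_path: "\<sigma> \<in> I \<Longrightarrow> a \<ge> 0 \<Longrightarrow> path_on \<sigma> a (\<lambda>t. flow t a)"
proof -
  assume \<sigma>: "\<sigma> \<in> I" and a: "a \<ge> 0"
  obtain B where "\<forall>\<sigma>'\<in>{0..\<sigma>}. \<forall>X. path_on \<sigma>' a X \<longrightarrow> (\<forall>t\<in>{0..\<sigma>'}. X t \<le> B)"
    using growth[OF \<sigma> a] by blast
  then obtain Y where Y: "path_on \<sigma> a Y" using path_exists[OF \<sigma> a, of B] by blast
  have eq: "flow t a = Y t" if "t \<in> {0..\<sigma>}" for t using flow_eq[OF \<sigma> Y that] .
  show "path_on \<sigma> a (\<lambda>t. flow t a)"
    unfolding path_on_def
  proof (intro conjI ballI)
    show "flow 0 a = a" using eq[of 0] nonneg[OF \<sigma>] Y by (simp add: path_on_def)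
    fix t assume t: "t \<in> {0..\<sigma>}"
    have "(Y has_real_derivative v t (flow t a)) (at t within {0..\<sigma>})"
      using Y t by (simp add: path_on_def eq)
    then show "((\<lambda>t. flow t a) has_real_derivative v t (flow t a)) (at t within {0..\<sigma>})"
      by (rule has_field_derivative_transform_within[OF _ zero_less_one t]) (simp add: eq)
  qed
qed

lemma flow_0: "a \<ge> 0 \<Longrightarrow> flow 0 a = a"
  using flow_path[OF zero_mem, of a] by (simp add: path_on_def)

lemma flow_deriv:
  assumes "t \<in> I" "a \<ge> 0"
  shows "((\<lambda>t. flow t a) has_real_derivative v t (flow t a)) (at t within I)"
proof -
  obtain \<sigma> where \<sigma>: "\<sigma> \<in> I" "t < \<sigma>" using later[OF assms(1)] by blast
  have "t \<in> {0..\<sigma>}" using \<sigma> nonneg[OF assms(1)] by auto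
  then show ?thesis
    using flow_path[OF \<sigma>(1) assms(2)] by (simp add: path_on_def at_within_Icc[OF \<sigma>])
qed

lemma flow_cont_t: "a \<ge> 0 \<Longrightarrow> continuous_on I (\<lambda>t. flow t a)"
  by (rule DERIV_continuous_on[OF flow_deriv])

text \<open>The divided difference of the flow in its label, by \<open>flow_diff\<close>, written as
  an exponential so that it is positive. On the diagonal it is the label derivative; with
  \<open>b = 0\<close> it is the ratio of radius to label, and it makes sense at
  \<open>a = 0\<close> as well.\<close>

definition W where "W t a b = exp (integral {0..t} (\<lambda>s. slope s (flow s a) (flow s b)))"

lemma W_pos: "W t a b > 0" by (simp add: W_def)

lemma W_0: "W 0 a b = 1" by (simp add: W_def)

lemma flow_diff: "t \<in> I \<Longrightarrow> a \<ge> 0 \<Longrightarrow> b \<ge> 0 \<Longrightarrow> flow t a - flow t b = (a - b) * W t a b"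
  unfolding W_def using nonneg by (intro path_diff[of t] flow_path) auto

lemma flow_origin: "t \<in> I \<Longrightarrow> flow t 0 = 0"
  using flow_eq[OF _ path_on_zero, of t t] nonneg by auto

lemma flow_eq_mult_W: "t \<in> I \<Longrightarrow> a \<ge> 0 \<Longrightarrow> flow t a = a * W t a 0"
  using flow_diff[of t a 0] flow_origin by simp

lemma flow_nonneg: "t \<in> I \<Longrightarrow> a \<ge> 0 \<Longrightarrow> flow t a \<ge> 0"
  using W_pos[of t a 0] by (simp add: flow_eq_mult_W)

lemma flow_pos: "t \<in> I \<Longrightarrow> a > 0 \<Longrightarrow> flow t a > 0"
  using W_pos[of t a 0] by (simp add: flow_eq_mult_W)

lemma flow_mono: "t \<in> I \<Longrightarrow> 0 \<le> a \<Longrightarrow> a \<le> b \<Longrightarrow> flow t a \<le> flow t b"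
proof -
  assume *: "t \<in> I" "0 \<le> a" "a \<le> b"
  have "0 \<le> (b - a) * W t b a" using * W_pos[of t b a] by (intro mult_nonneg_nonneg) auto
  then show ?thesis using flow_diff[of t b a] * by simp
qed

lemma W_deriv:
  assumes "t \<in> I" "a \<ge> 0" "b \<ge> 0"
  shows "((\<lambda>t. W t a b) has_real_derivative slope t (flow t a) (flow t b) * W t a b) (at t within I)"
proof -
  have "continuous_on I (\<lambda>s. slope s (flow s a) (flow s b))"
    using assms by (intro slope_compose_cont flow_cont_t continuous_on_id) auto
  from integral_has_derivative[OF this assms(1)]
  show ?thesis unfolding W_def by (auto intro!: derivative_eq_intros)
qed

text \<open>Order preservation confines all shells with labels up to \<open>A\<close> to the range
  swept by the outermost one, which is bounded on \<open>{0..\<tau>}\<close>; the rest is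
  compactness.\<close>

lemma slope_bound:
  assumes \<tau>: "\<tau> \<in> I" and A: "A \<ge> 0"
  shows "\<exists>C>0. \<forall>t\<in>{0..\<tau>}. \<forall>a\<in>{0..A}. \<forall>b\<in>{0..A}. \<bar>slope t (flow t a) (flow t b)\<bar> \<le> C"
proof -
  have "continuous_on {0..\<tau>} (\<lambda>t. flow t A)"
    using Icc_subset[OF \<tau>] A by (intro continuous_on_subset[OF flow_cont_t])
  from continuous_on_compact_abs_bound[OF compact_Icc this]
  obtain B where "\<And>t. t \<in> {0..\<tau>} \<Longrightarrow> \<bar>flow t A\<bar> \<le> B" by blast
  then have B: "\<And>t. t \<in> {0..\<tau>} \<Longrightarrow> flow t A \<le> B" using abs_le_D1 by blast
  have mem: "flow t a \<in> {0..B}" if "t \<in> {0..\<tau>}" "a \<in> {0..A}" for t a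
    using B[OF that(1)] flow_mono[of t a A] flow_nonneg[of t a] that Icc_subset[OF \<tau>] by fastforce
  have "continuous_on ({0..\<tau>} \<times> {0..B} \<times> {0..B}) (\<lambda>p. slope (fst p) (fst (snd p)) (snd (snd p)))"
    using Icc_subset[OF \<tau>] by (intro slope_compose_cont continuous_intros) auto
  from continuous_on_compact_abs_bound[OF compact_Times[OF compact_Icc compact_Times[OF compact_Icc compact_Icc]] this]
  obtain C where C: "C > 0" "\<And>p. p \<in> {0..\<tau>} \<times> {0..B} \<times> {0..B} \<Longrightarrow> \<bar>slope (fst p) (fst (snd p)) (snd (snd p))\<bar> \<le> C"
    by blast
  then have "\<bar>slope t x y\<bar> \<le> C" if "t \<in> {0..\<tau>}" "x \<in> {0..B}" "y \<in> {0..B}" for t x y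
    using C(2)[of "(t, x, y)"] that by simp
  then show ?thesis using mem C(1) by blast
qed

lemma W_bounds:
  assumes \<tau>: "\<tau> \<in> I" and A: "A \<ge> 0"
  shows "\<exists>C>0. \<forall>t\<in>{0..\<tau>}. \<forall>a\<in>{0..A}. \<forall>b\<in>{0..A}. 1 / C \<le> W t a b \<and> W t a b \<le> C"
proof -
  obtain K where K: "K > 0" "\<And>t a b. t \<in> {0..\<tau>} \<Longrightarrow> a \<in> {0..A} \<Longrightarrow> b \<in> {0..A} \<Longrightarrow> \<bar>slope t (flow t a) (flow t b)\<bar> \<le> K"
    using slope_bound[OF assms] by blast
  have "1 / exp (K * \<tau>) \<le> W t a b \<and> W t a b \<le> exp (K * \<tau>)"
    if t: "t \<in> {0..\<tau>}" and ab: "a \<in> {0..A}" "b \<in> {0..A}" for t a b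
  proof -
    have "continuous_on {0..t} (\<lambda>s. slope s (flow s a) (flow s b))"
      using ab t Icc_subset[OF \<tau>]
      by (intro slope_compose_cont continuous_on_subset[OF flow_cont_t] continuous_on_id) auto
    then have "\<bar>integral {0..t} (\<lambda>s. slope s (flow s a) (flow s b))\<bar> \<le> K * (t - 0)"
      using integral_bound[of 0 t "\<lambda>s. slope s (flow s a) (flow s b)" K] t K(2) ab by auto
    also have "\<dots> \<le> K * \<tau>" using t K by auto
    finally show ?thesis by (simp add: W_def abs_le_iff flip: exp_minus inverse_eq_divide)
  qed
  then show ?thesis by (intro exI[of _ "exp (K * \<tau>)"]) auto
qed

text \<open>The bound on \<open>W\<close> makes the dependence on the label Lipschitz, uniformly for
  times near \<open>t0\<close>. Together with continuity in time at the single label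
  \<open>a0\<close> this gives joint continuity.\<close>

lemma flow_cont: "continuous_on (I \<times> {0..}) (\<lambda>(t, a). flow t a)"
proof -
  have "((\<lambda>p. flow (fst p) (snd p)) \<longlongrightarrow> flow t0 a0) (at (t0, a0) within I \<times> {0..})"
    if t0: "t0 \<in> I" and a0: "a0 \<ge> 0" for t0 a0
  proof -
    obtain \<tau> where \<tau>: "\<tau> \<in> I" "t0 < \<tau>" using later[OF t0] by blast
    obtain C where C: "C > 0" "\<And>t a b. t \<in> {0..\<tau>} \<Longrightarrow> a \<in> {0..a0 + 1} \<Longrightarrow> b \<in> {0..a0 + 1} \<Longrightarrow> W t a b \<le> C"
      using W_bounds[OF \<tau>(1), of "a0 + 1"] a0 by fastforce
    have F: "filterlim f (nhds (f (t0, a0))) (at (t0, a0) within I \<times> {0..})" if "continuous_on UNIV f" for f :: "real \<times> real \<Rightarrow> real"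
      using that by (meson UNIV_I continuous_on_def tendsto_within_subset top_greatest)
    have ev: "eventually (\<lambda>p. norm (flow (fst p) (snd p) - flow (fst p) a0) \<le> C * \<bar>snd p - a0\<bar>) (at (t0, a0) within I \<times> {0..})"
    proof -
      have "eventually (\<lambda>p. fst p < \<tau>) (at (t0, a0) within I \<times> {0..})" "eventually (\<lambda>p. snd p < a0 + 1) (at (t0, a0) within I \<times> {0..})"
        using order_tendstoD(2)[OF F[OF continuous_on_fst[OF continuous_on_id]], of \<tau>]
          order_tendstoD(2)[OF F[OF continuous_on_snd[OF continuous_on_id]], of "a0 + 1"] \<tau> by simp_all
      moreover have "eventually (\<lambda>p. p \<in> I \<times> {0..}) (at (t0, a0) within I \<times> {0..})"
        by (auto simp: eventually_at_filter)
      ultimately show ?thesis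
      proof eventually_elim
        case (elim p)
        then have "W (fst p) (snd p) a0 \<le> C" using nonneg a0 by (intro C) auto
        then have "\<bar>snd p - a0\<bar> * W (fst p) (snd p) a0 \<le> \<bar>snd p - a0\<bar> * C" by (intro mult_left_mono) auto
        moreover have "flow (fst p) (snd p) - flow (fst p) a0 = (snd p - a0) * W (fst p) (snd p) a0"
          using elim a0 by (intro flow_diff) auto
        ultimately show ?case using W_pos[of "fst p" "snd p" a0] by (simp add: abs_mult mult.commute)
      qed
    qed
    have "((\<lambda>p. C * \<bar>snd p - a0\<bar>) \<longlongrightarrow> 0) (at (t0, a0) within I \<times> {0..})"
    proof -
      have "continuous_on UNIV (\<lambda>p::real \<times> real. C * \<bar>snd p - a0\<bar>)" by (intro continuous_intros)
      from F[OF this] show ?thesis by simp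
    qed
    from Lim_null_comparison[OF ev this]
    have 1: "((\<lambda>p. flow (fst p) (snd p) - flow (fst p) a0) \<longlongrightarrow> 0) (at (t0, a0) within I \<times> {0..})" .
    have "continuous_on (I \<times> {0..}) (\<lambda>p::real \<times> real. flow (fst p) a0)"
      by (rule continuous_on_compose2[OF flow_cont_t[OF a0] continuous_on_fst[OF continuous_on_id]]) auto
    then have 2: "((\<lambda>p::real \<times> real. flow (fst p) a0) \<longlongrightarrow> flow t0 a0) (at (t0, a0) within I \<times> {0..})"
      using t0 a0 unfolding continuous_on_def by fastforce
    show ?thesis using tendsto_add[OF 1 2] by simp
  qed
  then show ?thesis by (auto simp: continuous_on_def case_prod_unfold)
qed

lemma flow_compose_cont:
  assumes "continuous_on A f" "continuous_on A g" "\<And>a. a \<in> A \<Longrightarrow> f a \<in> I" "\<And>a. a \<in> A \<Longrightarrow> g a \<ge> 0"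
  shows "continuous_on A (\<lambda>a. flow (f a) (g a))"
  using continuous_on_compose2[OF flow_cont, of A "\<lambda>a. (f a, g a)"] assms
  by (auto intro!: continuous_intros)

lemma W_compose_cont:
  fixes f g h :: "'a::topological_space \<Rightarrow> real"
  assumes "continuous_on A f" "continuous_on A g" "continuous_on A h"
    and fgh: "\<And>a. a \<in> A \<Longrightarrow> f a \<in> I" "\<And>a. a \<in> A \<Longrightarrow> g a \<ge> 0" "\<And>a. a \<in> A \<Longrightarrow> h a \<ge> 0"
  shows "continuous_on A (\<lambda>a. W (f a) (g a) (h a))"
proof -
  have mem: "f a * \<theta> \<in> I" if "a \<in> A" "\<theta> \<in> {0..1}" for a \<theta>
  proof -
    have "f a * \<theta> \<in> {0..f a}" using that nonneg[OF fgh(1)[OF that(1)]] by (simp add: mult_left_le)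
    then show ?thesis using Icc_subset[OF fgh(1)[OF that(1)]] by blast
  qed
  have eq: "W (f a) (g a) (h a) = exp (f a * integral (cbox 0 1) (\<lambda>\<theta>. slope (f a * \<theta>) (flow (f a * \<theta>) (g a)) (flow (f a * \<theta>) (h a))))"
    if a: "a \<in> A" for a
  proof -
    have sub: "{0..f a} \<subseteq> I" using Icc_subset[OF fgh(1)[OF a]] .
    have "continuous_on {0..f a} (\<lambda>s. slope s (flow s (g a)) (flow s (h a)))"
      using fgh(2,3)[OF a] sub
      by (intro slope_compose_cont continuous_on_subset[OF flow_cont_t] continuous_on_id) auto
    from integral_eq_scaled_unit[OF nonneg[OF fgh(1)[OF a]] this] show ?thesis by (simp add: W_def)
  qed
  have "continuous_on A (\<lambda>a. integral (cbox 0 1) (\<lambda>\<theta>. slope (f a * \<theta>) (flow (f a * \<theta>) (g a)) (flow (f a * \<theta>) (h a))))"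
  proof (rule integral_continuous_on_param)
    have "continuous_on (A \<times> cbox 0 1) (\<lambda>p. slope (f (fst p) * snd p) (flow (f (fst p) * snd p) (g (fst p))) (flow (f (fst p) * snd p) (h (fst p))))"
      using assms mem
      by (intro slope_compose_cont flow_compose_cont continuous_intros continuous_on_compose2[of A _ "A \<times> cbox 0 1" fst]) auto
    then show "continuous_on (A \<times> cbox 0 1) (\<lambda>(a, \<theta>). slope (f a * \<theta>) (flow (f a * \<theta>) (g a)) (flow (f a * \<theta>) (h a)))"
      by (simp add: case_prod_unfold)
  qed
  then have "continuous_on A (\<lambda>a. exp (f a * integral (cbox 0 1) (\<lambda>\<theta>. slope (f a * \<theta>) (flow (f a * \<theta>) (g a)) (flow (f a * \<theta>) (h a)))))"
    using assms by (intro continuous_intros)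
  then show ?thesis by (subst continuous_on_cong[OF refl eq]) auto
qed

text \<open>The difference quotient in the label is exactly \<open>W t b a\<close>, whose limit as
  \<open>b\<close> tends to \<open>a\<close> is known from the continuity of
  \<open>W\<close>.\<close>

lemma flow_deriv_a:
  assumes "t \<in> I" "a > 0"
  shows "((\<lambda>a. flow t a) has_real_derivative W t a a) (at a)"
proof -
  have "continuous_on {0<..} (\<lambda>b. W t b a)"
    using assms by (intro W_compose_cont continuous_intros) auto
  then have lim: "((\<lambda>b. W t b a) \<longlongrightarrow> W t a a) (at a)"
    using assms by (simp add: continuous_on_eq_continuous_at isCont_def)
  have "eventually (\<lambda>b. b \<in> {0<..} \<and> b \<noteq> a) (at a)"
    using assms by (intro eventually_conj eventually_at_in_open' eventually_neq_at_within) auto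
  then have "eventually (\<lambda>b. W t b a = (flow t b - flow t a) / (b - a)) (at a)"
  proof eventually_elim
    case (elim b)
    then show ?case using flow_diff[of t b a] assms by (simp add: divide_simps)
  qed
  then have "((\<lambda>b. (flow t b - flow t a) / (b - a)) \<longlongrightarrow> W t a a) (at a)"
    using lim by (rule Lim_transform_eventually[rotated])
  then show ?thesis by (simp add: has_field_derivative_iff)
qed

end

section \<open>The Euler-Poisson system in Lagrangian coordinates\<close>

lemma has_real_derivative_divide_power:
  fixes f :: "real \<Rightarrow> real"
  assumes f: "(f has_real_derivative D) (at x within S)" and nz: "f x \<noteq> 0"
  shows "((\<lambda>x. c / f x ^ n) has_real_derivative - (real n * c * D / f x ^ (n + 1))) (at x within S)"
proof (cases n)
  case (Suc m)
  have "((\<lambda>x. c / f x ^ Suc m) has_real_derivative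
      (0 * f x ^ Suc m - c * ((1 + real m) * (D * f x ^ m))) / (f x ^ Suc m * f x ^ Suc m)) (at x within S)"
    using nz by (intro DERIV_divide DERIV_const DERIV_power_Suc f) simp
  moreover have "(0 * f x ^ Suc m - c * ((1 + real m) * (D * f x ^ m))) / (f x ^ Suc m * f x ^ Suc m)
      = - (real n * c * D / f x ^ (n + 1))"
    using nz by (simp add: Suc field_simps)
  ultimately show ?thesis by (simp add: Suc)
qed simp

lemma radial_mass_scaled:
  fixes R :: "real \<Rightarrow> real"
  assumes R: "continuous_on {0..r} R" and r: "r \<ge> 0" and N: "N \<ge> 1"
  shows "r ^ N * integral {0..1} (\<lambda>\<theta>. \<theta> ^ (N - 1) * R (\<theta> * r)) = integral {0..r} (\<lambda>\<xi>. \<xi> ^ (N - 1) * R \<xi>)"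
proof -
  have "integral {0..r} (\<lambda>\<xi>. \<xi> ^ (N - 1) * R \<xi>) = r * integral {0..1} (\<lambda>\<theta>. (r * \<theta>) ^ (N - 1) * R (r * \<theta>))"
    using r by (intro integral_eq_scaled_unit continuous_intros R)
  also have "(\<lambda>\<theta>. (r * \<theta>) ^ (N - 1) * R (r * \<theta>)) = (\<lambda>\<theta>. r ^ (N - 1) * (\<theta> ^ (N - 1) * R (\<theta> * r)))"
    by (auto simp: power_mult_distrib mult_ac)
  also have "r * integral {0..1} \<dots> = r * r ^ (N - 1) * integral {0..1} (\<lambda>\<theta>. \<theta> ^ (N - 1) * R (\<theta> * r))" by simp
  also have "r * r ^ (N - 1) = r ^ N" using N by (simp flip: power_Suc)
  finally show ?thesis ..
qed

text \<open>The potential is eliminated: its gradient appears as enclosed mass over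
  \<open>r ^ (N - 1)\<close>, with the mass as a scaled integral that is meaningful for every
  \<open>r\<close>. The two evolution equations are available at positive times only, so the
  conservation laws reach \<open>t = 0\<close> by continuity.\<close>

locale euler_poisson_radial = radial_velocity +
  fixes R Rx Rt :: "real \<Rightarrow> real \<Rightarrow> real" and k :: real and N :: nat
  assumes R_deriv: "t \<in> I \<Longrightarrow>
      ((\<lambda>p. R (fst p) (snd p)) has_derivative (\<lambda>h. Rt t x * fst h + Rx t x * snd h)) (at (t, x) within I \<times> UNIV)"
    and Rx_cont: "continuous_on (I \<times> UNIV) (\<lambda>(t, x). Rx t x)"
    and Rt_cont: "continuous_on (I \<times> UNIV) (\<lambda>(t, x). Rt t x)"
    and dim: "N \<ge> 3" and k_pos: "k > 0"
    and R0_nonneg: "r \<ge> 0 \<Longrightarrow> R 0 r \<ge> 0"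
    and continuity: "t \<in> I \<Longrightarrow> t > 0 \<Longrightarrow> r > 0 \<Longrightarrow>
      Rt t r + Rx t r * v t r + R t r * vx t r + real (N - 1) * R t r * v t r / r = 0"
    and momentum: "t \<in> I \<Longrightarrow> t > 0 \<Longrightarrow> r > 0 \<Longrightarrow>
      vt t r + v t r * vx t r = k * (r ^ N * integral {0..1} (\<lambda>\<theta>. \<theta> ^ (N - 1) * R t (\<theta> * r))) / r ^ (N - 1)"
begin

lemma R_compose_cont:
  assumes "continuous_on A f" "continuous_on A g" "\<And>a. a \<in> A \<Longrightarrow> f a \<in> I"
  shows "continuous_on A (\<lambda>a. R (f a) (g a))"
proof -
  have "continuous_on (I \<times> UNIV) (\<lambda>(t, x). R t x)"
    unfolding continuous_on_eq_continuous_within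
    by (auto simp: case_prod_unfold intro!: has_derivative_continuous[OF R_deriv])
  from continuous_on_compose2[OF this, of A "\<lambda>a. (f a, g a)"] assms
  show ?thesis by (auto intro!: continuous_intros)
qed

lemma Rx_compose_cont:
  assumes "continuous_on A f" "continuous_on A g" "\<And>a. a \<in> A \<Longrightarrow> f a \<in> I"
  shows "continuous_on A (\<lambda>a. Rx (f a) (g a))"
  using continuous_on_compose2[OF Rx_cont, of A "\<lambda>a. (f a, g a)"] assms
  by (auto intro!: continuous_intros)

lemma Rt_compose_cont:
  assumes "continuous_on A f" "continuous_on A g" "\<And>a. a \<in> A \<Longrightarrow> f a \<in> I"
  shows "continuous_on A (\<lambda>a. Rt (f a) (g a))"
  using continuous_on_compose2[OF Rt_cont, of A "\<lambda>a. (f a, g a)"] assms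
  by (auto intro!: continuous_intros)

lemma R_deriv_x: "t \<in> I \<Longrightarrow> (R t has_real_derivative Rx t x) (at x)"
  by (rule has_real_derivative_slice[OF R_deriv])

text \<open>The mass in the ball of radius \<open>r\<close> is \<open>r\<^sup>N \<mu> t r\<close>, up to the area of the unit sphere.\<close>

definition \<mu> where "\<mu> t r = integral {0..1} (\<lambda>\<theta>. \<theta> ^ (N - 1) * R t (\<theta> * r))"

lemma \<mu>_cont: "t \<in> I \<Longrightarrow> continuous_on UNIV (\<mu> t)"
proof -
  assume t: "t \<in> I"
  have "continuous_on UNIV (\<lambda>r. integral (cbox 0 1) (\<lambda>\<theta>. \<theta> ^ (N - 1) * R t (\<theta> * r)))"
  proof (rule integral_continuous_on_param)
    have "continuous_on (UNIV \<times> cbox 0 1) (\<lambda>p. snd p ^ (N - 1) * R t (snd p * fst p))"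
      using t by (intro continuous_intros R_compose_cont) auto
    then show "continuous_on (UNIV \<times> cbox 0 1) (\<lambda>(r, \<theta>). \<theta> ^ (N - 1) * R t (\<theta> * r))"
      by (simp add: case_prod_unfold)
  qed
  then show ?thesis by (simp add: \<mu>_def[abs_def])
qed

lemma mass_eq_integral:
  assumes "t \<in> I" "r \<ge> 0"
  shows "r ^ N * \<mu> t r = integral {0..r} (\<lambda>\<xi>. \<xi> ^ (N - 1) * R t \<xi>)"
  unfolding \<mu>_def using assms dim by (intro radial_mass_scaled R_compose_cont) auto

lemma \<mu>_0: "\<mu> t 0 = R t 0 / N"
proof -
  have "((\<lambda>\<theta>::real. \<theta> ^ (N - 1) * R t 0) has_integral (1 ^ N / N * R t 0 - 0 ^ N / N * R t 0)) {0..1}"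
    using dim by (intro fundamental_theorem_of_calculus)
      (auto intro!: derivative_eq_intros simp flip: has_real_derivative_iff_has_vector_derivative)
  from integral_unique[OF this] show ?thesis using dim by (simp only: \<mu>_def mult_zero_right) (simp add: zero_power)
qed

lemma \<mu>0_nonneg: "r \<ge> 0 \<Longrightarrow> \<mu> 0 r \<ge> 0"
  unfolding \<mu>_def using R0_nonneg
  by (intro integral_nonneg integrable_continuous_real continuous_intros R_compose_cont) (auto simp: zero_mem)

text \<open>In the scaled variable \<open>\<theta>\<close>, which makes the moving shell sit at
  \<open>\<theta> = 1\<close>, the continuity equation turns the rate of change of the enclosed mass
  into an exact \<open>\<theta>\<close>-derivative that integrates to 0.\<close>

lemma path_mass:
  assumes \<sigma>: "\<sigma> \<in> I" and X: "path_on \<sigma> a X" and a: "a > 0" and t: "t \<in> {0..\<sigma>}"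
  shows "X t ^ N * \<mu> t (X t) = a ^ N * \<mu> 0 a"
proof (cases "t = 0")
  case False
  define f where "f s \<theta> = \<theta> ^ (N - 1) * R s (\<theta> * X s)" for s \<theta>
  define f' where "f' s \<theta> = \<theta> ^ (N - 1) * (Rt s (\<theta> * X s) + Rx s (\<theta> * X s) * (\<theta> * v s (X s)))" for s \<theta>
  define q where "q s = X s ^ N * integral (cbox 0 1) (f s)" for s
  have sub: "{0..\<sigma>} \<subseteq> I" using Icc_subset[OF \<sigma>] .
  have Xc: "continuous_on {0..\<sigma>} X" using path_on_cont[OF X] .
  have Xd: "(X has_real_derivative v s (X s)) (at s within {0..\<sigma>})" if "s \<in> {0..\<sigma>}" for s
    using X that by (simp add: path_on_def)
  have Xc': "continuous_on ({0..\<sigma>} \<times> B) (\<lambda>p. X (fst p))" for B :: "real set"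
    by (rule continuous_on_compose2[OF Xc continuous_on_fst[OF continuous_on_id]]) auto
  have fd: "((\<lambda>s. integral (cbox 0 1) (f s)) has_real_derivative integral (cbox 0 1) (f' s)) (at s within {0..\<sigma>})"
    if s: "s \<in> {0..\<sigma>}" for s
  proof (rule leibniz_rule_field_derivative)
    fix s \<theta> :: real assume s: "s \<in> {0..\<sigma>}"
    have "((\<lambda>s. R s (\<theta> * X s)) has_real_derivative Rt s (\<theta> * X s) + Rx s (\<theta> * X s) * (\<theta> * v s (X s))) (at s within {0..\<sigma>})"
      using sub s by (intro has_real_derivative_along_path[OF R_deriv] DERIV_cmult Xd) auto
    then show "((\<lambda>s. f s \<theta>) has_real_derivative f' s \<theta>) (at s within {0..\<sigma>})"
      unfolding f_def f'_def by (intro DERIV_cmult)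
  next
    fix s assume "s \<in> {0..\<sigma>}"
    then show "f s integrable_on cbox 0 1"
      unfolding f_def using sub by (intro integrable_continuous continuous_intros R_compose_cont) auto
  next
    have "continuous_on ({0..\<sigma>} \<times> cbox 0 1) (\<lambda>p. f' (fst p) (snd p))"
      unfolding f'_def using sub
      by (intro continuous_intros Rt_compose_cont Rx_compose_cont v_compose_cont Xc') auto
    then show "continuous_on ({0..\<sigma>} \<times> cbox 0 1) (\<lambda>(s, \<theta>). f' s \<theta>)" by (simp add: case_prod_unfold)
  qed (use s in auto)
  have qd: "(q has_real_derivative real N * X s ^ (N - 1) * v s (X s) * integral (cbox 0 1) (f s)
      + X s ^ N * integral (cbox 0 1) (f' s)) (at s within {0..\<sigma>})" if s: "s \<in> {0..\<sigma>}" for s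
  proof -
    have "((\<lambda>s. X s ^ N) has_real_derivative real N * X s ^ (N - 1) * v s (X s)) (at s within {0..\<sigma>})"
      using DERIV_power[OF Xd[OF s], of N] by (simp add: mult_ac)
    from DERIV_mult[OF this fd[OF s]] show ?thesis unfolding q_def by (simp add: mult.commute)
  qed
  have zero: "real N * X s ^ (N - 1) * v s (X s) * integral (cbox 0 1) (f s) + X s ^ N * integral (cbox 0 1) (f' s) = 0"
    if s: "0 < s" "s < \<sigma>" for s
  proof -
    define x where "x = X s"
    define V where "V = v s x"
    have sI: "s \<in> I" using s sub by auto
    have x: "x > 0" using path_pos(1)[OF \<sigma> X _ a, of s] s by (simp add: x_def)
    obtain n where n: "N = Suc (Suc n)" using dim by (intro that[of "N - 2"]) simp
    \<comment> \<open>The primitive of the rate. Its first term comes from the stretching of the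
      scaled grid with speed \<open>\<theta> * V\<close>, its second is the mass flux. Both vanish
      at \<open>\<theta> = 0\<close> and they cancel at \<open>\<theta> = 1\<close>, where the shell
      moves with the fluid.\<close>
    define H where "H \<theta> = \<theta> ^ N * x ^ (N - 1) * V * R s (\<theta> * x) - (\<theta> * x) ^ (N - 1) * R s (\<theta> * x) * v s (\<theta> * x)" for \<theta>
    have "((\<lambda>\<theta>. real N * x ^ (N - 1) * V * f s \<theta> + x ^ N * f' s \<theta>) has_integral (H 1 - H 0)) {0..1}"
    proof (rule fundamental_theorem_of_calculus_interior)
      show "continuous_on {0..1} H"
        unfolding H_def using sI by (intro continuous_intros R_compose_cont v_compose_cont) auto
      fix \<theta> :: real assume \<theta>: "\<theta> \<in> {0<..<1}"
      define y where "y = \<theta> * x"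
      have y: "y > 0" using \<theta> x by (simp add: y_def)
      have Rd: "((\<lambda>\<theta>. R s (\<theta> * x)) has_real_derivative Rx s y * x) (at \<theta>)"
        unfolding y_def by (rule DERIV_chain2[OF R_deriv_x[OF sI]]) (auto intro!: derivative_eq_intros)
      have vd: "((\<lambda>\<theta>. v s (\<theta> * x)) has_real_derivative vx s y * x) (at \<theta>)"
        unfolding y_def by (rule DERIV_chain2[OF v_deriv_x[OF sI]]) (auto intro!: derivative_eq_intros)
      have "(H has_real_derivative
          real N * \<theta> ^ (N - 1) * x ^ (N - 1) * V * R s y + \<theta> ^ N * x ^ (N - 1) * V * (Rx s y * x)
          - (real (N - 1) * y ^ n * x * R s y * v s y + y ^ (N - 1) * (Rx s y * x) * v s y + y ^ (N - 1) * R s y * (vx s y * x))) (at \<theta>)"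
      proof -
        have p1: "((\<lambda>\<theta>. \<theta> ^ N * x ^ (N - 1) * V) has_real_derivative real N * \<theta> ^ (N - 1) * x ^ (N - 1) * V) (at \<theta>)"
          by (auto intro!: derivative_eq_intros)
        have p2: "((\<lambda>\<theta>. (\<theta> * x) ^ (N - 1)) has_real_derivative real (N - 1) * y ^ n * x) (at \<theta>)"
        proof -
          have "((\<lambda>\<theta>. \<theta> * x) has_real_derivative x) (at \<theta>)" by (auto intro!: derivative_eq_intros)
          from DERIV_power_Suc[OF this, of n] show ?thesis by (simp add: n y_def mult_ac)
        qed
        show ?thesis
          unfolding H_def
          by (rule DERIV_cong[OF DERIV_diff[OF DERIV_mult[OF p1 Rd] DERIV_mult[OF DERIV_mult[OF p2 Rd] vd]]])
            (simp add: y_def algebra_simps)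
      qed
      moreover have "real N * \<theta> ^ (N - 1) * x ^ (N - 1) * V * R s y + \<theta> ^ N * x ^ (N - 1) * V * (Rx s y * x)
          - (real (N - 1) * y ^ n * x * R s y * v s y + y ^ (N - 1) * (Rx s y * x) * v s y + y ^ (N - 1) * R s y * (vx s y * x))
          = real N * x ^ (N - 1) * V * f s \<theta> + x ^ N * f' s \<theta>"
      proof -
        have c: "Rt s y = - (Rx s y * v s y + R s y * vx s y + real (N - 1) * R s y * v s y / y)"
          using continuity[OF sI s(1) y] by linarith
        have "x ^ N * \<theta> ^ (N - 1) * Rt s y = - (real (N - 1) * y ^ n * x * R s y * v s y + y ^ (N - 1) * (Rx s y * x) * v s y + y ^ (N - 1) * R s y * (vx s y * x))"
        proof -
          have e: "x ^ N * \<theta> ^ (N - 1) = x * y * y ^ n" unfolding n y_def by (simp add: power_mult_distrib)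
          have "y ^ (N - 1) = y * y ^ n" by (simp add: n)
          then show ?thesis unfolding e c using y by (simp add: field_simps)
        qed
        moreover have "\<theta> ^ N = \<theta> * \<theta> ^ (N - 1)" "x ^ N = x * x ^ (N - 1)" by (simp_all add: n)
        ultimately show ?thesis by (simp add: f_def f'_def x_def[symmetric] V_def[symmetric] y_def[symmetric] algebra_simps)
      qed
      ultimately show "(H has_vector_derivative real N * x ^ (N - 1) * V * f s \<theta> + x ^ N * f' s \<theta>) (at \<theta>)"
        by (simp add: has_real_derivative_iff_has_vector_derivative)
    qed simp
    moreover have "H 1 - H 0 = 0" by (simp add: H_def n x_def V_def)
    ultimately have "integral {0..1} (\<lambda>\<theta>. real N * x ^ (N - 1) * V * f s \<theta> + x ^ N * f' s \<theta>) = 0"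
      by (simp add: integral_unique)
    moreover have "f s integrable_on {0..1}" "f' s integrable_on {0..1}"
      unfolding f_def f'_def using sI
      by (intro integrable_continuous_real continuous_intros Rt_compose_cont Rx_compose_cont R_compose_cont; simp)+
    ultimately show ?thesis by (simp add: integral_add integrable_on_mult_right x_def V_def)
  qed
  have \<sigma>0: "0 < \<sigma>" using False t by auto
  have "q t = q 0"
  proof (rule DERIV_isconst2[OF \<sigma>0])
    show "continuous_on {0..\<sigma>} q" by (rule DERIV_continuous_on[OF qd])
    fix s assume s: "0 < s" "s < \<sigma>"
    have "at s within {0..\<sigma>} = at s" using s by (intro at_within_interior) auto
    then show "(q has_real_derivative 0) (at s)" using qd[of s] zero[OF s] s by simp
  qed (use t in auto)
  moreover have "q s = X s ^ N * \<mu> s (X s)" for s by (simp add: q_def \<mu>_def f_def[abs_def])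
  moreover have "X 0 = a" using X by (simp add: path_on_def)
  ultimately show ?thesis by metis
qed (use X in \<open>auto simp: path_on_def\<close>)

text \<open>By \<open>path_mass\<close> the momentum equation along a path is Newton's law with a
  constant mass. The integral form includes the instant \<open>t = 0\<close>, and it can be
  differentiated in the label.\<close>

lemma path_velocity:
  assumes \<sigma>: "\<sigma> \<in> I" and X: "path_on \<sigma> a X" and a: "a > 0" and t: "t \<in> {0..\<sigma>}"
  shows "((\<lambda>s. k * (a ^ N * \<mu> 0 a) / X s ^ (N - 1)) has_integral (v t (X t) - v 0 a)) {0..t}"
proof -
  have sub: "{0..\<sigma>} \<subseteq> I" using Icc_subset[OF \<sigma>] .
  have Xc: "continuous_on {0..t} X" using path_on_cont[OF X] t by (auto intro: continuous_on_subset)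
  have "((\<lambda>s. k * (a ^ N * \<mu> 0 a) / X s ^ (N - 1)) has_integral (v t (X t) - v 0 (X 0))) {0..t}"
  proof (rule fundamental_theorem_of_calculus_interior[of 0 t "\<lambda>s. v s (X s)"])
    show "continuous_on {0..t} (\<lambda>s. v s (X s))"
      using sub t by (intro v_compose_cont Xc continuous_on_id) auto
    fix s assume s: "s \<in> {0<..<t}"
    then have s\<sigma>: "s \<in> {0..\<sigma>}" using t by auto
    have sI: "s \<in> I" using s\<sigma> sub by auto
    have "at s within {0..\<sigma>} = at s" using s t by (intro at_within_interior) auto
    moreover have "((\<lambda>s. v s (X s)) has_real_derivative vt s (X s) + vx s (X s) * v s (X s)) (at s within {0..\<sigma>})"
      using sub s\<sigma> sI X by (intro has_real_derivative_along_path[OF v_deriv]) (auto simp: path_on_def)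
    moreover have "vt s (X s) + vx s (X s) * v s (X s) = k * (a ^ N * \<mu> 0 a) / X s ^ (N - 1)"
      using momentum[OF sI, of "X s"] s path_pos(1)[OF \<sigma> X s\<sigma> a] path_mass[OF \<sigma> X a s\<sigma>]
      by (simp add: \<mu>_def mult.commute)
    ultimately show "((\<lambda>s. v s (X s)) has_vector_derivative k * (a ^ N * \<mu> 0 a) / X s ^ (N - 1)) (at s)"
      by (simp add: has_real_derivative_iff_has_vector_derivative)
  qed (use t in auto)
  then show ?thesis using X by (simp add: path_on_def)
qed

text \<open>Stated for an arbitrary path on a compact interval because the flow is not yet
  available: this identity is what supplies the growth bound from which the flow is built.\<close>

lemma path_energy:
  assumes \<sigma>: "\<sigma> \<in> I" and X: "path_on \<sigma> a X" and a: "a > 0" and t: "t \<in> {0..\<sigma>}"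
  defines "m \<equiv> a ^ N * \<mu> 0 a"
  shows "(v t (X t))\<^sup>2 / 2 + k * m / (real (N - 2) * X t ^ (N - 2)) = (v 0 a)\<^sup>2 / 2 + k * m / (real (N - 2) * a ^ (N - 2))"
proof -
  define V where "V s = v s (X s)" for s
  have pos: "X s > 0" if "s \<in> {0..\<sigma>}" for s using path_pos(1)[OF \<sigma> X that a] .
  have Xc: "continuous_on {0..\<sigma>} X" using path_on_cont[OF X] .
  have Xd: "(X has_real_derivative V s) (at s within {0..\<sigma>})" if "s \<in> {0..\<sigma>}" for s
    using X that by (simp add: path_on_def V_def)
  have g: "continuous_on {0..\<sigma>} (\<lambda>s. k * m / X s ^ (N - 1))"
    using pos by (intro continuous_intros Xc) (auto dest: pos)
  have Vd: "(V has_real_derivative k * m / X s ^ (N - 1)) (at s within {0..\<sigma>})" if s: "s \<in> {0..\<sigma>}" for s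
  proof -
    have "((\<lambda>t. v 0 a + integral {0..t} (\<lambda>s. k * m / X s ^ (N - 1))) has_real_derivative 0 + k * m / X s ^ (N - 1)) (at s within {0..\<sigma>})"
      by (intro DERIV_add DERIV_const integral_has_real_derivative g s)
    then have "((\<lambda>t. v 0 a + integral {0..t} (\<lambda>s. k * m / X s ^ (N - 1))) has_real_derivative k * m / X s ^ (N - 1)) (at s within {0..\<sigma>})"
      by simp
    moreover have "v 0 a + integral {0..s} (\<lambda>s. k * m / X s ^ (N - 1)) = V s" if "s \<in> {0..\<sigma>}" for s
      using integral_unique[OF path_velocity[OF \<sigma> X a that]] by (simp add: m_def V_def)
    ultimately show ?thesis
      by (rule has_field_derivative_transform_within[OF _ zero_less_one s])
  qed
  obtain n where n: "N = Suc (Suc (Suc n))" using dim by (intro that[of "N - 3"]) simp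
  have "((\<lambda>s. (V s)\<^sup>2 / 2 + k * m / (real (N - 2) * X s ^ (N - 2))) has_real_derivative 0) (at s within {0..\<sigma>})"
    if s: "s \<in> {0..\<sigma>}" for s
  proof -
    have "((\<lambda>s. (V s)\<^sup>2 / 2) has_real_derivative V s * (k * m / X s ^ (N - 1))) (at s within {0..\<sigma>})"
      using Vd[OF s] by (auto intro!: derivative_eq_intros)
    moreover have "((\<lambda>s. k * m / real (N - 2) / X s ^ (N - 2)) has_real_derivative - (V s * (k * m / X s ^ (N - 1)))) (at s within {0..\<sigma>})"
      using has_real_derivative_divide_power[OF Xd[OF s], of "k * m / real (N - 2)" "N - 2"] pos[OF s]
      by (simp add: n mult_ac)
    ultimately show ?thesis using DERIV_add by fastforce
  qed
  then obtain c where c: "\<And>s. s \<in> {0..\<sigma>} \<Longrightarrow> (V s)\<^sup>2 / 2 + k * m / (real (N - 2) * X s ^ (N - 2)) = c"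
    using has_field_derivative_zero_constant[of "{0..\<sigma>}" "\<lambda>s. (V s)\<^sup>2 / 2 + k * m / (real (N - 2) * X s ^ (N - 2))"] convex_real_interval(5) by blast
  show ?thesis using c[OF t] c[of 0] t X by (simp add: V_def path_on_def)
qed

text \<open>The force is repulsive, so both parts of the energy are nonnegative. The speed of every
  path from \<open>a\<close> is therefore at most \<open>sqrt (2 * E)\<close>, which bounds its
  position on any compact time interval. For \<open>a = 0\<close> uniqueness leaves only the path at
  rest.\<close>

sublocale radial_flow
proof
  fix \<tau> a :: real assume \<tau>: "\<tau> \<in> I" and a: "a \<ge> 0"
  show "\<exists>B. \<forall>\<sigma>\<in>{0..\<tau>}. \<forall>X. path_on \<sigma> a X \<longrightarrow> (\<forall>t\<in>{0..\<sigma>}. X t \<le> B)"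
  proof (cases "a = 0")
    case True
    have "X t \<le> 0" if "\<sigma> \<in> {0..\<tau>}" "path_on \<sigma> a X" "t \<in> {0..\<sigma>}" for \<sigma> X t
    proof -
      have "\<sigma> \<in> I" using subsetD[OF Icc_subset[OF \<tau>] that(1)] .
      from path_diff[OF this that(2) path_on_zero[OF this] that(3)] True show ?thesis by simp
    qed
    then show ?thesis by blast
  next
    case False
    then have a: "a > 0" using a by simp
    define E where "E = (v 0 a)\<^sup>2 / 2 + k * (a ^ N * \<mu> 0 a) / (real (N - 2) * a ^ (N - 2))"
    have E: "E \<ge> 0" unfolding E_def using a k_pos \<mu>0_nonneg[of a]
      by (intro add_nonneg_nonneg divide_nonneg_nonneg mult_nonneg_nonneg) auto
    have "X t \<le> a + \<tau> * sqrt (2 * E)" if \<sigma>: "\<sigma> \<in> {0..\<tau>}" and X: "path_on \<sigma> a X" and t: "t \<in> {0..\<sigma>}" for \<sigma> X t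
    proof -
      have \<sigma>I: "\<sigma> \<in> I" using Icc_subset[OF \<tau>] \<sigma> by auto
      have V: "\<bar>v s (X s)\<bar> \<le> sqrt (2 * E)" if s: "s \<in> {0..\<sigma>}" for s
      proof (rule real_le_rsqrt)
        have "k * (a ^ N * \<mu> 0 a) / (real (N - 2) * X s ^ (N - 2)) \<ge> 0"
          using a k_pos \<mu>0_nonneg[of a] path_pos(1)[OF \<sigma>I X s a]
          by (intro divide_nonneg_nonneg mult_nonneg_nonneg) auto
        then show "\<bar>v s (X s)\<bar>\<^sup>2 \<le> 2 * E"
          using path_energy[OF \<sigma>I X a s] by (simp add: E_def)
      qed
      have "\<bar>X t - X 0\<bar> \<le> sqrt (2 * E) * \<bar>t - 0\<bar>"
        using X t V
        by (intro field_differentiable_bound[of "{0..\<sigma>}" X "\<lambda>s. v s (X s)", simplified]) (auto simp: path_on_def)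
      also have "\<dots> \<le> sqrt (2 * E) * \<tau>" using t \<sigma> E by (intro mult_left_mono) auto
      finally show ?thesis using X by (simp add: path_on_def mult.commute)
    qed
    then show ?thesis by blast
  qed
qed

section \<open>Equations of motion for the shell variables\<close>

abbreviation \<eta> where "\<eta> t a \<equiv> W t a 0"
abbreviation \<Gamma> where "\<Gamma> t a \<equiv> W t a a"
text \<open>The time derivative of \<open>\<eta>\<close>. For \<open>a > 0\<close> it is
  \<open>v t (flow t a) / a\<close>; the form with \<open>slope\<close> extends this to the centre.
  Likewise \<open>P\<close> is the time derivative of \<open>\<Gamma>\<close>, and also the label
  derivative of the velocity of the shell.\<close>

definition \<zeta> where "\<zeta> t a = slope t (flow t a) 0 * \<eta> t a"
definition P where "P t a = vx t (flow t a) * \<Gamma> t a"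

lemma W_nonzero: "W t a b \<noteq> 0"
  using W_pos[of t a b] by simp

lemma flow_nonzero: "t \<in> I \<Longrightarrow> a > 0 \<Longrightarrow> flow t a \<noteq> 0"
  using flow_pos[of t a] by simp

lemma \<eta>_deriv: "t \<in> I \<Longrightarrow> a \<ge> 0 \<Longrightarrow> ((\<lambda>t. \<eta> t a) has_real_derivative \<zeta> t a) (at t within I)"
  using W_deriv[of t a 0] by (simp add: \<zeta>_def flow_origin)

lemma \<Gamma>_deriv: "t \<in> I \<Longrightarrow> a \<ge> 0 \<Longrightarrow> ((\<lambda>t. \<Gamma> t a) has_real_derivative P t a) (at t within I)"
  using W_deriv[of t a a] by (simp add: P_def slope_same)

lemma \<zeta>_eq: "t \<in> I \<Longrightarrow> a > 0 \<Longrightarrow> \<zeta> t a = v t (flow t a) / a"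
  using v_diff[of t "flow t a" 0] flow_eq_mult_W[of t a] by (simp add: \<zeta>_def v_origin)

lemma P_origin: "t \<in> I \<Longrightarrow> P t 0 = \<zeta> t 0"
  by (simp add: P_def \<zeta>_def flow_origin slope_same)

lemma power_dim: "(x::real) ^ N = x * x ^ (N - 1)"
  using dim by (simp flip: power_Suc)

lemma \<eta>_cont_t: "a \<ge> 0 \<Longrightarrow> continuous_on I (\<lambda>t. \<eta> t a)"
  by (rule DERIV_continuous_on[OF \<eta>_deriv])

lemma \<Gamma>_cont_t: "a \<ge> 0 \<Longrightarrow> continuous_on I (\<lambda>t. \<Gamma> t a)"
  by (rule DERIV_continuous_on[OF \<Gamma>_deriv])

text \<open>For \<open>a > 0\<close> this is Newton's law divided by \<open>a\<close>. Both sides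
  are continuous in the label up to \<open>a = 0\<close>, which settles the centre.\<close>

lemma \<zeta>_integral:
  assumes t: "t \<in> I" and a: "a \<ge> 0"
  shows "\<zeta> t a = \<zeta> 0 a + integral {0..t} (\<lambda>s. k * \<mu> 0 a / \<eta> s a ^ (N - 1))"
proof -
  define f where "f a = \<zeta> t a - \<zeta> 0 a" for a
  define g where "g a = integral (cbox 0 t) (\<lambda>s. k * \<mu> 0 a / \<eta> s a ^ (N - 1))" for a
  have sub: "{0..t} \<subseteq> I" using Icc_subset[OF t] .
  have eq: "f a = g a" if a: "a > 0" for a
  proof -
    have "((\<lambda>s. k * (a ^ N * \<mu> 0 a) / flow s a ^ (N - 1) / a) has_integral (v t (flow t a) - v 0 a) / a) {0..t}"
      using a nonneg[OF t] by (intro has_integral_divide path_velocity[OF t flow_path[OF t]]) auto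
    moreover have "k * (a ^ N * \<mu> 0 a) / flow s a ^ (N - 1) / a = k * \<mu> 0 a / \<eta> s a ^ (N - 1)" if "s \<in> {0..t}" for s
      using flow_eq_mult_W[of s a] sub that a by (auto simp: power_dim[of a] power_mult_distrib)
    ultimately have "((\<lambda>s. k * \<mu> 0 a / \<eta> s a ^ (N - 1)) has_integral (v t (flow t a) - v 0 a) / a) {0..t}"
      by (subst has_integral_cong[symmetric]) auto
    then show ?thesis
      using a t by (simp add: f_def g_def \<zeta>_eq zero_mem flow_0 integral_unique diff_divide_distrib)
  qed
  have fc: "continuous_on {0..} f"
    unfolding f_def \<zeta>_def using t zero_mem
    by (intro continuous_intros slope_compose_cont flow_compose_cont W_compose_cont) auto
  have gc: "continuous_on {0..} g"
    unfolding g_def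
  proof (rule integral_continuous_on_param)
    have "continuous_on ({0..} \<times> cbox 0 t) (\<lambda>p. k * \<mu> 0 (fst p) / \<eta> (snd p) (fst p) ^ (N - 1))"
      using sub
      by (intro continuous_intros W_compose_cont continuous_on_compose2[OF \<mu>_cont[OF zero_mem]])
        (auto simp: W_nonzero)
    then show "continuous_on ({0..} \<times> cbox 0 t) (\<lambda>(a, s). k * \<mu> 0 a / \<eta> s a ^ (N - 1))"
      by (simp add: case_prod_unfold)
  qed
  have "f a = g a"
  proof (cases "a = 0")
    case True
    have "continuous_on {0..} (\<lambda>a. f a - g a)" by (intro continuous_intros fc gc)
    then have "((\<lambda>a. f a - g a) \<longlongrightarrow> f 0 - g 0) (at 0 within {0..})" by (simp add: continuous_on_def)
    then have "((\<lambda>a. f a - g a) \<longlongrightarrow> f 0 - g 0) (at_right 0)" by (rule tendsto_within_subset) auto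
    moreover have "((\<lambda>a. f a - g a) \<longlongrightarrow> 0) (at_right 0)"
      by (rule tendsto_eventually) (auto simp: eventually_at_filter eq)
    ultimately have "f 0 - g 0 = 0" by (rule tendsto_unique[rotated]) simp
    then show ?thesis using True by simp
  qed (use eq a in auto)
  then show ?thesis by (simp add: f_def g_def)
qed

lemma \<zeta>_deriv:
  assumes t: "t \<in> I" and a: "a \<ge> 0"
  shows "((\<lambda>t. \<zeta> t a) has_real_derivative k * \<mu> 0 a / \<eta> t a ^ (N - 1)) (at t within I)"
proof -
  have "continuous_on I (\<lambda>s. k * \<mu> 0 a / \<eta> s a ^ (N - 1))"
    using a by (intro continuous_intros \<eta>_cont_t) (auto simp: W_nonzero)
  from DERIV_add[OF DERIV_const[of "\<zeta> 0 a"] integral_has_derivative[OF this t]]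
  have "((\<lambda>t. \<zeta> 0 a + integral {0..t} (\<lambda>s. k * \<mu> 0 a / \<eta> s a ^ (N - 1))) has_real_derivative k * \<mu> 0 a / \<eta> t a ^ (N - 1)) (at t within I)"
    by simp
  then show ?thesis
    by (rule has_field_derivative_transform_within[OF _ zero_less_one t]) (simp add: \<zeta>_integral[OF _ a])
qed

lemma mass0_deriv:
  assumes "a > 0"
  shows "((\<lambda>a. a ^ N * \<mu> 0 a) has_real_derivative a ^ (N - 1) * R 0 a) (at a)"
proof -
  have "((\<lambda>r. integral {0..r} (\<lambda>\<xi>. \<xi> ^ (N - 1) * R 0 \<xi>)) has_real_derivative a ^ (N - 1) * R 0 a) (at a within {0..a + 1})"
    using assms zero_mem by (intro integral_has_real_derivative continuous_intros R_compose_cont) auto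
  then have "((\<lambda>a. a ^ N * \<mu> 0 a) has_real_derivative a ^ (N - 1) * R 0 a) (at a within {0..a + 1})"
    by (rule has_field_derivative_transform_within[OF _ zero_less_one])
      (use assms mass_eq_integral[OF zero_mem] in auto)
  moreover have "at a within {0..a + 1} = at a" using assms by (intro at_within_interior) auto
  ultimately show ?thesis by simp
qed

text \<open>The velocity is only \<open>C^1\<close>, so \<open>vx\<close> has no time derivative to
  start from. Instead the integral form of Newton's law is differentiated in the label under the
  integral sign, and the resulting formula for \<open>P\<close> is differentiable in time. At the
  centre \<open>P\<close> coincides with \<open>\<zeta>\<close>, and the two formulas agree because
  \<open>N * \<mu> 0 0 = R 0 0\<close>.\<close>

lemma P_deriv:
  assumes t: "t \<in> I" and a: "a \<ge> 0"
  shows "((\<lambda>t. P t a) has_real_derivative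
    k * R 0 a / \<eta> t a ^ (N - 1) - k * real (N - 1) * \<mu> 0 a * \<Gamma> t a / \<eta> t a ^ N) (at t within I)"
proof (cases "a = 0")
  case True
  have "((\<lambda>t. P t 0) has_real_derivative k * \<mu> 0 0 / \<eta> t 0 ^ (N - 1)) (at t within I)"
    by (rule has_field_derivative_transform_within[OF \<zeta>_deriv[OF t order_refl] zero_less_one t]) (simp add: P_origin)
  moreover have "k * \<mu> 0 0 / \<eta> t 0 ^ (N - 1)
     = k * R 0 0 / \<eta> t 0 ^ (N - 1) - k * real (N - 1) * \<mu> 0 0 * \<Gamma> t 0 / \<eta> t 0 ^ N"
  proof -
    define y where "y = \<eta> t 0"
    have y: "y > 0" unfolding y_def by (rule W_pos)
    have "real N * \<mu> 0 0 = R 0 0" using \<mu>_0[of 0] dim by simp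
    moreover have "real (N - 1) = real N - 1" using dim by simp
    ultimately show ?thesis using y by (simp add: power_dim[of y] field_simps flip: y_def)
  qed
  ultimately show ?thesis using True by simp
next
  case False
  then have a: "a > 0" using a by simp
  define g where "g s b = k * (b ^ N * \<mu> 0 b) / flow s b ^ (N - 1)" for s b
  define h where "h s b = k * (b ^ (N - 1) * R 0 b) / flow s b ^ (N - 1) - real (N - 1) * (k * (b ^ N * \<mu> 0 b)) * \<Gamma> s b / flow s b ^ N" for s b
  have h_eq: "h s a = k * R 0 a / \<eta> s a ^ (N - 1) - k * real (N - 1) * \<mu> 0 a * \<Gamma> s a / \<eta> s a ^ N" if "s \<in> I" for s
    unfolding h_def flow_eq_mult_W[OF that less_imp_le[OF a]]
    using a by (simp add: power_mult_distrib)
  have h_cont: "continuous_on I (\<lambda>s. h s a)"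
    unfolding h_def using a
    by (intro continuous_intros flow_cont_t \<Gamma>_cont_t) (auto simp: flow_nonzero)
  have P_int: "P t a = P 0 a + integral {0..t} (\<lambda>s. h s a)" if t: "t \<in> I" for t
  proof -
    have sub: "{0..t} \<subseteq> I" using Icc_subset[OF t] .
    have gd: "((\<lambda>b. g s b) has_real_derivative h s b) (at b)" if s: "s \<in> I" and b: "b > 0" for s b
    proof -
      have pos: "flow s b > 0" using flow_pos[OF s b] .
      have 1: "((\<lambda>b. k * (b ^ N * \<mu> 0 b)) has_real_derivative k * (b ^ (N - 1) * R 0 b)) (at b)"
        by (intro DERIV_cmult mass0_deriv b)
      have 2: "((\<lambda>b. 1 / flow s b ^ (N - 1)) has_real_derivative - (real (N - 1) * \<Gamma> s b / flow s b ^ N)) (at b)"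
        using has_real_derivative_divide_power[OF flow_deriv_a[OF s b], of 1 "N - 1"] pos dim by simp
      show ?thesis
        using DERIV_mult[OF 1 2] by (simp add: g_def h_def algebra_simps)
    qed
    have "((\<lambda>b. integral (cbox 0 t) (\<lambda>s. g s b)) has_real_derivative integral (cbox 0 t) (\<lambda>s. h s a)) (at a within {0<..})"
    proof (rule leibniz_rule_field_derivative)
      fix b s :: real assume "b \<in> {0<..}" "s \<in> cbox 0 t"
      then have "s \<in> I" "b > 0" using sub by auto
      then show "((\<lambda>b. g s b) has_real_derivative h s b) (at b within {0<..})"
        by (rule has_field_derivative_at_within[OF gd])
    next
      fix b :: real assume "b \<in> {0<..}"
      then show "(\<lambda>s. g s b) integrable_on cbox 0 t"
        unfolding g_def using sub
        by (intro integrable_continuous continuous_intros continuous_on_subset[OF flow_cont_t])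
          (auto simp: flow_nonzero subset_eq)
    next
      have "continuous_on ({0<..} \<times> cbox 0 t) (\<lambda>p. h (snd p) (fst p))"
        unfolding h_def using sub
        by (intro continuous_intros flow_compose_cont W_compose_cont R_compose_cont continuous_on_compose2[OF \<mu>_cont[OF zero_mem]])
          (auto simp: flow_nonzero subset_eq zero_mem)
      then show "continuous_on ({0<..} \<times> cbox 0 t) (\<lambda>(b, s). h s b)" by (simp add: case_prod_unfold)
    qed (use a in auto)
    then have 1: "((\<lambda>b. integral {0..t} (\<lambda>s. g s b)) has_real_derivative integral {0..t} (\<lambda>s. h s a)) (at a)"
      using at_within_open[of a "{0<..}"] a by simp
    have 2: "((\<lambda>b. v t (flow t b) - v 0 b) has_real_derivative vx t (flow t a) * \<Gamma> t a - vx 0 a) (at a)"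
      by (rule DERIV_diff[OF DERIV_chain2[OF v_deriv_x[OF t] flow_deriv_a[OF t a]] v_deriv_x[OF zero_mem]])
    have "((\<lambda>b. integral {0..t} (\<lambda>s. g s b)) has_real_derivative vx t (flow t a) * \<Gamma> t a - vx 0 a) (at a)"
    proof (rule has_field_derivative_transform_within_open[OF 2 open_greaterThan])
      fix b :: real assume b: "b \<in> {0<..}"
      show "v t (flow t b) - v 0 b = integral {0..t} (\<lambda>s. g s b)"
        using integral_unique[OF path_velocity[OF t flow_path[OF t], of b t]] b nonneg[OF t] by (simp add: g_def)
    qed (use a in simp)
    from DERIV_unique[OF 1 this] have "integral {0..t} (\<lambda>s. h s a) = vx t (flow t a) * \<Gamma> t a - vx 0 a" .
    moreover have "P 0 a = vx 0 a" using a by (simp add: P_def flow_0 W_0)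
    ultimately show ?thesis by (simp add: P_def)
  qed
  from DERIV_add[OF DERIV_const[of "P 0 a"] integral_has_derivative[OF h_cont t]]
  have "((\<lambda>t. P 0 a + integral {0..t} (\<lambda>s. h s a)) has_real_derivative h t a) (at t within I)" by simp
  then have "((\<lambda>t. P t a) has_real_derivative h t a) (at t within I)"
    by (rule has_field_derivative_transform_within[OF _ zero_less_one t]) (simp add: P_int)
  then show ?thesis by (simp add: h_eq[OF t])
qed

text \<open>Conservation of mass in Lagrangian form: \<open>\<eta> ^ (N - 1) * \<Gamma>\<close> is
  the Jacobian of the flow on \<open>N\<close>-space, with \<open>N - 1\<close> tangential
  stretchings and one radial. For \<open>a > 0\<close> the product with the density has zero time
  derivative; the centre follows by continuity in the label.\<close>

lemma density_along_flow:
  assumes t: "t \<in> I" and a: "a \<ge> 0"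
  shows "R t (flow t a) * (\<eta> t a ^ (N - 1) * \<Gamma> t a) = R 0 a"
proof -
  have pos: "R t (flow t a) * (\<eta> t a ^ (N - 1) * \<Gamma> t a) = R 0 a" if a: "a > 0" for a
  proof (cases "t = 0")
    case False
    define q where "q s = R s (flow s a) * (\<eta> s a ^ (N - 1) * \<Gamma> s a)" for s
    have sub: "{0..t} \<subseteq> I" using Icc_subset[OF t] .
    have qd: "(q has_real_derivative
        (Rt s (flow s a) + Rx s (flow s a) * v s (flow s a)) * (\<eta> s a ^ (N - 1) * \<Gamma> s a)
        + (real (N - 1) * \<eta> s a ^ (N - 2) * \<zeta> s a * \<Gamma> s a + P s a * \<eta> s a ^ (N - 1)) * R s (flow s a)) (at s within I)"
      if s: "s \<in> I" for s
    proof -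
      have f1: "((\<lambda>s. R s (flow s a)) has_real_derivative Rt s (flow s a) + Rx s (flow s a) * v s (flow s a)) (at s within I)"
        by (rule has_real_derivative_along_path[OF R_deriv[OF s] _ _ flow_deriv[OF s less_imp_le[OF a]]]) simp_all
      have "((\<lambda>s. \<eta> s a ^ (N - 1)) has_real_derivative real (N - 1) * (\<zeta> s a * \<eta> s a ^ (N - 1 - Suc 0))) (at s within I)"
        by (rule DERIV_power[OF \<eta>_deriv[OF s less_imp_le[OF a]]])
      moreover have "real (N - 1) * (\<zeta> s a * \<eta> s a ^ (N - 1 - Suc 0)) = real (N - 1) * \<eta> s a ^ (N - 2) * \<zeta> s a"
        by (simp add: numeral_2_eq_2)
      ultimately have f2: "((\<lambda>s. \<eta> s a ^ (N - 1)) has_real_derivative real (N - 1) * \<eta> s a ^ (N - 2) * \<zeta> s a) (at s within I)"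
        by (simp only:)
      show ?thesis
        unfolding q_def by (rule DERIV_mult[OF f1 DERIV_mult[OF f2 \<Gamma>_deriv[OF s less_imp_le[OF a]]]])
    qed
    have "q t = q 0"
    proof (rule DERIV_isconst2[of 0 t])
      show "continuous_on {0..t} q"
        by (rule continuous_on_subset[OF DERIV_continuous_on[OF qd] sub])
      fix s assume s: "0 < s" "s < t"
      then have sI: "s \<in> I" using sub by auto
      have "at s within I = at s" unfolding at_within_Icc[OF t s(2)] using s by (intro at_within_interior) auto
      moreover have "(Rt s (flow s a) + Rx s (flow s a) * v s (flow s a)) * (\<eta> s a ^ (N - 1) * \<Gamma> s a)
        + (real (N - 1) * \<eta> s a ^ (N - 2) * \<zeta> s a * \<Gamma> s a + P s a * \<eta> s a ^ (N - 1)) * R s (flow s a) = 0"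
      proof -
        define x where "x = flow s a"
        have x: "x > 0" using flow_pos[OF sI a] by (simp add: x_def)
        have e: "x = a * \<eta> s a" using flow_eq_mult_W[OF sI less_imp_le[OF a]] by (simp add: x_def)
        have z: "\<zeta> s a = v s x / a" using \<zeta>_eq[OF sI a] by (simp add: x_def)
        have z': "\<eta> s a ^ (N - 2) * \<zeta> s a = \<eta> s a ^ (N - 1) * (v s x / x)"
        proof -
          obtain n where "N = Suc (Suc n)" using dim by (intro that[of "N - 2"]) simp
          then have "\<eta> s a ^ (N - 1) = \<eta> s a ^ (N - 2) * \<eta> s a" by simp
          then have "\<eta> s a ^ (N - 1) * (v s x / x) = \<eta> s a ^ (N - 2) * (\<eta> s a * v s x / (a * \<eta> s a))"
            by (simp only: e[symmetric]) simp
          also have "\<eta> s a * v s x / (a * \<eta> s a) = \<zeta> s a" using W_pos[of s a 0] by (simp add: z)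
          finally show ?thesis ..
        qed
        have c: "Rt s x = - (Rx s x * v s x + R s x * vx s x + real (N - 1) * R s x * v s x / x)"
          using continuity[OF sI s(1) x] by linarith
        have "real (N - 1) * \<eta> s a ^ (N - 2) * \<zeta> s a * \<Gamma> s a = real (N - 1) * (\<eta> s a ^ (N - 1) * (v s x / x)) * \<Gamma> s a"
          unfolding z'[symmetric] by (simp only: mult.assoc)
        note E = this
        have "(A + B * V) * (y * G) + (n * (y * (V / x)) * G + w * G * y) * r = 0"
          if "A = - (B * V + r * w + n * r * V / x)" for A B V y G n w r :: real
          unfolding that by (simp add: algebra_simps)
        from this[OF c, of "\<eta> s a ^ (N - 1)" "\<Gamma> s a"] show ?thesis
          unfolding P_def E x_def[symmetric] .
      qed
      ultimately show "(q has_real_derivative 0) (at s)" using qd[OF sI] by simp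
    qed (use False nonneg[OF t] in auto)
    then show ?thesis using a by (simp add: q_def flow_0 W_0)
  qed (use a in \<open>simp add: flow_0 W_0\<close>)
  show ?thesis
  proof (cases "a = 0")
    case True
    define f where "f a = R t (flow t a) * (\<eta> t a ^ (N - 1) * \<Gamma> t a) - R 0 a" for a
    have "continuous_on {0..} f"
      unfolding f_def using t zero_mem
      by (intro continuous_intros R_compose_cont flow_compose_cont W_compose_cont) auto
    then have "(f \<longlongrightarrow> f 0) (at 0 within {0..})" by (simp add: continuous_on_def)
    then have "(f \<longlongrightarrow> f 0) (at_right 0)" by (rule tendsto_within_subset) auto
    moreover have "(f \<longlongrightarrow> 0) (at_right 0)"
      by (rule tendsto_eventually, rule eventually_at_rightI[of 0 1]) (simp_all add: pos f_def del: One_nat_def)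
    ultimately have "f 0 = 0" by (rule tendsto_unique[rotated]) simp
    then show ?thesis using True by (simp add: f_def)
  qed (use pos a in auto)
qed

end

section \<open>Dynamics of a single shell\<close>

context time_domain
begin

lemma mean_value:
  fixes f :: "real \<Rightarrow> real"
  assumes f: "\<And>t. t \<in> I \<Longrightarrow> (f has_real_derivative f' t) (at t within I)"
    and st: "t \<in> I" "0 \<le> s" "s < t"
  shows "\<exists>z. s < z \<and> z < t \<and> f t - f s = f' z * (t - s)"
proof -
  have sub: "{s..t} \<subseteq> I" using Icc_subset[OF st(1)] st(2) by auto
  have "(f has_derivative (*) (f' x)) (at x within {s..t})" if "s \<le> x" "x \<le> t" for x
    using DERIV_subset[OF f sub, of x] subsetD[OF sub, of x] that by (simp add: has_field_derivative_def)
  from mvt_simple[OF st(3) this] show ?thesis by auto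
qed

lemma increment_le:
  fixes f :: "real \<Rightarrow> real"
  assumes f: "\<And>t. t \<in> I \<Longrightarrow> (f has_real_derivative f' t) (at t within I)"
    and st: "t \<in> I" "0 \<le> s" "s \<le> t" and le: "\<And>r. s < r \<Longrightarrow> r < t \<Longrightarrow> f' r \<le> K"
  shows "f t - f s \<le> K * (t - s)"
proof (cases "s = t")
  case False
  then obtain z where z: "s < z" "z < t" "f t - f s = f' z * (t - s)"
    using mean_value[OF f st(1,2)] st(3) by fastforce
  then show ?thesis using le[of z] by (simp add: mult_right_mono)
qed simp

lemma increment_ge:
  fixes f :: "real \<Rightarrow> real"
  assumes f: "\<And>t. t \<in> I \<Longrightarrow> (f has_real_derivative f' t) (at t within I)"
    and st: "t \<in> I" "0 \<le> s" "s \<le> t" and le: "\<And>r. s < r \<Longrightarrow> r < t \<Longrightarrow> K \<le> f' r"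
  shows "K * (t - s) \<le> f t - f s"
proof (cases "s = t")
  case False
  then obtain z where z: "s < z" "z < t" "f t - f s = f' z * (t - s)"
    using mean_value[OF f st(1,2)] st(3) by fastforce
  then show ?thesis using le[of z] by (simp add: mult_right_mono)
qed simp

lemma constant_of_zero_derivative:
  fixes f :: "real \<Rightarrow> real"
  assumes "\<And>t. t \<in> I \<Longrightarrow> (f has_real_derivative 0) (at t within I)" and t: "t \<in> I"
  shows "f t = f 0"
  using increment_le[OF assms(1) t order_refl nonneg[OF t], of 0] increment_ge[OF assms(1) t order_refl nonneg[OF t], of 0]
  by simp

end

text \<open>
  The equations of motion of a single shell: \<open>\<eta>\<close> is the ratio of its radius to the initial one, \<open>\<Gamma>\<close> the
  derivative of its radius with respect to the initial one.
\<close>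

locale shell = time_domain +
  fixes \<eta> \<zeta> \<Gamma> P :: "real \<Rightarrow> real" and k \<mu> \<rho> :: real and N :: nat
  assumes \<eta>_deriv: "t \<in> I \<Longrightarrow> (\<eta> has_real_derivative \<zeta> t) (at t within I)"
    and \<zeta>_deriv: "t \<in> I \<Longrightarrow> (\<zeta> has_real_derivative k * \<mu> / \<eta> t ^ (N - 1)) (at t within I)"
    and \<Gamma>_deriv: "t \<in> I \<Longrightarrow> (\<Gamma> has_real_derivative P t) (at t within I)"
    and P_deriv: "t \<in> I \<Longrightarrow>
      (P has_real_derivative k * \<rho> / \<eta> t ^ (N - 1) - k * real (N - 1) * \<mu> * \<Gamma> t / \<eta> t ^ N) (at t within I)"
    and \<eta>_pos: "t \<in> I \<Longrightarrow> \<eta> t > 0" and \<Gamma>_pos: "t \<in> I \<Longrightarrow> \<Gamma> t > 0"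
    and \<eta>_0: "\<eta> 0 = 1" and \<Gamma>_0: "\<Gamma> 0 = 1"
    and k_pos: "k > 0" and \<mu>_nonneg: "\<mu> \<ge> 0" and \<rho>_nonneg: "\<rho> \<ge> 0" and dim: "N \<ge> 3"
begin

text \<open>The energy \<open>E(a)\<close> of the overview divided by \<open>a\<^sup>2\<close>,
  since lengths are measured in units of the initial radius.\<close>

definition energy where "energy = (\<zeta> 0)\<^sup>2 / 2 + k * \<mu> / real (N - 2)"

lemma inverse_power_deriv:
  "t \<in> I \<Longrightarrow> ((\<lambda>t. c / \<eta> t ^ n) has_real_derivative - (real n * c * \<zeta> t / \<eta> t ^ (n + 1))) (at t within I)"
  using has_real_derivative_divide_power[OF \<eta>_deriv, of t c n] \<eta>_pos[of t] by simp

lemma energy_eq: "t \<in> I \<Longrightarrow> (\<zeta> t)\<^sup>2 / 2 + k * \<mu> / real (N - 2) / \<eta> t ^ (N - 2) = energy"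
proof -
  assume t: "t \<in> I"
  have "((\<lambda>t. (\<zeta> t)\<^sup>2 / 2 + k * \<mu> / real (N - 2) / \<eta> t ^ (N - 2)) has_real_derivative 0) (at t within I)"
    if t: "t \<in> I" for t
  proof -
    have 1: "((\<lambda>t. (\<zeta> t)\<^sup>2 / 2) has_real_derivative \<zeta> t * (k * \<mu> / \<eta> t ^ (N - 1))) (at t within I)"
      using \<zeta>_deriv[OF t] by (auto intro!: derivative_eq_intros)
    obtain n where n: "N = Suc (Suc (Suc n))" using dim by (intro that[of "N - 3"]) simp
    show ?thesis
      by (rule DERIV_cong[OF DERIV_add[OF 1 inverse_power_deriv[OF t]]]) (simp add: n)
  qed
  from constant_of_zero_derivative[OF this t] show ?thesis by (simp add: energy_def \<eta>_0)
qed

lemma zeta_square_le: "t \<in> I \<Longrightarrow> (\<zeta> t)\<^sup>2 \<le> 2 * energy"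
proof -
  assume t: "t \<in> I"
  have "k * \<mu> / real (N - 2) / \<eta> t ^ (N - 2) \<ge> 0"
    using k_pos \<mu>_nonneg \<eta>_pos[OF t] by (intro divide_nonneg_nonneg mult_nonneg_nonneg) auto
  then show ?thesis using energy_eq[OF t] by simp
qed

lemma zeta_bound: "t \<in> I \<Longrightarrow> \<bar>\<zeta> t\<bar> \<le> sqrt (2 * energy)"
  using zeta_square_le[of t] by (intro real_le_rsqrt) simp

text \<open>This is \<open>E'(a) / a\<close> for the energy of the overview, so
  \<open>Q \<le> 0\<close> is the rescaled hypothesis on \<open>A0\<close>.\<close>

definition Q where "Q = \<zeta> 0 * P 0 - k * \<mu> + k * \<rho> / real (N - 2)"

text \<open>The derivative of the energy identity with respect to the initial radius.\<close>

lemma Q_eq: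
  assumes t: "t \<in> I"
  shows "\<zeta> t * P t - k * \<mu> * \<Gamma> t / \<eta> t ^ (N - 1) + k * \<rho> / real (N - 2) / \<eta> t ^ (N - 2) = Q"
proof -
  define q where "q t = \<zeta> t * P t - k * \<mu> / \<eta> t ^ (N - 1) * \<Gamma> t + k * \<rho> / real (N - 2) / \<eta> t ^ (N - 2)" for t
  have "(q has_real_derivative 0) (at t within I)" if t: "t \<in> I" for t
  proof -
    obtain n where n: "N = Suc (Suc (Suc n))" using dim by (intro that[of "N - 3"]) simp
    have 3: "((\<lambda>t. k * \<rho> / real (N - 2) / \<eta> t ^ (N - 2)) has_real_derivative - (k * \<rho> * \<zeta> t / \<eta> t ^ (N - 1))) (at t within I)"
      by (rule DERIV_cong[OF inverse_power_deriv[OF t]]) (simp add: n)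
    show ?thesis
      unfolding q_def
      by (rule DERIV_cong[OF DERIV_add[OF DERIV_diff[OF DERIV_mult[OF \<zeta>_deriv[OF t] P_deriv[OF t]]
            DERIV_mult[OF inverse_power_deriv[OF t] \<Gamma>_deriv[OF t]]] 3]])
        (simp add: n algebra_simps)
  qed
  from constant_of_zero_derivative[OF this t] show ?thesis by (simp add: q_def Q_def \<eta>_0 \<Gamma>_0)
qed

section \<open>Shells that cannot exist for all times\<close>

lemma ratio_deriv:
  assumes t: "t \<in> I" and z: "\<zeta> t \<noteq> 0"
  shows "((\<lambda>t. \<Gamma> t / \<zeta> t) has_real_derivative (Q - k * \<rho> / real (N - 2) / \<eta> t ^ (N - 2)) / (\<zeta> t)\<^sup>2) (at t within I)"
proof -
  have "(P t * \<zeta> t - \<Gamma> t * (k * \<mu> / \<eta> t ^ (N - 1))) = Q - k * \<rho> / real (N - 2) / \<eta> t ^ (N - 2)"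
    using Q_eq[OF t] by (simp add: mult_ac)
  then show ?thesis
    using DERIV_divide[OF \<Gamma>_deriv[OF t] \<zeta>_deriv[OF t] z] by (simp add: power2_eq_square)
qed

text \<open>The function \<open>w\<close> stands for a guaranteed rate of decrease of
  \<open>\<Gamma> / \<zeta>\<close>: linear when \<open>Q < 0\<close>, logarithmic in dimension
  three. Once \<open>\<zeta>\<close> is positive, \<open>\<Gamma> / \<zeta> + w\<close> does not
  increase, so \<open>w\<close> would stay bounded.\<close>

lemma not_global:
  assumes I: "I = {0..}" and \<mu>: "\<mu> > 0"
    and w: "\<And>t. t > 0 \<Longrightarrow> (w has_real_derivative w' t) (at t)" "filterlim w at_top at_top"
    and le: "\<And>t. t > 0 \<Longrightarrow> \<zeta> t > 0 \<Longrightarrow> (Q - k * \<rho> / real (N - 2) / \<eta> t ^ (N - 2)) / (\<zeta> t)\<^sup>2 \<le> - w' t"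
  shows False
proof -
  have \<zeta>_mono: "\<zeta> s \<le> \<zeta> t" if "0 \<le> s" "s \<le> t" for s t
  proof -
    have tI: "t \<in> I" using that I by simp
    have "0 * (t - s) \<le> \<zeta> t - \<zeta> s"
    proof (rule increment_ge[OF \<zeta>_deriv tI that])
      fix r assume "s < r" "r < t"
      then have "r \<in> I" using that I by simp
      from \<eta>_pos[OF this] show "0 \<le> k * \<mu> / \<eta> r ^ (N - 1)" using k_pos \<mu> by simp
    qed
    then show ?thesis by simp
  qed
  \<comment> \<open>As long as \<open>\<zeta>\<close> is not positive,
    \<open>\<eta> \<le> 1\<close>, so the acceleration is at least \<open>k * \<mu>\<close> and
    \<open>\<zeta>\<close> becomes positive after a finite time.\<close>
  have "\<exists>t>0. \<zeta> t > 0"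
  proof (rule ccontr)
    assume neg: "\<not> (\<exists>t>0. \<zeta> t > 0)"
    have \<eta>1: "\<eta> t \<le> 1" if "t \<ge> 0" for t
    proof -
      have tI: "t \<in> I" using that I by simp
      have "\<eta> t - \<eta> 0 \<le> 0 * (t - 0)"
      proof (rule increment_le[OF \<eta>_deriv tI order_refl that])
        fix r :: real assume "0 < r"
        then show "\<zeta> r \<le> 0" using neg by (meson not_less)
      qed
      then show ?thesis by (simp add: \<eta>_0)
    qed
    have grow: "k * \<mu> * (t - 0) \<le> \<zeta> t - \<zeta> 0" if "t \<ge> 0" for t
    proof (rule increment_ge[OF \<zeta>_deriv])
      fix r assume r: "0 < r" "r < t"
      have "0 < \<eta> r ^ (N - 1)" "\<eta> r ^ (N - 1) \<le> 1" using \<eta>1[of r] \<eta>_pos[of r] r I by (auto intro: power_le_one)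
      then show "k * \<mu> \<le> k * \<mu> / \<eta> r ^ (N - 1)" using k_pos \<mu> by (simp add: pos_le_divide_eq mult_left_le)
    qed (use that I in auto)
    define t where "t = (\<bar>\<zeta> 0\<bar> + 1) / (k * \<mu>)"
    have "t > 0" unfolding t_def using k_pos \<mu> by (intro divide_pos_pos) auto
    moreover have "k * \<mu> * t = \<bar>\<zeta> 0\<bar> + 1" unfolding t_def using k_pos \<mu> by simp
    ultimately have "\<zeta> t > 0" using grow[of t] by simp
    then show False using neg \<open>t > 0\<close> by blast
  qed
  then obtain t1 where t1: "t1 > 0" "\<zeta> t1 > 0" by blast
  have pos: "\<zeta> t > 0" if "t \<ge> t1" for t using \<zeta>_mono[of t1 t] t1 that by simp
  define h where "h t = \<Gamma> t / \<zeta> t + w t" for t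
  have "h t \<le> h t1" if t: "t \<ge> t1" for t
  proof (rule DERIV_nonpos_imp_nonincreasing[OF t])
    fix s assume s: "t1 \<le> s" "s \<le> t"
    have "at s within I = at s" unfolding I using s t1 by (intro at_within_interior) auto
    then have "(h has_real_derivative (Q - k * \<rho> / real (N - 2) / \<eta> s ^ (N - 2)) / (\<zeta> s)\<^sup>2 + w' s) (at s)"
      unfolding h_def using DERIV_add[OF ratio_deriv[of s] w(1)[of s, THEN has_field_derivative_at_within]] pos[of s] s t1 I
      by simp
    then show "\<exists>y. (h has_real_derivative y) (at s) \<and> y \<le> 0"
      using le[of s] pos[of s] s t1 by (intro exI conjI) auto
  qed
  have "\<Gamma> t / \<zeta> t \<ge> 0" if "t \<ge> t1" for t
    using pos[OF that] \<Gamma>_pos[of t] I that t1 by (intro divide_nonneg_nonneg) auto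
  have up: "w t \<le> h t1" if "t \<ge> t1" for t
  proof -
    have "\<Gamma> t / \<zeta> t + w t \<le> h t1" "0 \<le> \<Gamma> t / \<zeta> t"
      using \<open>\<And>t. t1 \<le> t \<Longrightarrow> h t \<le> h t1\<close>[OF that] \<open>\<And>t. t1 \<le> t \<Longrightarrow> 0 \<le> \<Gamma> t / \<zeta> t\<close>[OF that] by (simp_all only: h_def)
    then show ?thesis by linarith
  qed
  have "eventually (\<lambda>t. w t > h t1) at_top" using w(2) by (simp add: filterlim_at_top_dense)
  then have "eventually (\<lambda>t::real. False) at_top"
    using eventually_ge_at_top[of t1] by eventually_elim (use up in \<open>simp add: not_less[symmetric]\<close>)
  then show False by simp
qed

lemma energy_pos: "\<mu> > 0 \<Longrightarrow> energy > 0"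
  unfolding energy_def using k_pos dim by (intro add_nonneg_pos divide_pos_pos mult_pos_pos) auto

lemma not_global_of_Q_neg:
  assumes I: "I = {0..}" and \<mu>: "\<mu> > 0" and Q: "Q < 0"
  shows False
proof (rule not_global[OF I \<mu>, of "\<lambda>t. - Q / (2 * energy) * t" "\<lambda>_. - Q / (2 * energy)"])
  have c: "- Q / (2 * energy) > 0" using energy_pos[OF \<mu>] Q by (intro divide_pos_pos) auto
  show "filterlim (\<lambda>t. - Q / (2 * energy) * t) at_top at_top"
    using c by (intro filterlim_tendsto_pos_mult_at_top[OF tendsto_const _ filterlim_ident])
  fix t :: real assume t: "t > 0" "\<zeta> t > 0"
  have tI: "t \<in> I" using t I by simp
  have "k * \<rho> / real (N - 2) / \<eta> t ^ (N - 2) \<ge> 0"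
    using k_pos \<rho>_nonneg \<eta>_pos[OF tI] by (intro divide_nonneg_nonneg mult_nonneg_nonneg) auto
  then have "(Q - k * \<rho> / real (N - 2) / \<eta> t ^ (N - 2)) / (\<zeta> t)\<^sup>2 \<le> Q / (\<zeta> t)\<^sup>2"
    by (intro divide_right_mono) auto
  also have "\<dots> \<le> Q / (2 * energy)"
    using zeta_square_le[OF tI] Q t energy_pos[OF \<mu>] by (intro divide_left_mono_neg) auto
  finally show "(Q - k * \<rho> / real (N - 2) / \<eta> t ^ (N - 2)) / (\<zeta> t)\<^sup>2 \<le> - (- Q / (2 * energy))" by simp
next
  fix t :: real
  show "((\<lambda>t. - Q / (2 * energy) * t) has_real_derivative - Q / (2 * energy)) (at t)"
    using DERIV_cmult[OF DERIV_ident, of "- Q / (2 * energy)" t UNIV] by (simp only: mult_1_right)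
qed

lemma not_global_of_dim3:
  assumes I: "I = {0..}" and \<mu>: "\<mu> > 0" and Q: "Q \<le> 0" and \<rho>: "\<rho> > 0" and N: "N = 3"
  shows False
proof -
  define S where "S = sqrt (2 * energy)"
  \<comment> \<open>Chosen so that \<open>c * S / (1 + S * t)\<close> is
    \<open>k * \<rho> / \<eta> t\<close> over twice the energy, with \<open>\<eta> t\<close>
    replaced by its linear bound \<open>1 + S * t\<close>.\<close>
  define c where "c = k * \<rho> / (2 * energy * S)"
  have S: "S > 0" using energy_pos[OF \<mu>] by (simp add: S_def)
  have c: "c > 0" using energy_pos[OF \<mu>] S k_pos \<rho> by (simp add: c_def)
  show False
  proof (rule not_global[OF I \<mu>, of "\<lambda>t. c * ln (1 + S * t)" "\<lambda>t. c * (S / (1 + S * t))"])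
    have "filterlim (\<lambda>t::real. 1 + S * t) at_top at_top"
      using S by (intro filterlim_tendsto_add_at_top[OF tendsto_const]
          filterlim_tendsto_pos_mult_at_top[OF tendsto_const _ filterlim_ident])
    then show "filterlim (\<lambda>t. c * ln (1 + S * t)) at_top at_top"
      using c by (intro filterlim_tendsto_pos_mult_at_top[OF tendsto_const]
          filterlim_compose[OF ln_at_top])
    fix t :: real assume t: "t > 0"
    have p: "1 + S * t > 0" using S t by (simp add: add_pos_pos)
    show "((\<lambda>t. c * ln (1 + S * t)) has_real_derivative c * (S / (1 + S * t))) (at t)"
      using p by (auto intro!: derivative_eq_intros)
    assume z: "\<zeta> t > 0"
    have tI: "t \<in> I" using t I by simp
    have "\<eta> t - \<eta> 0 \<le> S * (t - 0)"
      using tI t zeta_bound I by (intro increment_le[OF \<eta>_deriv]) (auto simp: S_def intro: order_trans[OF abs_ge_self])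
    then have "\<eta> t \<le> 1 + S * t" by (simp add: \<eta>_0)
    then have a: "k * \<rho> / \<eta> t \<ge> k * \<rho> / (1 + S * t)"
      using \<eta>_pos[OF tI] k_pos \<rho> by (intro divide_left_mono) auto
    have "c * (S / (1 + S * t)) = k * \<rho> / (1 + S * t) / (2 * energy)"
      using S by (simp add: c_def)
    also have "\<dots> \<le> k * \<rho> / \<eta> t / (2 * energy)" using energy_pos[OF \<mu>] by (intro divide_right_mono a) auto
    also have "\<dots> \<le> k * \<rho> / \<eta> t / (\<zeta> t)\<^sup>2"
      using zeta_square_le[OF tI] z \<eta>_pos[OF tI] k_pos \<rho> energy_pos[OF \<mu>] by (intro divide_left_mono) auto
    also have "\<dots> \<le> - ((Q - k * \<rho> / \<eta> t) / (\<zeta> t)\<^sup>2)"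
    proof -
      have "k * \<rho> / \<eta> t / (\<zeta> t)\<^sup>2 \<le> - (Q - k * \<rho> / \<eta> t) / (\<zeta> t)\<^sup>2" using Q by (intro divide_right_mono) auto
      then show ?thesis by (simp only: minus_divide_left)
    qed
    finally show "(Q - k * \<rho> / real (N - 2) / \<eta> t ^ (N - 2)) / (\<zeta> t)\<^sup>2 \<le> - (c * (S / (1 + S * t)))"
      by (simp add: N)
  qed
qed

text \<open>The bounds depend on the shell only through \<open>c\<close>, \<open>m\<close>,
  \<open>r\<close> and \<open>p\<close>, so they are uniform over families of labels. Dropping the
  attractive term of \<open>P'\<close> bounds \<open>P\<close> above, integration then bounds
  \<open>\<Gamma>\<close> above, and with this the attractive term is bounded, which gives the lower
  estimate. The loss \<open>D\<close> is proportional to \<open>m\<close>, hence small for shells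
  far out.\<close>

lemma P_bounds:
  assumes I: "I = {0..<T}" and c: "c > 0" "\<And>t. t \<in> I \<Longrightarrow> c \<le> \<eta> t" and m: "\<mu> \<le> m" and r: "\<rho> \<le> r"
    and p: "\<bar>P 0\<bar> \<le> p"
  defines "P1 \<equiv> p + k * r / c ^ (N - 1) * T"
  defines "D \<equiv> k * real (N - 1) * m / c ^ N * (1 + P1 * T) * T"
  assumes t: "t \<in> I"
  shows "P t \<le> P1" "P 0 - D \<le> P t" "\<Gamma> t \<le> 1 + P1 * T"
proof -
  have T: "T > 0" using t I by auto
  have r0: "r \<ge> 0" "m \<ge> 0" "p \<ge> 0" using r \<rho>_nonneg m \<mu>_nonneg p by auto
  have P1: "P1 \<ge> 0" unfolding P1_def using r0 c k_pos T
    by (intro add_nonneg_nonneg mult_nonneg_nonneg divide_nonneg_nonneg) auto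
  have up: "P s \<le> P1" if s: "s \<in> I" for s
  proof -
    have "P s - P 0 \<le> k * r / c ^ (N - 1) * (s - 0)"
    proof (rule increment_le[OF P_deriv s order_refl nonneg[OF s]])
      fix q assume q: "0 < q" "q < s"
      then have qI: "q \<in> I" using Icc_subset[OF s] by auto
      have "k * \<rho> / \<eta> q ^ (N - 1) \<le> k * r / c ^ (N - 1)"
        using r c(1) c(2)[OF qI] k_pos \<rho>_nonneg r0 by (intro frac_le mult_left_mono power_mono) auto
      moreover have "k * real (N - 1) * \<mu> * \<Gamma> q / \<eta> q ^ N \<ge> 0"
        using k_pos \<mu>_nonneg \<Gamma>_pos[OF qI] \<eta>_pos[OF qI]
        by (intro divide_nonneg_nonneg mult_nonneg_nonneg) auto
      ultimately show "k * \<rho> / \<eta> q ^ (N - 1) - k * real (N - 1) * \<mu> * \<Gamma> q / \<eta> q ^ N \<le> k * r / c ^ (N - 1)"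
        by linarith
    qed
    also have "\<dots> \<le> k * r / c ^ (N - 1) * T"
      using s I r0 c k_pos by (intro mult_left_mono divide_nonneg_nonneg mult_nonneg_nonneg) auto
    finally show ?thesis using p by (simp add: P1_def)
  qed
  have G: "\<Gamma> s \<le> 1 + P1 * T" if s: "s \<in> I" for s
  proof -
    have "\<Gamma> s - \<Gamma> 0 \<le> P1 * (s - 0)"
    proof (rule increment_le[OF \<Gamma>_deriv s order_refl nonneg[OF s]])
      fix q assume "0 < q" "q < s"
      then show "P q \<le> P1" using Icc_subset[OF s] by (intro up) auto
    qed
    also have "\<dots> \<le> P1 * T" using P1 s I by (intro mult_left_mono) auto
    finally show ?thesis by (simp add: \<Gamma>_0)
  qed
  have GT: "1 + P1 * T \<ge> 0" using P1 T by (intro add_nonneg_nonneg mult_nonneg_nonneg) auto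
  define K where "K = k * real (N - 1) * m / c ^ N * (1 + P1 * T)"
  have K0: "K \<ge> 0" unfolding K_def using r0 c k_pos GT by (intro mult_nonneg_nonneg divide_nonneg_nonneg) auto
  have "- K * (t - 0) \<le> P t - P 0"
  proof (rule increment_ge[OF P_deriv t order_refl nonneg[OF t]])
    fix q assume q: "0 < q" "q < t"
    then have qI: "q \<in> I" using Icc_subset[OF t] by auto
    have "k * real (N - 1) * \<mu> * \<Gamma> q / \<eta> q ^ N \<le> k * real (N - 1) * m * (1 + P1 * T) / c ^ N"
      using m r0 \<mu>_nonneg k_pos c(1) c(2)[OF qI] G[OF qI] \<Gamma>_pos[OF qI] GT
      by (intro frac_le mult_mono mult_left_mono power_mono mult_nonneg_nonneg) auto
    also have "\<dots> = K" by (simp add: K_def)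
    finally have "k * real (N - 1) * \<mu> * \<Gamma> q / \<eta> q ^ N \<le> K" .
    moreover have "k * \<rho> / \<eta> q ^ (N - 1) \<ge> 0"
      using k_pos \<rho>_nonneg \<eta>_pos[OF qI] by (intro divide_nonneg_nonneg mult_nonneg_nonneg) auto
    ultimately show "- K \<le> k * \<rho> / \<eta> q ^ (N - 1) - k * real (N - 1) * \<mu> * \<Gamma> q / \<eta> q ^ N" by linarith
  qed
  moreover have "K * t \<le> D" unfolding D_def K_def[symmetric] using K0 t I by (intro mult_left_mono) auto
  ultimately show "P 0 - D \<le> P t" by simp
  show "P t \<le> P1" "\<Gamma> t \<le> 1 + P1 * T" using up[OF t] G[OF t] by auto
qed

end

section \<open>Decay of the data\<close>

lemma C1_on_continuous: "C1_on f S \<Longrightarrow> continuous_on S f"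
  unfolding C1_on_def by (meson has_derivative_continuous_on)

lemma filterlim_axis_at_infinity:
  fixes e :: "'a::real_normed_vector"
  assumes "norm e = 1"
  shows "filterlim (\<lambda>x::real. x *\<^sub>R e) at_infinity at_top"
  unfolding filterlim_at_infinity_conv_norm_at_top
proof (rule filterlim_at_top_mono[OF filterlim_ident])
  show "eventually (\<lambda>x::real. x \<le> norm (x *\<^sub>R e)) at_top"
    using assms by (intro always_eventually allI) simp
qed

text \<open>On the axis \<open>i\<close> the \<open>i\<close>-th component of the velocity field is
  its radial profile, so decay on space restricts to decay of profiles. The velocity has Sobolev
  exponent \<open>s + 1\<close>, which is just what the decay of the derivative requires.\<close>

lemma admissible_data_decay:
  fixes i :: "'n::finite"
  assumes s: "s > real CARD('n) / 2" and data: "admissible_data TYPE('n) s \<rho>\<^sub>0 u\<^sub>0"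
  defines "w \<equiv> \<lambda>x. radial_field u\<^sub>0 (x *\<^sub>R axis i 1 :: real ^ 'n) $ i"
  shows "((\<lambda>x. \<rho>\<^sub>0 \<bar>x\<bar>) \<longlongrightarrow> 0) at_top"
    and "(w \<longlongrightarrow> 0) at_top"
    and "(\<And>y. (w has_real_derivative w' y) (at y)) \<Longrightarrow> (w' \<longlongrightarrow> 0) at_top"
    and "\<exists>C. \<forall>a\<ge>0. integral {0..a} (\<lambda>r. r ^ (CARD('n) - 1) * (\<rho>\<^sub>0 \<bar>r\<bar>)\<^sup>2) \<le> C"
proof -
  define e :: "real ^ 'n" where "e = axis i 1"
  have e: "norm e = 1" by (simp add: e_def)
  have \<rho>c: "continuous_on UNIV (radial_scalar \<rho>\<^sub>0 :: real ^ 'n \<Rightarrow> real)"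
    and uc: "continuous_on UNIV (radial_field u\<^sub>0 :: real ^ 'n \<Rightarrow> real ^ 'n)"
    and \<rho>s: "sobolev s (radial_scalar \<rho>\<^sub>0 :: real ^ 'n \<Rightarrow> real)"
    and us: "sobolev (s + 1) (\<lambda>x :: real ^ 'n. radial_field u\<^sub>0 x $ i)"
    using data by (auto simp: admissible_data_def intro: C1_on_continuous)
  have ui: "continuous_on UNIV (\<lambda>x :: real ^ 'n. radial_field u\<^sub>0 x $ i)"
    by (intro continuous_on_component uc)
  have "((\<lambda>x. radial_scalar \<rho>\<^sub>0 (x *\<^sub>R e)) \<longlongrightarrow> 0) at_top"
    by (rule filterlim_compose[OF sobolev_tendsto_0(1)[OF s \<rho>s \<rho>c] filterlim_axis_at_infinity[OF e]])
  then show "((\<lambda>x. \<rho>\<^sub>0 \<bar>x\<bar>) \<longlongrightarrow> 0) at_top" by (simp add: radial_scalar_def e)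
  have s1: "s + 1 > real CARD('n) / 2" "s + 1 > real CARD('n) / 2 + 1" using s by auto
  show "(w \<longlongrightarrow> 0) at_top"
    unfolding w_def e_def[symmetric]
    by (rule filterlim_compose[OF sobolev_tendsto_0(1)[OF s1(1) us ui] filterlim_axis_at_infinity[OF e]])
  show "(w' \<longlongrightarrow> 0) at_top" if "\<And>y. (w has_real_derivative w' y) (at y)"
    using sobolev_tendsto_0(2)[OF s1(1) us ui s1(2) e] that unfolding w_def e_def[symmetric] by blast
  have "continuous_on UNIV (\<lambda>r::real. radial_scalar \<rho>\<^sub>0 (r *\<^sub>R e))"
    by (rule continuous_on_compose2[OF \<rho>c]) (auto intro!: continuous_intros)
  then have cont: "continuous_on UNIV (\<lambda>r. (\<rho>\<^sub>0 \<bar>r\<bar>)\<^sup>2)"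
    by (intro continuous_on_power) (simp add: radial_scalar_def e)
  have "integrable lborel (\<lambda>x::real ^ 'n. (\<rho>\<^sub>0 \<bar>norm x\<bar>)\<^sup>2)"
    using \<rho>s by (simp add: sobolev_def radial_scalar_def)
  from radial_integral_bounded[OF cont _ this]
  show "\<exists>C. \<forall>a\<ge>0. integral {0..a} (\<lambda>r. r ^ (CARD('n) - 1) * (\<rho>\<^sub>0 \<bar>r\<bar>)\<^sup>2) \<le> C" by simp
qed

section \<open>Behaviour at a finite lifespan\<close>

locale finite_time_domain = time_domain +
  fixes T :: real
  assumes I_eq: "I = {0..<T}" and T_pos: "T > 0"
begin

lemma eventually_in_I: "s < T \<Longrightarrow> eventually (\<lambda>t. t \<in> I \<and> s < t \<and> t < T) (at_left T)"
proof -
  assume "s < T"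
  then have "eventually (\<lambda>t. t \<in> {max 0 s<..<T}) (at_left T)"
    using T_pos by (intro eventually_at_left_real) simp
  then show ?thesis by eventually_elim (simp add: I_eq)
qed

text \<open>\<open>f t + K * t\<close> is nondecreasing and bounded on \<open>{0..<T}\<close>, so it
  converges, and \<open>K * t\<close> converges too.\<close>

lemma limit_of_bounded_derivative:
  fixes f :: "real \<Rightarrow> real"
  assumes f: "\<And>t. t \<in> I \<Longrightarrow> (f has_real_derivative f' t) (at t within I)"
    and K: "\<And>t. t \<in> I \<Longrightarrow> \<bar>f' t\<bar> \<le> K"
  shows "\<exists>l. (f \<longlongrightarrow> l) (at_left T)"
proof -
  define g where "g t = f t + K * t" for t
  have I: "t \<in> I \<longleftrightarrow> 0 \<le> t \<and> t < T" for t by (auto simp: I_eq)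
  have step: "\<bar>f t - f s\<bar> \<le> K * (t - s)" if "0 \<le> s" "s \<le> t" "t < T" for s t
  proof -
    have b: "\<bar>f' r\<bar> \<le> K" if "s < r" "r < t" for r
      using K[of r] that \<open>0 \<le> s\<close> \<open>t < T\<close> by (simp add: I)
    have tI: "t \<in> I" using that by (simp add: I)
    have "f t - f s \<le> K * (t - s)"
      by (rule increment_le[OF f tI that(1,2)], assumption) (rule abs_le_D1[OF b])
    moreover have "- K * (t - s) \<le> f t - f s"
    proof (rule increment_ge[OF f tI that(1,2)], assumption)
      fix r assume "s < r" "r < t"
      from b[OF this] show "- K \<le> f' r" by linarith
    qed
    ultimately show ?thesis by simp
  qed
  have mono: "g s \<le> g t" if "0 \<le> s" "s \<le> t" "t < T" for s t
    using step[OF that] by (simp add: g_def algebra_simps abs_le_iff)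
  have K0: "K \<ge> 0" using K[of 0] T_pos by (simp add: I)
  have bdd: "bdd_above (g ` {0..<T})"
  proof (rule bdd_aboveI2)
    fix t assume t: "t \<in> {0..<T}"
    have "K * t \<le> K * T" using t K0 by (intro mult_left_mono) auto
    then show "g t \<le> f 0 + K * T + K * T" using step[of 0 t] t by (auto simp: g_def abs_le_iff)
  qed
  define L where "L = Sup (g ` {0..<T})"
  have "(g \<longlongrightarrow> L) (at_left T)"
  proof (rule increasing_tendsto)
    show "eventually (\<lambda>t. g t \<le> L) (at_left T)"
      using eventually_in_I[OF T_pos]
    proof eventually_elim
      case (elim t)
      then have "g t \<in> g ` {0..<T}" by (simp add: I)
      then show ?case unfolding L_def by (rule cSup_upper[OF _ bdd])
    qed
    fix x assume "x < L"
    then obtain s where s: "s \<in> {0..<T}" "x < g s"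
    proof -
      have "g ` {0..<T} \<noteq> {}" using T_pos by simp
      from less_cSupE[OF _ this, of x] \<open>x < L\<close> show thesis unfolding L_def using that by blast
    qed
    have "s < T" using s by simp
    from eventually_in_I[OF this] show "eventually (\<lambda>t. x < g t) (at_left T)"
    proof eventually_elim
      case (elim t)
      then show ?case using mono[of s t] s by simp
    qed
  qed
  then have "((\<lambda>t. g t - K * t) \<longlongrightarrow> L - K * T) (at_left T)"
    by (intro tendsto_intros)
  then show ?thesis by (auto simp: g_def)
qed

lemma positive_lower_bound:
  fixes f :: "real \<Rightarrow> real"
  assumes f: "continuous_on I f" "\<And>t. t \<in> I \<Longrightarrow> f t > 0" and lim: "(f \<longlongrightarrow> l) (at_left T)" "l > 0"
  shows "\<exists>c>0. \<forall>t\<in>I. c \<le> f t"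
proof -
  have "eventually (\<lambda>t. f t > l / 2) (at_left T)" using lim by (intro order_tendstoD) auto
  then obtain b where b: "b < T" "\<And>t. b < t \<Longrightarrow> t < T \<Longrightarrow> f t > l / 2"
    unfolding eventually_at_left_field by blast
  define s where "s = max 0 b"
  have s: "s \<in> I" using b T_pos by (auto simp: s_def I_eq)
  have "\<exists>x\<in>{0..s}. \<forall>y\<in>{0..s}. f x \<le> f y"
    using nonneg[OF s] Icc_subset[OF s] by (intro continuous_attains_inf continuous_on_subset[OF f(1)]) auto
  then obtain x where x: "x \<in> {0..s}" "\<And>y. y \<in> {0..s} \<Longrightarrow> f x \<le> f y" by blast
  have "f x > 0" using x(1) Icc_subset[OF s] f(2) by blast
  moreover have "min (f x) (l / 2) \<le> f t" if t: "t \<in> I" for t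
  proof (cases "t \<le> s")
    case True
    then show ?thesis using x(2)[of t] nonneg[OF t] by auto
  next
    case False
    then have "b < t" "t < T" using t by (auto simp: s_def I_eq)
    from b(2)[OF this] show ?thesis by linarith
  qed
  ultimately show ?thesis using lim(2) by (intro exI[of _ "min (f x) (l / 2)"]) auto
qed

text \<open>Spreads non-collapse from the label \<open>a\<close> to a neighbourhood. As
  \<open>f t a\<close> does not tend to 0, it is at least some \<open>\<epsilon>\<close> at a time
  \<open>t0\<close> within \<open>\<epsilon> / (4 * (Z + 1))\<close> of \<open>T\<close>. Passing to
  a nearby label costs at most \<open>\<epsilon> / 4\<close> at \<open>t0\<close>, and the
  derivative bound costs at most \<open>\<epsilon> / 4\<close> afterwards; before \<open>t0\<close>
  the bound on compact times applies.\<close>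

lemma uniform_lower_bound:
  fixes f :: "real \<Rightarrow> real \<Rightarrow> real"
  assumes f: "\<And>t b. t \<in> I \<Longrightarrow> b \<in> U \<Longrightarrow> ((\<lambda>t. f t b) has_real_derivative f' t b) (at t within I)"
    and Z: "\<And>t b. t \<in> I \<Longrightarrow> b \<in> U \<Longrightarrow> \<bar>f' t b\<bar> \<le> Z"
    and a: "a \<in> U" and pos: "\<And>t. t \<in> I \<Longrightarrow> f t a > 0"
    and lim: "\<not> ((\<lambda>t. f t a) \<longlongrightarrow> 0) (at_left T)"
    and cont: "\<And>t. t \<in> I \<Longrightarrow> continuous_on U (f t)"
    and cpt: "\<And>t0. t0 \<in> I \<Longrightarrow> \<exists>c>0. \<forall>t\<in>{0..t0}. \<forall>b\<in>U. c \<le> f t b"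
  shows "\<exists>\<delta>>0. \<exists>c>0. \<forall>b\<in>U. \<bar>b - a\<bar> < \<delta> \<longrightarrow> (\<forall>t\<in>I. c \<le> f t b)"
proof -
  obtain \<epsilon> where \<epsilon>: "\<epsilon> > 0" "\<not> eventually (\<lambda>t. dist (f t a) 0 < \<epsilon>) (at_left T)"
    using lim by (auto simp: tendsto_iff)
  have Z0: "Z \<ge> 0" using Z[OF zero_mem a] by simp
  define s where "s = T - \<epsilon> / (4 * (Z + 1))"
  have s: "s < T" using \<epsilon>(1) Z0 by (simp add: s_def)
  obtain t0 where t0: "t0 \<in> I" "s < t0" "t0 < T" "f t0 a \<ge> \<epsilon>"
  proof (rule ccontr)
    assume no: "\<not> thesis"
    have "eventually (\<lambda>t. dist (f t a) 0 < \<epsilon>) (at_left T)"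
      using eventually_in_I[OF s]
    proof eventually_elim
      case (elim t)
      then have "\<not> f t a \<ge> \<epsilon>" using that no by blast
      then show ?case using pos[of t] elim by simp
    qed
    then show False using \<epsilon>(2) by contradiction
  qed
  obtain \<delta> where \<delta>: "\<delta> > 0" "\<And>b. b \<in> U \<Longrightarrow> dist b a < \<delta> \<Longrightarrow> dist (f t0 b) (f t0 a) < \<epsilon> / 4"
  proof -
    have "\<epsilon> / 4 > 0" using \<epsilon>(1) by simp
    with cont[OF t0(1)] a that show thesis unfolding continuous_on_iff by blast
  qed
  obtain c where c: "c > 0" "\<And>t b. t \<in> {0..t0} \<Longrightarrow> b \<in> U \<Longrightarrow> c \<le> f t b" using cpt[OF t0(1)] by blast
  have "min c (\<epsilon> / 2) \<le> f t b" if b: "b \<in> U" "\<bar>b - a\<bar> < \<delta>" and t: "t \<in> I" for b t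
  proof (cases "t \<le> t0")
    case True
    then show ?thesis using c(2)[of t b] b nonneg[OF t] by auto
  next
    case False
    have "- Z * (t - t0) \<le> f t b - f t0 b"
    proof (rule increment_ge[OF f[OF _ b(1)] t nonneg[OF t0(1)]])
      fix r assume "t0 < r" "r < t"
      then have "r \<in> I" using t nonneg[OF t0(1)] by (auto simp: I_eq)
      from Z[OF this b(1)] show "- Z \<le> f' r b" by linarith
    qed (use False in auto)
    moreover have "Z * (t - t0) \<le> (Z + 1) * (\<epsilon> / (4 * (Z + 1)))"
      using t0(2) t Z0 False by (intro mult_mono) (auto simp: s_def I_eq)
    moreover have "(Z + 1) * (\<epsilon> / (4 * (Z + 1))) = \<epsilon> / 4" using Z0 by (simp add: field_simps)
    moreover have "\<bar>f t0 b - f t0 a\<bar> < \<epsilon> / 4" using \<delta>(2)[OF b(1)] b(2) by (simp add: dist_real_def)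
    ultimately show ?thesis using t0(4) by linarith
  qed
  then show ?thesis using \<delta>(1) c(1) \<epsilon>(1) by (intro exI[of _ \<delta>] conjI exI[of _ "min c (\<epsilon> / 2)"]) auto
qed

end

section \<open>Limits of a single shell at the end of a finite lifespan\<close>

locale finite_shell = shell + finite_time_domain
begin

lemma eta_limit: "\<exists>e\<ge>0. (\<eta> \<longlongrightarrow> e) (at_left T)"
proof -
  obtain e where e: "(\<eta> \<longlongrightarrow> e) (at_left T)"
    using limit_of_bounded_derivative[OF \<eta>_deriv zeta_bound] by blast
  moreover have "e \<ge> 0"
    using eventually_in_I[OF T_pos] by (intro tendsto_lowerbound[OF e]) (auto elim!: eventually_mono intro: less_imp_le \<eta>_pos)
  ultimately show ?thesis by blast
qed

text \<open>Repulsion by a positive enclosed mass would need infinite energy to reach the centre, so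
  \<open>\<mu> = 0\<close>. The shell then moves freely: \<open>\<eta>\<close> is affine, and its
  slope is determined by the values 1 at time 0 and 0 at \<open>T\<close>.\<close>

lemma collapse:
  assumes lim: "(\<eta> \<longlongrightarrow> 0) (at_left T)"
  shows "\<mu> = 0" "\<zeta> 0 = - 1 / T" "\<And>t. t \<in> I \<Longrightarrow> \<zeta> t = \<zeta> 0"
proof -
  define K where "K = k * \<mu> / real (N - 2)"
  have "((\<lambda>t. energy * \<eta> t ^ (N - 2)) \<longlongrightarrow> energy * 0 ^ (N - 2)) (at_left T)" by (intro tendsto_intros lim)
  then have "((\<lambda>t. energy * \<eta> t ^ (N - 2)) \<longlongrightarrow> 0) (at_left T)" using dim by (simp add: zero_power)
  moreover have "eventually (\<lambda>t. K \<le> energy * \<eta> t ^ (N - 2)) (at_left T)"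
    using eventually_in_I[OF T_pos]
  proof eventually_elim
    case (elim t)
    then have t: "t \<in> I" by simp
    have "(\<zeta> t)\<^sup>2 / 2 + K / \<eta> t ^ (N - 2) = energy" unfolding K_def by (rule energy_eq[OF t])
    moreover have "(\<zeta> t)\<^sup>2 / 2 \<ge> 0" by simp
    ultimately have "K / \<eta> t ^ (N - 2) \<le> energy" by linarith
    then show ?case using \<eta>_pos[OF t] by (simp add: pos_divide_le_eq)
  qed
  ultimately have "K \<le> 0" by (intro tendsto_lowerbound) auto
  moreover have "K \<ge> 0" using k_pos \<mu>_nonneg by (simp add: K_def)
  ultimately have "K = 0" by simp
  then show \<mu>: "\<mu> = 0" using k_pos dim by (simp add: K_def)
  show z: "\<zeta> t = \<zeta> 0" if "t \<in> I" for t
    by (rule constant_of_zero_derivative[OF _ that]) (use \<zeta>_deriv \<mu> in simp)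
  have "((\<lambda>t. \<eta> t - \<zeta> 0 * t) has_real_derivative 0) (at t within I)" if t: "t \<in> I" for t
    using DERIV_diff[OF \<eta>_deriv[OF t] DERIV_cmult[OF DERIV_ident, of "\<zeta> 0"]] z[OF t] by simp
  from constant_of_zero_derivative[OF this] have e: "\<eta> t = 1 + \<zeta> 0 * t" if "t \<in> I" for t using that \<eta>_0 by force
  have "((\<lambda>t. 1 + \<zeta> 0 * t) \<longlongrightarrow> 1 + \<zeta> 0 * T) (at_left T)" by (intro tendsto_intros)
  moreover have "((\<lambda>t. 1 + \<zeta> 0 * t) \<longlongrightarrow> 0) (at_left T)"
    using lim by (rule Lim_transform_eventually) (use eventually_in_I[OF T_pos] e in \<open>auto elim!: eventually_mono\<close>)
  ultimately have "1 + \<zeta> 0 * T = 0" by (intro tendsto_unique) auto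
  then show "\<zeta> 0 = - 1 / T" using T_pos by (simp add: field_simps)
qed

lemma inverse_remaining_time: "filterlim (\<lambda>t. 1 / (T - t)) at_top (at_left T)"
proof -
  have "((\<lambda>t. T - t) \<longlongrightarrow> T - T) (at_left T)" by (intro tendsto_intros)
  then have "filterlim (\<lambda>t. inverse (T - t)) at_top (at_left T)"
    using eventually_in_I[OF T_pos] by (intro filterlim_inverse_at_top) (auto elim!: eventually_mono)
  then show ?thesis by (simp add: inverse_eq_divide)
qed

text \<open>
  If \<open>P \<rightarrow> 0\<close> while \<open>P\<close> increases, then \<open>\<Gamma> t \<le> |P t| (T - t)\<close>. If \<open>P\<close> decreases, it cannot tend to
  \<open>0\<close>, as \<open>\<Gamma>\<close> could not decrease from \<open>1\<close> to \<open>0\<close>.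
\<close>

lemma gradient_blowup:
  assumes e: "(\<eta> \<longlongrightarrow> e) (at_left T)" "e > 0" and G0: "(\<Gamma> \<longlongrightarrow> 0) (at_left T)"
  shows "filterlim (\<lambda>t. \<bar>P t\<bar> / \<Gamma> t) at_top (at_left T)"
proof -
  define P' where "P' t = k * \<rho> / \<eta> t ^ (N - 1) - k * real (N - 1) * \<mu> * \<Gamma> t / \<eta> t ^ N" for t
  have Pd: "(P has_real_derivative P' t) (at t within I)" if "t \<in> I" for t
    unfolding P'_def by (rule P_deriv[OF that])
  have \<Gamma>_ev: "eventually (\<lambda>t. \<Gamma> t > 0) (at_left T)"
    using eventually_in_I[OF T_pos] by eventually_elim (auto intro: \<Gamma>_pos)
  obtain c where c: "c > 0" "\<And>t. t \<in> I \<Longrightarrow> c \<le> \<eta> t"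
    using positive_lower_bound[OF DERIV_continuous_on[OF \<eta>_deriv] \<eta>_pos e] by blast
  define G where "G = 1 + (\<bar>P 0\<bar> + k * \<rho> / c ^ (N - 1) * T) * T"
  have G: "\<Gamma> t \<le> G" if "t \<in> I" for t
    unfolding G_def by (rule P_bounds(3)[OF I_eq c order_refl order_refl order_refl that])
  have "\<bar>P' t\<bar> \<le> k * \<rho> / c ^ (N - 1) + k * real (N - 1) * \<mu> * G / c ^ N" if t: "t \<in> I" for t
  proof -
    have "0 \<le> k * \<rho> / \<eta> t ^ (N - 1)" "0 \<le> k * real (N - 1) * \<mu> * \<Gamma> t / \<eta> t ^ N"
      using k_pos \<rho>_nonneg \<mu>_nonneg \<eta>_pos[OF t] \<Gamma>_pos[OF t] by auto
    moreover have "k * \<rho> / \<eta> t ^ (N - 1) \<le> k * \<rho> / c ^ (N - 1)"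
      using k_pos \<rho>_nonneg c(1) c(2)[OF t] by (intro frac_le power_mono) auto
    moreover have "k * real (N - 1) * \<mu> * \<Gamma> t / \<eta> t ^ N \<le> k * real (N - 1) * \<mu> * G / c ^ N"
      using k_pos \<mu>_nonneg c(1) c(2)[OF t] G[OF t] \<Gamma>_pos[OF t] by (intro frac_le power_mono mult_left_mono) auto
    ultimately show ?thesis unfolding P'_def by linarith
  qed
  then obtain p where p: "(P \<longlongrightarrow> p) (at_left T)"
    using limit_of_bounded_derivative[OF Pd] by blast
  \<comment> \<open>If the limit \<open>p\<close> of \<open>P\<close> is not 0, the quotient is a
    nonzero limit over a vanishing positive one. For \<open>p = 0\<close> the sign of
    \<open>P'\<close> decides: it is at most 0 throughout when \<open>\<rho> = 0\<close>, and
    otherwise eventually positive, because \<open>\<Gamma> \<rightarrow> 0\<close> removes the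
    attractive term.\<close>
  show ?thesis
  proof (cases "p = 0")
    case False
    then show ?thesis by (intro LIM_at_top_divide[OF tendsto_rabs[OF p] _ G0 \<Gamma>_ev]) auto
  next
    case p0: True
    show ?thesis
    proof (cases "\<rho> = 0")
      case True
      have Pn: "P t \<ge> 0" if t: "t \<in> I" for t
      proof -
        have "t < T" using t by (simp add: I_eq)
        have "eventually (\<lambda>s. P s \<le> P t) (at_left T)"
          using eventually_in_I[OF \<open>t < T\<close>]
        proof eventually_elim
          case (elim s)
          have "P s - P t \<le> 0 * (s - t)"
          proof (rule increment_le[OF Pd])
            fix r assume "t < r" "r < s"
            then have "r \<in> I" using elim nonneg[OF t] by (auto simp: I_eq)
            then show "P' r \<le> 0" using k_pos \<mu>_nonneg \<eta>_pos[of r] \<Gamma>_pos[of r] by (simp add: P'_def True)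
          qed (use elim nonneg[OF t] in auto)
          then show ?case by simp
        qed
        from tendsto_upperbound[OF p this] show ?thesis by (simp add: p0)
      qed
      have "\<Gamma> t \<ge> 1" if t: "t \<in> I" for t
      proof -
        have "0 * (t - 0) \<le> \<Gamma> t - \<Gamma> 0"
        proof (rule increment_ge[OF \<Gamma>_deriv t order_refl nonneg[OF t]], assumption)
          fix r assume "0 < r" "r < t"
          then have "r \<in> I" using t by (simp add: I_eq)
          then show "0 \<le> P r" by (rule Pn)
        qed
        then show ?thesis by (simp add: \<Gamma>_0)
      qed
      then have "eventually (\<lambda>t. 1 \<le> \<Gamma> t) (at_left T)" using eventually_in_I[OF T_pos] by (auto elim!: eventually_mono)
      from tendsto_lowerbound[OF G0 this] show ?thesis by simp
    next
      case False
      have "(P' \<longlongrightarrow> k * \<rho> / e ^ (N - 1) - k * real (N - 1) * \<mu> * 0 / e ^ N) (at_left T)"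
        unfolding P'_def using e(2) by (intro tendsto_intros e(1) G0) auto
      moreover have "k * \<rho> / e ^ (N - 1) - k * real (N - 1) * \<mu> * 0 / e ^ N > 0"
        using k_pos \<rho>_nonneg False e(2) by simp
      ultimately have "eventually (\<lambda>t. P' t > 0) (at_left T)" by (rule order_tendstoD)
      then obtain b where b: "b < T" "\<And>t. b < t \<Longrightarrow> t < T \<Longrightarrow> P' t > 0"
        unfolding eventually_at_left_field by blast
      have mono: "P t \<le> P s" if "t \<in> I" "b < t" "t \<le> s" "s < T" for s t
      proof -
        have "0 * (s - t) \<le> P s - P t"
          using that nonneg[OF that(1)] b(2) by (intro increment_ge[OF Pd]) (auto simp: I_eq intro: less_imp_le)
        then show ?thesis by simp
      qed
      have "eventually (\<lambda>t. 1 / (T - t) \<le> \<bar>P t\<bar> / \<Gamma> t) (at_left T)"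
        using eventually_in_I[OF b(1)]
      proof eventually_elim
        case (elim t)
        then have t: "t \<in> I" "b < t" "t < T" by auto
        have ev: "eventually (\<lambda>s. s \<in> I \<and> t < s \<and> s < T) (at_left T)" by (rule eventually_in_I[OF t(3)])
        have "eventually (\<lambda>s. P t \<le> P s) (at_left T)"
          using ev by eventually_elim (use mono[OF t(1,2)] in auto)
        from tendsto_lowerbound[OF p this] have neg: "P t \<le> 0" by (simp add: p0)
        have "eventually (\<lambda>s. P t * (s - t) \<le> \<Gamma> s - \<Gamma> t) (at_left T)"
          using ev
        proof eventually_elim
          case (elim s)
          then show ?case
            using mono[OF t(1,2)] nonneg[OF t(1)] by (intro increment_ge[OF \<Gamma>_deriv]) auto
        qed
        moreover have "((\<lambda>s. P t * (s - t)) \<longlongrightarrow> P t * (T - t)) (at_left T)" by (intro tendsto_intros)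
        moreover have "((\<lambda>s. \<Gamma> s - \<Gamma> t) \<longlongrightarrow> 0 - \<Gamma> t) (at_left T)" by (intro tendsto_intros G0)
        ultimately have "P t * (T - t) \<le> 0 - \<Gamma> t" by (intro tendsto_le) auto
        then have "\<Gamma> t \<le> \<bar>P t\<bar> * (T - t)" using neg by simp
        then show ?case using \<Gamma>_pos[OF t(1)] t(3) by (simp add: field_simps)
      qed
      then show ?thesis by (rule filterlim_at_top_mono[OF inverse_remaining_time])
    qed
  qed
qed

end

context euler_poisson_radial
begin

lemma shell: "a \<ge> 0 \<Longrightarrow> shell I (\<lambda>t. \<eta> t a) (\<lambda>t. \<zeta> t a) (\<lambda>t. \<Gamma> t a) (\<lambda>t. P t a) k (\<mu> 0 a) (R 0 a) N"
  using \<eta>_deriv \<zeta>_deriv \<Gamma>_deriv P_deriv W_pos W_0 k_pos \<mu>0_nonneg R0_nonneg dim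
  by unfold_locales auto

lemma initial_values: "a \<ge> 0 \<Longrightarrow> P 0 a = vx 0 a" "a > 0 \<Longrightarrow> \<zeta> 0 a = v 0 a / a"
  by (simp_all add: P_def flow_0 W_0 \<zeta>_eq zero_mem)

end

section \<open>Finiteness of the lifespan\<close>

locale decaying_data = euler_poisson_radial +
  fixes C :: real
  assumes v0_lim: "(v 0 \<longlongrightarrow> 0) at_top" and vx0_lim: "(vx 0 \<longlongrightarrow> 0) at_top"
    and R0_lim: "(R 0 \<longlongrightarrow> 0) at_top"
    and square_integral: "a \<ge> 0 \<Longrightarrow> integral {0..a} (\<lambda>r. r ^ (N - 1) * (R 0 r)\<^sup>2) \<le> C"
begin

abbreviation mass0 where "mass0 a \<equiv> a ^ N * \<mu> 0 a"
definition sqint where "sqint a = integral {0..a} (\<lambda>r. r ^ (N - 1) * (R 0 r)\<^sup>2)"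

lemma sqint_deriv:
  assumes "a > 0"
  shows "(sqint has_real_derivative a ^ (N - 1) * (R 0 a)\<^sup>2) (at a)"
proof -
  have "(sqint has_real_derivative a ^ (N - 1) * (R 0 a)\<^sup>2) (at a within {0..a + 1})"
    unfolding sqint_def using assms zero_mem
    by (intro integral_has_real_derivative continuous_intros R_compose_cont) auto
  moreover have "at a within {0..a + 1} = at a" using assms by (intro at_within_interior) auto
  ultimately show ?thesis by simp
qed

lemma sqint_nonneg: "sqint a \<ge> 0"
  unfolding sqint_def
  by (intro integral_nonneg integrable_continuous_real continuous_intros R_compose_cont) (auto simp: zero_mem)

text \<open>Young's inequality \<open>\<rho> \<le> \<lambda> \<rho>\<^sup>2 / 2 + 1 / (2 \<lambda>)\<close>, integrated over a shell.\<close>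

lemma mass0_le:
  assumes r: "0 < r" "r \<le> a" and l: "l > 0"
  shows "mass0 a \<le> mass0 r + l / 2 * (sqint a - sqint r) + a ^ N / (2 * l)"
proof -
  define h where "h x = l / 2 * sqint x + x ^ N / (2 * l * N) - mass0 x" for x
  have "h r \<le> h a"
  proof (rule DERIV_nonneg_imp_nondecreasing[OF r(2)])
    fix x assume "r \<le> x" "x \<le> a"
    then have x: "x > 0" using r by simp
    have p: "((\<lambda>x. x ^ N / (2 * l * N)) has_real_derivative x ^ (N - 1) / (2 * l)) (at x)"
      using dim l by (auto intro!: derivative_eq_intros)
    have "(h has_real_derivative l / 2 * (x ^ (N - 1) * (R 0 x)\<^sup>2) + x ^ (N - 1) / (2 * l) - x ^ (N - 1) * R 0 x) (at x)"
      unfolding h_def by (intro DERIV_diff DERIV_add p DERIV_cmult sqint_deriv mass0_deriv x)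
    moreover have "l / 2 * (x ^ (N - 1) * (R 0 x)\<^sup>2) + x ^ (N - 1) / (2 * l) - x ^ (N - 1) * R 0 x
        = x ^ (N - 1) * (l * R 0 x - 1)\<^sup>2 / (2 * l)"
      using l by (simp add: power2_eq_square field_simps)
    moreover have "x ^ (N - 1) * (l * R 0 x - 1)\<^sup>2 / (2 * l) \<ge> 0" using x l by simp
    ultimately show "\<exists>y. (h has_real_derivative y) (at x) \<and> 0 \<le> y" by auto
  qed
  moreover have "a ^ N / (2 * l * N) \<le> a ^ N / (2 * l)" using r l dim by (intro divide_left_mono) auto
  moreover have "r ^ N / (2 * l * N) \<ge> 0" using r l by simp
  ultimately show ?thesis unfolding h_def by (simp only: right_diff_distrib)
qed

lemma \<mu>0_lim: "(\<mu> 0 \<longlongrightarrow> 0) at_top"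
proof (rule tendstoI)
  fix \<epsilon> :: real assume \<epsilon>: "\<epsilon> > 0"
  \<comment> \<open>\<open>mass0_le\<close> with \<open>l = 1 / \<epsilon>\<close> and
    \<open>r = 1\<close>: the constant part \<open>K\<close> is outgrown by
    \<open>a ^ N * (\<epsilon> / 2)\<close>.\<close>
  define K where "K = mass0 1 + 1 / \<epsilon> / 2 * C"
  have K0: "K \<ge> 0" unfolding K_def using \<epsilon> \<mu>0_nonneg[of 1] sqint_nonneg[of 1] square_integral[of 1] by (simp add: sqint_def)
  have "eventually (\<lambda>a. a > 2 * K / \<epsilon> \<and> a \<ge> 1) at_top"
    by (intro eventually_conj eventually_gt_at_top eventually_ge_at_top)
  then show "eventually (\<lambda>a. dist (\<mu> 0 a) 0 < \<epsilon>) at_top"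
  proof eventually_elim
    case (elim a)
    have "mass0 a \<le> mass0 1 + 1 / \<epsilon> / 2 * (sqint a - sqint 1) + a ^ N / (2 * (1 / \<epsilon>))"
      using elim \<epsilon> by (intro mass0_le) auto
    also have "\<dots> \<le> K + a ^ N * (\<epsilon> / 2)"
    proof -
      have "sqint a - sqint 1 \<le> C" using square_integral[of a] sqint_nonneg[of 1] elim by (simp add: sqint_def)
      then have "1 / \<epsilon> / 2 * (sqint a - sqint 1) \<le> 1 / \<epsilon> / 2 * C" using \<epsilon> by (intro mult_left_mono) auto
      then show ?thesis by (simp add: K_def)
    qed
    also have "K < a ^ N * (\<epsilon> / 2)"
    proof -
      have "K < a * (\<epsilon> / 2)" using elim \<epsilon> by (simp add: field_simps)
      also have "a * (\<epsilon> / 2) \<le> a ^ N * (\<epsilon> / 2)" using elim \<epsilon> dim self_le_power[of a N] by (intro mult_right_mono) auto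
      finally show ?thesis .
    qed
    finally have "a ^ N * \<mu> 0 a < a ^ N * \<epsilon>" by (simp only: distrib_left[symmetric] field_sum_of_halves)
    then have "\<mu> 0 a < \<epsilon>" using elim by (simp add: mult_less_cancel_left_pos)
    then show ?case using \<mu>0_nonneg[of a] elim by simp
  qed
qed

text \<open>Apply \<open>mass0_le\<close> with the parameter
  \<open>2 * a\<^sup>2 / \<epsilon>\<close>. Its last term is then
  \<open>a ^ (N - 2) * \<epsilon> / 4\<close>, and the middle one is at most
  \<open>a\<^sup>2 * \<epsilon> / 4\<close> once \<open>r\<close> leaves less than
  \<open>\<epsilon>\<^sup>2 / 4\<close> of the square integral outside. The comparison of
  \<open>a\<^sup>2\<close> with \<open>a ^ (N - 2)\<close> is where \<open>N \<ge> 4\<close>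
  enters.\<close>

lemma mass0_lim:
  assumes N: "N \<ge> 4"
  shows "((\<lambda>a. mass0 a / a ^ (N - 2)) \<longlongrightarrow> 0) at_top"
proof (rule tendstoI)
  fix \<epsilon> :: real assume \<epsilon>: "\<epsilon> > 0"
  have bdd: "bdd_above (sqint ` {0<..})"
    using square_integral by (intro bdd_aboveI2[of _ _ C]) (simp add: sqint_def)
  define L where "L = Sup (sqint ` {0<..})"
  have "\<exists>r\<in>{0<..}. L - \<epsilon>\<^sup>2 / 4 < sqint r"
  proof -
    have "sqint ` {0<..} \<noteq> {}" by simp
    moreover have "L - \<epsilon>\<^sup>2 / 4 < Sup (sqint ` {0<..})" using \<epsilon> by (simp add: L_def)
    ultimately show ?thesis using less_cSupE by (metis imageE)
  qed
  then obtain r where r: "r > 0" "L - \<epsilon>\<^sup>2 / 4 < sqint r" by auto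
  define K where "K = 2 / \<epsilon>"
  have K: "K > 0" using \<epsilon> by (simp add: K_def)
  have "eventually (\<lambda>a. a > 4 * mass0 r / \<epsilon> \<and> a \<ge> max 1 r) at_top"
    by (intro eventually_conj eventually_gt_at_top eventually_ge_at_top)
  then show "eventually (\<lambda>a. dist (mass0 a / a ^ (N - 2)) 0 < \<epsilon>) at_top"
  proof eventually_elim
    case (elim a)
    then have a: "a \<ge> 1" "a \<ge> r" by auto
    have sL: "sqint a \<le> L" unfolding L_def using a by (intro cSup_upper bdd) auto
    have Na: "a ^ N = a\<^sup>2 * a ^ (N - 2)"
    proof -
      obtain n where "N = Suc (Suc n)" using dim by (intro that[of "N - 2"]) simp
      then show ?thesis by (simp add: power2_eq_square)
    qed
    have "mass0 a \<le> mass0 r + K * a\<^sup>2 / 2 * (sqint a - sqint r) + a ^ N / (2 * (K * a\<^sup>2))"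
      using a r(1) K by (intro mass0_le) auto
    also have "a ^ N / (2 * (K * a\<^sup>2)) = a ^ (N - 2) * (\<epsilon> / 4)"
      unfolding Na K_def using a \<epsilon> by (simp add: field_simps)
    also have "K * a\<^sup>2 / 2 * (sqint a - sqint r) \<le> K * a\<^sup>2 / 2 * (\<epsilon>\<^sup>2 / 4)"
      using sL r(2) K by (intro mult_left_mono) auto
    also have "K * a\<^sup>2 / 2 * (\<epsilon>\<^sup>2 / 4) = a\<^sup>2 * (\<epsilon> / 4)" using \<epsilon> by (simp add: K_def power2_eq_square)
    also have "a\<^sup>2 * (\<epsilon> / 4) \<le> a ^ (N - 2) * (\<epsilon> / 4)"
      using a \<epsilon> N by (intro mult_right_mono power_increasing) auto
    also have "mass0 r < a ^ (N - 2) * (\<epsilon> / 4)"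
    proof -
      have "mass0 r < a * (\<epsilon> / 4)" using elim \<epsilon> by (simp add: field_simps)
      also have "a * (\<epsilon> / 4) \<le> a ^ (N - 2) * (\<epsilon> / 4)" using a \<epsilon> dim self_le_power[of a "N - 2"] by (intro mult_right_mono) auto
      finally show ?thesis .
    qed
    finally have "mass0 a < a ^ (N - 2) * (\<epsilon> / 4) + a ^ (N - 2) * (\<epsilon> / 4) + a ^ (N - 2) * (\<epsilon> / 4)" by (simp add: add_ac)
    then have "mass0 a < a ^ (N - 2) * \<epsilon> * (3 / 4)" by linarith
    also have "\<dots> \<le> a ^ (N - 2) * \<epsilon>" using a \<epsilon> by simp
    finally have "mass0 a / a ^ (N - 2) < \<epsilon>" using a by (simp add: pos_divide_less_eq mult.commute)
    moreover have "mass0 a / a ^ (N - 2) \<ge> 0" using a \<mu>0_nonneg[of a] by simp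
    ultimately show ?case by simp
  qed
qed

lemma lifespan_finite:
  assumes rc: "rc > 0" "R 0 rc > 0"
    and Q: "v 0 rc / rc * vx 0 rc - k * \<mu> 0 rc + k * R 0 rc / real (N - 2) \<le> 0"
  shows "I \<noteq> {0..}"
proof
  assume I: "I = {0..}"
  have mass_mono: "mass0 x \<le> mass0 y" if "0 < x" "x \<le> y" for x y
  proof (rule DERIV_nonneg_imp_nondecreasing[OF that(2)])
    fix z assume "x \<le> z" "z \<le> y"
    then have z: "z > 0" using that by simp
    show "\<exists>D. ((\<lambda>a. mass0 a) has_real_derivative D) (at z) \<and> 0 \<le> D"
      using mass0_deriv[OF z] R0_nonneg[of z] z by (intro exI[of _ "z ^ (N - 1) * R 0 z"] conjI) simp_all
  qed
  \<comment> \<open>Positive density at \<open>rc\<close> makes the mass strictly increasing there,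
    so every shell from \<open>rc\<close> outwards encloses positive mass and
    \<open>not_global\<close> can be used for it.\<close>
  have "rc ^ (N - 1) * R 0 rc > 0" using rc by simp
  from DERIV_pos_inc_left[OF mass0_deriv[OF rc(1)] this]
  obtain d where d: "d > 0" "\<And>h. h > 0 \<Longrightarrow> h < d \<Longrightarrow> mass0 (rc - h) < mass0 rc" by blast
  define h where "h = min (d / 2) (rc / 2)"
  have h: "h > 0" "h < d" "h < rc" using d rc by (auto simp: h_def)
  have "mass0 (rc - h) \<ge> 0" using h \<mu>0_nonneg[of "rc - h"] by simp
  then have mrc: "mass0 rc > 0" using d(2)[OF h(1,2)] by linarith
  have \<mu>b: "\<mu> 0 b > 0" if "b \<ge> rc" for b
  proof -
    have "b ^ N * \<mu> 0 b > 0" using mrc mass_mono[OF rc(1) that] by linarith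
    moreover have "b ^ N > 0" using that rc by simp
    ultimately show ?thesis by (rule zero_less_mult_pos)
  qed
  interpret c: shell I "\<lambda>t. \<eta> t rc" "\<lambda>t. \<zeta> t rc" "\<lambda>t. \<Gamma> t rc" "\<lambda>t. P t rc" k "\<mu> 0 rc" "R 0 rc" N
    using shell rc by simp
  show False
  proof (cases "N = 3")
    case True
    have "c.Q \<le> 0" using Q rc by (simp add: c.Q_def initial_values)
    then show False by (rule c.not_global_of_dim3[OF I \<mu>b[OF order_refl] _ rc(2) True])
  next
    case False
    then have N: "N \<ge> 4" using dim by simp
    \<comment> \<open>\<open>q b\<close> is \<open>E'(b) / b\<close>. A negative value at any
      \<open>b \<ge> rc\<close> contradicts global existence of that shell. Otherwise
      \<open>E\<close> is nondecreasing from its positive value at \<open>rc\<close>, and this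
      contradicts its decay.\<close>
    define q where "q b = v 0 b / b * vx 0 b - k * \<mu> 0 b + k * R 0 b / real (N - 2)" for b
    have q: "q b \<ge> 0" if b: "b \<ge> rc" for b
    proof (rule ccontr)
      assume "\<not> q b \<ge> 0"
      interpret b: shell I "\<lambda>t. \<eta> t b" "\<lambda>t. \<zeta> t b" "\<lambda>t. \<Gamma> t b" "\<lambda>t. P t b" k "\<mu> 0 b" "R 0 b" N
        using shell rc b by simp
      have "b.Q < 0" using \<open>\<not> q b \<ge> 0\<close> b rc by (simp add: b.Q_def q_def initial_values)
      then show False by (rule b.not_global_of_Q_neg[OF I \<mu>b[OF b]])
    qed
    define E where "E a = (v 0 a)\<^sup>2 / 2 + k / real (N - 2) * (mass0 a / a ^ (N - 2))" for a
    have "(E \<longlongrightarrow> 0\<^sup>2 / 2 + k / real (N - 2) * 0) at_top"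
      unfolding E_def by (intro tendsto_intros v0_lim mass0_lim N) auto
    then have lim: "(E \<longlongrightarrow> 0) at_top" by simp
    have mono: "E rc \<le> E a" if a: "rc \<le> a" for a
    proof (rule DERIV_nonneg_imp_nondecreasing[OF a])
      fix x assume "rc \<le> x" "x \<le> a"
      then have x: "x > 0" "x \<ge> rc" using rc by auto
      have 1: "((\<lambda>a. (v 0 a)\<^sup>2 / 2) has_real_derivative v 0 x * vx 0 x) (at x)"
        using v_deriv_x[OF zero_mem, of x] by (auto intro!: derivative_eq_intros)
      have 2: "((\<lambda>a. 1 / a ^ (N - 2)) has_real_derivative - (real (N - 2) / x ^ (N - 1))) (at x)"
      proof -
        have "N - 2 + 1 = N - 1" using dim by simp
        then show ?thesis
          using has_real_derivative_divide_power[OF DERIV_ident, of x 1 "N - 2"] x by simp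
      qed
      have "((\<lambda>a. mass0 a * (1 / a ^ (N - 2))) has_real_derivative
          x ^ (N - 1) * R 0 x * (1 / x ^ (N - 2)) + - (real (N - 2) / x ^ (N - 1)) * mass0 x) (at x)"
        by (rule DERIV_mult[OF mass0_deriv[OF x(1)] 2])
      then have 3: "((\<lambda>a. mass0 a / a ^ (N - 2)) has_real_derivative
          x ^ (N - 1) * R 0 x * (1 / x ^ (N - 2)) + - (real (N - 2) / x ^ (N - 1)) * mass0 x) (at x)"
        by simp
      have e: "x ^ (N - 1) * R 0 x * (1 / x ^ (N - 2)) + - (real (N - 2) / x ^ (N - 1)) * mass0 x = x * R 0 x - real (N - 2) * x * \<mu> 0 x"
      proof -
        obtain n where n: "N = Suc (Suc n)" using dim by (intro that[of "N - 2"]) simp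
        show ?thesis using x by (simp add: n field_simps)
      qed
      have "(E has_real_derivative v 0 x * vx 0 x + k / real (N - 2) * (x * R 0 x - real (N - 2) * x * \<mu> 0 x)) (at x)"
        unfolding E_def e[symmetric] by (intro DERIV_add 1 DERIV_cmult 3)
      moreover have "v 0 x * vx 0 x + k / real (N - 2) * (x * R 0 x - real (N - 2) * x * \<mu> 0 x) = x * q x"
        using x dim by (simp add: q_def field_simps)
      moreover have "x * q x \<ge> 0" using q[OF x(2)] x by simp
      ultimately show "\<exists>D. (E has_real_derivative D) (at x) \<and> 0 \<le> D" by auto
    qed
    have "E rc > 0" unfolding E_def using k_pos dim \<mu>b[OF order_refl] rc
      by (intro add_nonneg_pos mult_pos_pos divide_pos_pos) auto
    moreover have "E rc \<le> 0"
    proof (rule tendsto_lowerbound[OF lim])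
      show "eventually (\<lambda>a. E rc \<le> E a) at_top"
        using eventually_ge_at_top[of rc] by (rule eventually_mono) (rule mono)
    qed simp
    ultimately show False by simp
  qed
qed

end

section \<open>Control of the velocity gradient up to the lifespan\<close>

locale finite_decaying = decaying_data + finite_time_domain
begin

lemma finite_shell: "a \<ge> 0 \<Longrightarrow> finite_shell I (\<lambda>t. \<eta> t a) (\<lambda>t. \<zeta> t a) (\<lambda>t. \<Gamma> t a) (\<lambda>t. P t a) k (\<mu> 0 a) (R 0 a) N T"
  using shell finite_time_domain_axioms by (simp add: finite_shell_def)

lemma vx_eq: "vx t (flow t a) = P t a / \<Gamma> t a"
  using W_pos[of t a a] by (simp add: P_def)

lemma \<zeta>0_cont: "continuous_on {0..} (\<zeta> 0)"
  unfolding \<zeta>_def by (intro continuous_intros slope_compose_cont flow_compose_cont W_compose_cont) (auto simp: zero_mem)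

text \<open>\<open>uniform_lower_bound\<close> is used twice, in this order. For
  \<open>\<eta>\<close> the time derivative is bounded by the energy alone. For
  \<open>\<Gamma>\<close> it is \<open>P\<close>, whose bound requires the lower bound on
  \<open>\<eta>\<close> already obtained, hence the restriction to the smaller label set
  \<open>V\<close>. The gradient is then \<open>P / \<Gamma>\<close> with bounded numerator.\<close>

lemma local_bound:
  assumes a: "a \<ge> 0" and e: "\<not> ((\<lambda>t. \<eta> t a) \<longlongrightarrow> 0) (at_left T)" and g: "\<not> ((\<lambda>t. \<Gamma> t a) \<longlongrightarrow> 0) (at_left T)"
  shows "\<exists>\<delta>>0. \<exists>B. \<forall>b\<ge>0. \<bar>b - a\<bar> < \<delta> \<longrightarrow> (\<forall>t\<in>I. \<bar>vx t (flow t b)\<bar> \<le> B)"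
proof -
  define U where "U = {0..a + 1}"
  have U: "b \<ge> 0" if "b \<in> U" for b using that by (simp add: U_def)
  have aU: "a \<in> U" using a by (simp add: U_def)
  have bound: "\<exists>K>0. \<forall>b\<in>U. \<bar>f b\<bar> \<le> K" if "continuous_on {0..} f" for f :: "real \<Rightarrow> real"
    unfolding U_def by (rule continuous_on_compact_abs_bound[OF compact_Icc continuous_on_subset[OF that]]) auto
  obtain z where z: "z > 0" "\<And>b. b \<in> U \<Longrightarrow> \<bar>\<zeta> 0 b\<bar> \<le> z" using bound[OF \<zeta>0_cont] by blast
  obtain m where m: "m > 0" "\<And>b. b \<in> U \<Longrightarrow> \<bar>\<mu> 0 b\<bar> \<le> m"
    using bound[OF continuous_on_subset[OF \<mu>_cont[OF zero_mem]]] by blast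
  have "continuous_on {0..} (R 0)" using R_compose_cont[of "{0..}" "\<lambda>_. 0" "\<lambda>x. x"] zero_mem by (simp add: continuous_on_id)
  from bound[OF this] obtain r where r: "r > 0" "\<And>b. b \<in> U \<Longrightarrow> \<bar>R 0 b\<bar> \<le> r" by blast
  have "continuous_on {0..} (vx 0)" using vx_compose_cont[of "{0..}" "\<lambda>_. 0" "\<lambda>x. x"] zero_mem by (simp add: continuous_on_id)
  from bound[OF this] obtain p where p: "p > 0" "\<And>b. b \<in> U \<Longrightarrow> \<bar>vx 0 b\<bar> \<le> p" by blast
  define Z where "Z = sqrt (2 * (z\<^sup>2 / 2 + k * m / real (N - 2)))"
  have Z: "\<bar>\<zeta> t b\<bar> \<le> Z" if t: "t \<in> I" and b: "b \<in> U" for t b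
  proof -
    interpret s: shell I "\<lambda>t. \<eta> t b" "\<lambda>t. \<zeta> t b" "\<lambda>t. \<Gamma> t b" "\<lambda>t. P t b" k "\<mu> 0 b" "R 0 b" N
      by (rule shell[OF U[OF b]])
    have "(\<zeta> 0 b)\<^sup>2 \<le> z\<^sup>2" using z(2)[OF b] by (simp add: abs_le_square_iff[symmetric])
    moreover have "k * \<mu> 0 b / real (N - 2) \<le> k * m / real (N - 2)"
      using m(2)[OF b] k_pos by (intro divide_right_mono mult_left_mono) auto
    ultimately have "s.energy \<le> z\<^sup>2 / 2 + k * m / real (N - 2)" unfolding s.energy_def
      by (intro add_mono) (simp_all only: divide_right_mono zero_le_numeral)
    then have "sqrt (2 * s.energy) \<le> Z" unfolding Z_def by simp
    then show ?thesis using s.zeta_bound[OF t] by linarith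
  qed
  have Wb: "\<exists>c>0. \<forall>t\<in>{0..t0}. \<forall>b\<in>U. \<forall>b'\<in>U. c \<le> W t b b'" if "t0 \<in> I" for t0
  proof -
    from W_bounds[OF that, of "a + 1"] a obtain C where "C > 0"
      "\<forall>t\<in>{0..t0}. \<forall>b\<in>U. \<forall>b'\<in>U. 1 / C \<le> W t b b' \<and> W t b b' \<le> C" unfolding U_def by auto
    then show ?thesis by (intro exI[of _ "1 / C"]) simp
  qed
  have zU: "0 \<in> U" using a by (simp add: U_def)
  have Wc: "continuous_on V (\<lambda>b. W t b 0)" "continuous_on V (\<lambda>b. W t b b)" if "t \<in> I" "V \<subseteq> U" for t V
    using that U by (intro W_compose_cont continuous_intros; auto)+
  obtain \<delta>1 c1 where 1: "\<delta>1 > 0" "c1 > 0" "\<And>b t. b \<in> U \<Longrightarrow> \<bar>b - a\<bar> < \<delta>1 \<Longrightarrow> t \<in> I \<Longrightarrow> c1 \<le> \<eta> t b"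
  proof -
    have "\<exists>\<delta>>0. \<exists>c>0. \<forall>b\<in>U. \<bar>b - a\<bar> < \<delta> \<longrightarrow> (\<forall>t\<in>I. c \<le> \<eta> t b)"
    proof (rule uniform_lower_bound[where f = \<eta> and f' = \<zeta> and U = U and Z = Z and a = a])
      fix t b assume "t \<in> I" "b \<in> U"
      then show "((\<lambda>t. \<eta> t b) has_real_derivative \<zeta> t b) (at t within I)" by (intro \<eta>_deriv U)
    next
      fix t0 assume "t0 \<in> I"
      from Wb[OF this] zU show "\<exists>c>0. \<forall>t\<in>{0..t0}. \<forall>b\<in>U. c \<le> \<eta> t b" by blast
    qed (use Z aU W_pos e Wc in auto)
    then show thesis using that by blast
  qed
  define V where "V = {b\<in>U. \<bar>b - a\<bar> < \<delta>1}"
  have V: "V \<subseteq> U" "a \<in> V" using aU 1(1) by (auto simp: V_def)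
  define P1 where "P1 = p + k * r / c1 ^ (N - 1) * T"
  define D where "D = k * real (N - 1) * m / c1 ^ N * (1 + P1 * T) * T"
  have Pb: "\<bar>P t b\<bar> \<le> P1 + p + \<bar>D\<bar>" if t: "t \<in> I" and b: "b \<in> V" for t b
  proof -
    have bU: "b \<in> U" using b V by auto
    interpret s: shell I "\<lambda>t. \<eta> t b" "\<lambda>t. \<zeta> t b" "\<lambda>t. \<Gamma> t b" "\<lambda>t. P t b" k "\<mu> 0 b" "R 0 b" N
      by (rule shell[OF U[OF bU]])
    have c: "c1 \<le> \<eta> t b" if "t \<in> I" for t using 1(3)[OF bU _ that] b by (simp add: V_def)
    have P0: "\<bar>P 0 b\<bar> \<le> p" using p(2)[OF bU] U[OF bU] by (simp add: initial_values)
    have mr: "\<mu> 0 b \<le> m" "R 0 b \<le> r" using m(2)[OF bU] r(2)[OF bU] by linarith+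
    have "P t b \<le> P1" "P 0 b - D \<le> P t b"
      using s.P_bounds(1,2)[OF I_eq 1(2) c mr P0 t] unfolding P1_def D_def by simp_all
    moreover have "P1 \<ge> 0" unfolding P1_def using p r k_pos 1(2) T_pos by simp
    ultimately show ?thesis using P0 by linarith
  qed
  have "\<exists>\<delta>>0. \<exists>c>0. \<forall>b\<in>V. \<bar>b - a\<bar> < \<delta> \<longrightarrow> (\<forall>t\<in>I. c \<le> \<Gamma> t b)"
  proof (rule uniform_lower_bound[where f = \<Gamma> and f' = P and U = V and Z = "P1 + p + \<bar>D\<bar>" and a = a])
    fix t b assume "t \<in> I" "b \<in> V"
    then show "((\<lambda>t. \<Gamma> t b) has_real_derivative P t b) (at t within I)" using V by (intro \<Gamma>_deriv U) auto
  next
    fix t0 assume "t0 \<in> I"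
    from Wb[OF this] V(1) show "\<exists>c>0. \<forall>t\<in>{0..t0}. \<forall>b\<in>V. c \<le> \<Gamma> t b" by blast
  qed (use Pb V W_pos g Wc in auto)
  then obtain \<delta>2 c2 where 2: "\<delta>2 > 0" "c2 > 0" "\<And>b t. b \<in> V \<Longrightarrow> \<bar>b - a\<bar> < \<delta>2 \<Longrightarrow> t \<in> I \<Longrightarrow> c2 \<le> \<Gamma> t b" by blast
  have "\<bar>vx t (flow t b)\<bar> \<le> (P1 + p + \<bar>D\<bar>) / c2" if b: "b \<ge> 0" "\<bar>b - a\<bar> < min (min \<delta>1 \<delta>2) 1" and t: "t \<in> I" for b t
  proof -
    have bV: "b \<in> V" using b by (auto simp: V_def U_def)
    have "\<bar>P t b\<bar> / \<Gamma> t b \<le> (P1 + p + \<bar>D\<bar>) / c2"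
      using Pb[OF t bV] 2(2) 2(3)[OF bV _ t] b by (intro frac_le) auto
    then show ?thesis using W_pos[of t b b] by (simp add: vx_eq)
  qed
  moreover have "min (min \<delta>1 \<delta>2) 1 > 0" using 1(1) 2(1) by simp
  ultimately show ?thesis by blast
qed

text \<open>Far out the data are so small that over the finite lifespan neither
  \<open>\<eta>\<close> nor \<open>\<Gamma>\<close> can fall from 1 below \<open>1 / 2\<close>. The
  bound on \<open>\<eta>\<close> is kept in the statement in order to show later that the shells
  cover all radii.\<close>

lemma bound_at_infinity:
  "\<exists>A\<ge>0. \<exists>B. \<forall>b\<ge>A. \<forall>t\<in>I. \<bar>vx t (flow t b)\<bar> \<le> B \<and> 1 / 2 \<le> \<eta> t b"
proof -
  have "eventually (\<lambda>b. R 0 b < 1) at_top" using R0_lim by (rule order_tendstoD) simp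
  \<comment> \<open>With \<open>\<zeta> \<ge> - p\<close> the loss of \<open>\<eta>\<close> is at
    most \<open>p * T = 1 / 4\<close>; with \<open>P \<ge> - 2 * p\<close> the loss of
    \<open>\<Gamma>\<close> is at most \<open>1 / 2\<close>.\<close>
  define p where "p = 1 / (4 * T)"
  have p: "p > 0" using T_pos by (simp add: p_def)
  define P1 where "P1 = p + k * 1 / (1 / 2) ^ (N - 1) * T"
  have P1: "P1 > 0" unfolding P1_def using p k_pos T_pos by (intro add_pos_pos mult_pos_pos divide_pos_pos) auto
  define D where "D m = k * real (N - 1) * m / (1 / 2) ^ N * (1 + P1 * T) * T" for m
  \<comment> \<open>\<open>D\<close> is linear in \<open>m\<close>, so this choice gives
    \<open>D m = p\<close>: the mass term takes at most another \<open>p\<close> from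
    \<open>P\<close>.\<close>
  define m where "m = p / D 1"
  have D1: "D 1 > 0" unfolding D_def using k_pos dim P1 T_pos
    by (intro mult_pos_pos divide_pos_pos add_pos_pos) auto
  have m: "m > 0" using D1 p by (simp add: m_def)
  have Dm: "D m = p"
  proof -
    have "D m = m * D 1" by (simp add: D_def)
    then show ?thesis using D1 by (simp add: m_def)
  qed
  have "eventually (\<lambda>b. R 0 b < 1 \<and> dist (\<mu> 0 b) 0 < m \<and> dist (vx 0 b) 0 < p \<and> dist (v 0 b) 0 < p \<and> 1 \<le> b) at_top"
    using p m by (intro eventually_conj eventually_ge_at_top order_tendstoD(2)[OF R0_lim] tendstoD[OF \<mu>0_lim] tendstoD[OF vx0_lim] tendstoD[OF v0_lim]) auto
  then obtain A where A: "\<And>b. b \<ge> A \<Longrightarrow> R 0 b < 1 \<and> dist (\<mu> 0 b) 0 < m \<and> dist (vx 0 b) 0 < p \<and> dist (v 0 b) 0 < p \<and> 1 \<le> b"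
    by (auto simp: eventually_at_top_linorder)
  have "\<bar>vx t (flow t b)\<bar> \<le> 2 * (P1 + 2 * p) \<and> 1 / 2 \<le> \<eta> t b" if b: "b \<ge> A" and t: "t \<in> I" for b t
  proof -
    have b1: "b \<ge> 1" using A[OF b] by simp
    interpret s: shell I "\<lambda>t. \<eta> t b" "\<lambda>t. \<zeta> t b" "\<lambda>t. \<Gamma> t b" "\<lambda>t. P t b" k "\<mu> 0 b" "R 0 b" N
      using b1 by (intro shell) simp
    have z0: "- p \<le> \<zeta> 0 b"
    proof -
      have "\<bar>v 0 b / b\<bar> \<le> \<bar>v 0 b\<bar>" using b1 by (simp add: divide_le_eq mult_left_le_one_le mult_le_cancel_left1)
      moreover have "\<bar>v 0 b\<bar> < p" using A[OF b] by simp
      ultimately have "\<bar>v 0 b / b\<bar> < p" by linarith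
      moreover have "\<zeta> 0 b = v 0 b / b" using b1 by (intro initial_values) simp
      ultimately show ?thesis by linarith
    qed
    have z: "- p \<le> \<zeta> t b" if t: "t \<in> I" for t
    proof -
      have "0 * (t - 0) \<le> \<zeta> t b - \<zeta> 0 b"
      proof (rule increment_ge[OF s.\<zeta>_deriv t order_refl nonneg[OF t]], assumption)
        fix r assume "0 < r" "r < t"
        then have "r \<in> I" using t by (simp add: I_eq)
        from s.\<eta>_pos[OF this] show "0 \<le> k * \<mu> 0 b / \<eta> r b ^ (N - 1)" using k_pos s.\<mu>_nonneg by simp
      qed
      then show ?thesis using z0 by simp
    qed
    have pT: "p * T = 1 / 4" using T_pos by (simp add: p_def)
    have eta: "1 / 2 \<le> \<eta> t b" if t: "t \<in> I" for t
    proof -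
      have "- p * (t - 0) \<le> \<eta> t b - \<eta> 0 b"
      proof (rule increment_ge[OF s.\<eta>_deriv t order_refl nonneg[OF t]], assumption)
        fix r assume "0 < r" "r < t"
        then show "- p \<le> \<zeta> r b" using t by (intro z) (simp add: I_eq)
      qed
      moreover have "p * t \<le> p * T" using t p by (intro mult_left_mono) (auto simp: I_eq)
      ultimately show ?thesis using pT by (simp add: s.\<eta>_0)
    qed
    have P0: "\<bar>P 0 b\<bar> \<le> p" using A[OF b] b1 by (simp add: initial_values)
    have mb: "\<mu> 0 b \<le> m" "R 0 b \<le> 1" using A[OF b] by auto
    have Pb: "P t b \<le> P1" "P 0 b - D m \<le> P t b" if t: "t \<in> I" for t
      using s.P_bounds(1,2)[OF I_eq _ eta mb P0 t] unfolding P1_def D_def by simp_all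
    have Pl: "- (2 * p) \<le> P t b" if t: "t \<in> I" for t using Pb(2)[OF t] P0 Dm by linarith
    have gam: "1 / 2 \<le> \<Gamma> t b"
    proof -
      have "- (2 * p) * (t - 0) \<le> \<Gamma> t b - \<Gamma> 0 b"
      proof (rule increment_ge[OF s.\<Gamma>_deriv t order_refl nonneg[OF t]], assumption)
        fix r assume "0 < r" "r < t"
        then show "- (2 * p) \<le> P r b" using t by (intro Pl) (simp add: I_eq)
      qed
      moreover have "p * t \<le> p * T" using t p by (intro mult_left_mono) (auto simp: I_eq)
      ultimately show ?thesis using pT by (simp add: s.\<Gamma>_0)
    qed
    have "\<bar>P t b\<bar> / \<Gamma> t b \<le> (P1 + 2 * p) / (1 / 2)"
      using Pb(1)[OF t] Pl[OF t] P1 p gam by (intro frac_le) auto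
    then have "\<bar>vx t (flow t b)\<bar> \<le> 2 * (P1 + 2 * p)" using W_pos[of t b b] by (simp add: vx_eq)
    then show ?thesis using eta[OF t] by simp
  qed
  then show ?thesis by (intro exI[of _ "max A 0"]) auto
qed

text \<open>Finitely many neighbourhoods from \<open>local_bound\<close> cover the labels up to
  \<open>A\<close>, and \<open>bound_at_infinity\<close> covers the others. This bounds the gradient
  along all shells; it is a bound in space because every radius is occupied by some shell.\<close>

lemma gradient_bounded:
  assumes "\<And>a. a \<ge> 0 \<Longrightarrow> \<not> ((\<lambda>t. \<eta> t a) \<longlongrightarrow> 0) (at_left T) \<and> \<not> ((\<lambda>t. \<Gamma> t a) \<longlongrightarrow> 0) (at_left T)"
  shows "\<exists>B. \<forall>t\<in>I. \<forall>x\<ge>0. \<bar>vx t x\<bar> \<le> B"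
proof -
  obtain A B where A: "A \<ge> 0" and B: "\<And>b t. b \<ge> A \<Longrightarrow> t \<in> I \<Longrightarrow> \<bar>vx t (flow t b)\<bar> \<le> B \<and> 1 / 2 \<le> \<eta> t b"
    using bound_at_infinity by blast
  define good where "good a \<delta> K \<longleftrightarrow> (\<forall>b\<ge>0. \<bar>b - a\<bar> < \<delta> \<longrightarrow> (\<forall>t\<in>I. \<bar>vx t (flow t b)\<bar> \<le> K))" for a \<delta> K
  have "\<exists>p. fst p > 0 \<and> good a (fst p) (snd p)" if a: "a \<in> {0..A}" for a
  proof -
    have "a \<ge> 0" using a by simp
    with assms[OF this] local_bound[of a] obtain \<delta> K where "\<delta> > 0" "good a \<delta> K"
      unfolding good_def by blast
    then show ?thesis by (intro exI[of _ "(\<delta>, K)"]) simp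
  qed
  then have "\<exists>q. \<forall>a\<in>{0..A}. fst (q a) > 0 \<and> good a (fst (q a)) (snd (q a))"
    by (intro bchoice) blast
  then obtain q where q: "\<forall>a\<in>{0..A}. fst (q a) > 0 \<and> good a (fst (q a)) (snd (q a))" ..
  define \<delta> where "\<delta> a = fst (q a)" for a
  define B' where "B' a = snd (q a)" for a
  have \<delta>: "\<delta> a > 0" if "a \<in> {0..A}" for a using q that by (simp add: \<delta>_def)
  have B': "\<bar>vx t (flow t b)\<bar> \<le> B' a" if "a \<in> {0..A}" "b \<ge> 0" "\<bar>b - a\<bar> < \<delta> a" "t \<in> I" for a b t
    using bspec[OF q that(1)] that(2-) by (simp add: \<delta>_def B'_def good_def)
  have "{0..A} \<subseteq> (\<Union>a\<in>{0..A}. ball a (\<delta> a))"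
  proof
    fix x assume "x \<in> {0..A}"
    moreover have "x \<in> ball x (\<delta> x)" using \<delta>[OF \<open>x \<in> {0..A}\<close>] by simp
    ultimately show "x \<in> (\<Union>a\<in>{0..A}. ball a (\<delta> a))" by (rule UN_I)
  qed
  from compactE_image[OF compact_Icc open_ball this]
  obtain F where F: "F \<subseteq> {0..A}" "finite F" "{0..A} \<subseteq> (\<Union>a\<in>F. ball a (\<delta> a))" .
  define M where "M = Max (insert B (B' ` F))"
  have all: "\<bar>vx t (flow t b)\<bar> \<le> M" if b: "b \<ge> 0" and t: "t \<in> I" for b t
  proof (cases "b \<ge> A")
    case True
    have "B \<le> M" unfolding M_def using F by (intro Max_ge) auto
    then show ?thesis using B[OF True t] by linarith
  next
    case False
    then obtain a where a: "a \<in> F" "b \<in> ball a (\<delta> a)" using subsetD[OF F(3), of b] b by auto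
    have "B' a \<le> M" unfolding M_def using F a by (intro Max_ge) auto
    moreover have "\<bar>vx t (flow t b)\<bar> \<le> B' a"
      using a subsetD[OF F(1) a(1)] by (intro B'[OF _ b _ t]) (simp_all add: dist_real_def abs_minus_commute)
    ultimately show ?thesis by linarith
  qed
  have "\<bar>vx t x\<bar> \<le> M" if t: "t \<in> I" and x: "x \<ge> 0" for t x
  proof -
    \<comment> \<open>The shell of label \<open>A'\<close> is at least at
      \<open>A' / 2 \<ge> x\<close>, so the intermediate value theorem between the centre and this
      shell finds one passing through \<open>x\<close>.\<close>
    define A' where "A' = max A (2 * x)"
    have A': "A' \<ge> 0" "A' \<ge> A" "A' \<ge> 2 * x" using A by (auto simp: A'_def)
    have "1 / 2 \<le> \<eta> t A'" using B[OF A'(2) t] by simp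
    then have "A' * (1 / 2) \<le> A' * \<eta> t A'" by (intro mult_left_mono A')
    then have "x \<le> flow t A'" using A'(3) flow_eq_mult_W[OF t A'(1)] by linarith
    moreover have "flow t 0 \<le> x" using flow_origin[OF t] x by simp
    moreover have "continuous_on {0..A'} (flow t)"
      using t by (intro flow_compose_cont continuous_intros) auto
    ultimately obtain b where "b \<ge> 0" "flow t b = x" using IVT'[of "flow t" 0 x A'] A'(1) by blast
    then show ?thesis using all[OF _ t] by blast
  qed
  then show ?thesis by blast
qed

text \<open>If some \<open>\<eta>\<close> collapses, the path followed is not that shell but the
  centre, where everything is explicit: the gradient is \<open>- 1 / (T - t)\<close> and the density
  stays 0. Otherwise the unbounded gradient provides a shell with
  \<open>\<Gamma> \<rightarrow> 0\<close> whose \<open>\<eta>\<close> has a positive limit.\<close>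

lemma breakdown:
  assumes unbounded: "\<not> (\<exists>B. \<forall>t\<in>I. \<forall>x\<ge>0. \<bar>vx t x\<bar> \<le> B)"
  shows "\<exists>a\<ge>0. \<exists>r. ((\<lambda>t. flow t a) \<longlongrightarrow> r) (at_left T) \<and> (r > 0 \<or> r = 0 \<and> (\<forall>\<xi>\<in>{0..a}. R 0 \<xi> = 0)) \<and>
    filterlim (\<lambda>t. \<bar>vx t (flow t a)\<bar>) at_top (at_left T) \<and>
    (filterlim (\<lambda>t. R t (flow t a)) at_top (at_left T) \<or> ((\<lambda>t. R t (flow t a)) \<longlongrightarrow> 0) (at_left T))"
proof -
  have ev: "eventually (\<lambda>t. t \<in> I) (at_left T)" using eventually_in_I[OF T_pos] by (rule eventually_mono) simp
  have "\<exists>a\<ge>0. ((\<lambda>t. \<eta> t a) \<longlongrightarrow> 0) (at_left T) \<or> ((\<lambda>t. \<Gamma> t a) \<longlongrightarrow> 0) (at_left T)"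
  proof (rule ccontr)
    assume no: "\<not> ?thesis"
    have "\<exists>B. \<forall>t\<in>I. \<forall>x\<ge>0. \<bar>vx t x\<bar> \<le> B"
    proof (rule gradient_bounded)
      fix a :: real assume "a \<ge> 0"
      with no show "\<not> ((\<lambda>t. \<eta> t a) \<longlongrightarrow> 0) (at_left T) \<and> \<not> ((\<lambda>t. \<Gamma> t a) \<longlongrightarrow> 0) (at_left T)" by blast
    qed
    with unbounded show False by contradiction
  qed
  then obtain a where a: "a \<ge> 0" "((\<lambda>t. \<eta> t a) \<longlongrightarrow> 0) (at_left T) \<or> ((\<lambda>t. \<Gamma> t a) \<longlongrightarrow> 0) (at_left T)"
    by blast
  show ?thesis
  proof (cases "\<exists>a\<ge>0. ((\<lambda>t. \<eta> t a) \<longlongrightarrow> 0) (at_left T)")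
    case True
    then obtain a where a: "a \<ge> 0" and lim: "((\<lambda>t. \<eta> t a) \<longlongrightarrow> 0) (at_left T)" by blast
    \<comment> \<open>Paths do not cross, so \<open>b * \<eta> t b \<le> a * \<eta> t a\<close>: a
      collapsing shell takes all inner ones with it.\<close>
    have col: "((\<lambda>t. \<eta> t b) \<longlongrightarrow> 0) (at_left T)" if b: "0 < b" "b \<le> a" for b
    proof (rule tendsto_sandwich[OF _ _ tendsto_const])
      show "eventually (\<lambda>t. 0 \<le> \<eta> t b) (at_left T)" using W_pos by (intro always_eventually allI less_imp_le)
      show "eventually (\<lambda>t. \<eta> t b \<le> a / b * \<eta> t a) (at_left T)"
        using ev
      proof eventually_elim
        case (elim t)
        have "b * \<eta> t b \<le> a * \<eta> t a"
          using flow_mono[OF elim less_imp_le[OF b(1)] b(2)] flow_eq_mult_W[OF elim a] flow_eq_mult_W[OF elim less_imp_le[OF b(1)]] by simp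
        then show ?case using b by (simp add: field_simps)
      qed
      have "((\<lambda>t. a / b * \<eta> t a) \<longlongrightarrow> a / b * 0) (at_left T)" by (intro tendsto_intros lim)
      then show "((\<lambda>t. a / b * \<eta> t a) \<longlongrightarrow> 0) (at_left T)" by simp
    qed
    have vac: "\<mu> 0 b = 0 \<and> \<zeta> 0 b = - 1 / T" if "((\<lambda>t. \<eta> t b) \<longlongrightarrow> 0) (at_left T)" "b \<ge> 0" for b
    proof -
      interpret s: finite_shell I "\<lambda>t. \<eta> t b" "\<lambda>t. \<zeta> t b" "\<lambda>t. \<Gamma> t b" "\<lambda>t. P t b" k "\<mu> 0 b" "R 0 b" N T
        by (rule finite_shell[OF that(2)])
      show ?thesis using s.collapse(1,2)[OF that(1)] by simp
    qed
    \<comment> \<open>All inner shells collapse at the same \<open>T\<close>, hence share the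
      initial value \<open>- 1 / T\<close> of \<open>\<zeta>\<close> and enclose no mass; continuity
      in the label transfers both facts to the centre.\<close>
    have origin: "\<mu> 0 0 = 0 \<and> \<zeta> 0 0 = - 1 / T"
    proof (cases "a = 0")
      case True
      then show ?thesis using vac[of 0] lim by simp
    next
      case False
      then have "a > 0" using a by simp
      have evb: "eventually (\<lambda>b. \<mu> 0 b = 0) (at_right 0)" "eventually (\<lambda>b. \<zeta> 0 b = - 1 / T) (at_right 0)"
      proof -
        have "\<mu> 0 b = 0 \<and> \<zeta> 0 b = - 1 / T" if "b \<in> {0<..<a}" for b
          using that by (intro vac col) simp_all
        then show "eventually (\<lambda>b. \<mu> 0 b = 0) (at_right 0)" "eventually (\<lambda>b. \<zeta> 0 b = - 1 / T) (at_right 0)"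
          by (intro eventually_at_rightI[OF _ \<open>a > 0\<close>]; blast)+
      qed
      have "(\<mu> 0 \<longlongrightarrow> \<mu> 0 0) (at 0 within {0..})"
        using continuous_on_subset[OF \<mu>_cont[OF zero_mem], of "{0..}"] by (simp add: continuous_on_def)
      then have m: "(\<mu> 0 \<longlongrightarrow> \<mu> 0 0) (at_right 0)" by (rule tendsto_within_subset) auto
      have "(\<zeta> 0 \<longlongrightarrow> \<zeta> 0 0) (at 0 within {0..})" using \<zeta>0_cont by (simp add: continuous_on_def)
      then have z: "(\<zeta> 0 \<longlongrightarrow> \<zeta> 0 0) (at_right 0)" by (rule tendsto_within_subset) auto
      have "\<mu> 0 0 = 0" by (rule tendsto_unique[OF _ m tendsto_eventually[OF evb(1)]]) simp
      moreover have "\<zeta> 0 0 = - 1 / T" by (rule tendsto_unique[OF _ z tendsto_eventually[OF evb(2)]]) simp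
      ultimately show ?thesis by simp
    qed
    interpret s: finite_shell I "\<lambda>t. \<eta> t 0" "\<lambda>t. \<zeta> t 0" "\<lambda>t. \<Gamma> t 0" "\<lambda>t. P t 0" k "\<mu> 0 0" "R 0 0" N T
      by (rule finite_shell) simp
    have R00: "R 0 0 = 0" using origin \<mu>_0[of 0] dim by simp
    have z: "\<zeta> t 0 = - 1 / T" if "t \<in> I" for t
    proof -
      have "\<zeta> t 0 = \<zeta> 0 0" by (rule constant_of_zero_derivative[OF _ that]) (use s.\<zeta>_deriv origin in simp)
      then show ?thesis using origin by simp
    qed
    have e: "\<eta> t 0 = 1 - t / T" if t: "t \<in> I" for t
    proof -
      have "((\<lambda>t. \<eta> t 0 + t / T) has_real_derivative 0) (at t within I)" if t: "t \<in> I" for t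
        by (rule DERIV_cong[OF DERIV_add[OF s.\<eta>_deriv[OF t] DERIV_cdivide[OF DERIV_ident]]]) (simp add: z[OF t])
      from constant_of_zero_derivative[OF this t] have "\<eta> t 0 + t / T = 1" using s.\<eta>_0 by simp
      then show ?thesis by linarith
    qed
    have vx0: "1 / (T - t) = \<bar>vx t (flow t 0)\<bar>" if t: "t \<in> I" for t
    proof -
      have "t < T" using t by (simp add: I_eq)
      then have "- 1 / T / (1 - t / T) = - (1 / (T - t))" using T_pos by (simp add: field_simps)
      then have "vx t (flow t 0) = - (1 / (T - t))"
        unfolding vx_eq P_origin[OF t] z[OF t] e[OF t] .
      then show ?thesis using \<open>t < T\<close> by simp
    qed
    have "eventually (\<lambda>t. 1 / (T - t) = \<bar>vx t (flow t 0)\<bar>) (at_left T)"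
      using ev by (rule eventually_mono) (rule vx0)
    from filterlim_cong[OF refl refl this] s.inverse_remaining_time
    have "filterlim (\<lambda>t. \<bar>vx t (flow t 0)\<bar>) at_top (at_left T)" by blast
    moreover have "((\<lambda>t. flow t 0) \<longlongrightarrow> 0) (at_left T)"
      using eventually_mono[OF ev flow_origin] by (rule tendsto_eventually)
    moreover have "((\<lambda>t. R t (flow t 0)) \<longlongrightarrow> 0) (at_left T)"
    proof (rule tendsto_eventually)
      show "eventually (\<lambda>t. R t (flow t 0) = 0) (at_left T)"
        using ev
      proof eventually_elim
        case (elim t)
        then show ?case using density_along_flow[OF elim order_refl] R00 W_pos[of t 0 0] by simp
      qed
    qed
    moreover have "\<forall>\<xi>\<in>{0..0}. R 0 \<xi> = 0" using R00 by simp
    ultimately show ?thesis by blast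
  next
    case no: False
    have e0: "\<not> ((\<lambda>t. \<eta> t a) \<longlongrightarrow> 0) (at_left T)"
    proof
      assume "((\<lambda>t. \<eta> t a) \<longlongrightarrow> 0) (at_left T)"
      with a(1) have "\<exists>a\<ge>0. ((\<lambda>t. \<eta> t a) \<longlongrightarrow> 0) (at_left T)" by (intro exI[of _ a] conjI)
      with no show False by (rule notE)
    qed
    from a(2) have G0: "((\<lambda>t. \<Gamma> t a) \<longlongrightarrow> 0) (at_left T)"
      by (rule disjE) (erule notE[OF e0], assumption)
    \<comment> \<open>At the centre \<open>\<Gamma>\<close> and \<open>\<eta>\<close> are both
      \<open>W t 0 0\<close>, so one cannot collapse without the other.\<close>
    have "a \<noteq> 0"
    proof
      assume "a = 0"
      with G0 e0 show False by simp
    qed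
    then have apos: "a > 0" using a(1) by simp
    interpret s: finite_shell I "\<lambda>t. \<eta> t a" "\<lambda>t. \<zeta> t a" "\<lambda>t. \<Gamma> t a" "\<lambda>t. P t a" k "\<mu> 0 a" "R 0 a" N T
      by (rule finite_shell[OF a(1)])
    obtain e where e: "e \<ge> 0" "((\<lambda>t. \<eta> t a) \<longlongrightarrow> e) (at_left T)" using s.eta_limit by blast
    have "e \<noteq> 0"
    proof
      assume "e = 0"
      with e(2) e0 show False by simp
    qed
    then have epos: "e > 0" using e(1) by simp
    have "(\<lambda>t. \<bar>vx t (flow t a)\<bar>) = (\<lambda>t. \<bar>P t a\<bar> / \<Gamma> t a)"
      unfolding vx_eq abs_divide using W_pos by (simp add: fun_eq_iff abs_of_pos)
    then have "filterlim (\<lambda>t. \<bar>vx t (flow t a)\<bar>) at_top (at_left T)"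
      using s.gradient_blowup[OF e(2) epos G0] by (simp only:)
    moreover have "((\<lambda>t. flow t a) \<longlongrightarrow> a * e) (at_left T)"
    proof -
      have "((\<lambda>t. a * \<eta> t a) \<longlongrightarrow> a * e) (at_left T)" by (intro tendsto_intros e)
      moreover have "eventually (\<lambda>t. a * \<eta> t a = flow t a) (at_left T)"
        using ev by eventually_elim (simp add: flow_eq_mult_W a(1))
      ultimately show ?thesis by (rule Lim_transform_eventually)
    qed
    moreover have "filterlim (\<lambda>t. R t (flow t a)) at_top (at_left T) \<or> ((\<lambda>t. R t (flow t a)) \<longlongrightarrow> 0) (at_left T)"
    proof -
      have Req: "eventually (\<lambda>t. R 0 a / (\<eta> t a ^ (N - 1) * \<Gamma> t a) = R t (flow t a)) (at_left T)"
        using ev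
      proof eventually_elim
        case (elim t)
        have "\<eta> t a ^ (N - 1) * \<Gamma> t a \<noteq> 0" using W_nonzero by simp
        then show ?case unfolding density_along_flow[OF elim a(1), symmetric] by (rule nonzero_mult_div_cancel_right)
      qed
      show ?thesis
      proof (cases "R 0 a = 0")
        case True
        have "eventually (\<lambda>t. R t (flow t a) = 0) (at_left T)"
          using Req by (rule eventually_mono) (simp add: True)
        then show ?thesis by (intro disjI2 tendsto_eventually)
      next
        case False
        then have "R 0 a > 0" using R0_nonneg[OF a(1)] by simp
        have "((\<lambda>t. \<eta> t a ^ (N - 1) * \<Gamma> t a) \<longlongrightarrow> e ^ (N - 1) * 0) (at_left T)" by (intro tendsto_intros e G0)
        then have "((\<lambda>t. \<eta> t a ^ (N - 1) * \<Gamma> t a) \<longlongrightarrow> 0) (at_left T)" by simp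
        then have "filterlim (\<lambda>t. R 0 a / (\<eta> t a ^ (N - 1) * \<Gamma> t a)) at_top (at_left T)"
        proof (rule LIM_at_top_divide[OF tendsto_const \<open>R 0 a > 0\<close>])
          show "eventually (\<lambda>t. 0 < \<eta> t a ^ (N - 1) * \<Gamma> t a) (at_left T)"
            by (intro always_eventually allI mult_pos_pos zero_less_power W_pos)
        qed
        then have "filterlim (\<lambda>t. R t (flow t a)) at_top (at_left T)"
          unfolding filterlim_cong[OF refl refl Req] .
        then show ?thesis by (rule disjI1)
      qed
    qed
    moreover have "a * e > 0" using apos epos by simp
    ultimately show ?thesis
      using a(1) by - (rule exI[of _ a], rule conjI[OF a(1)], rule exI[of _ "a * e"], intro conjI disjI1[of "a * e > 0"])
  qed
qed

end

section \<open>From fields on space to radial profiles\<close>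

text \<open>Adding the enclosed mass to \<open>\<xi> ^ n * \<phi>' \<xi>\<close> gives a function
  with zero derivative on the positive axis, and the boundary condition at the origin fixes the
  constant to be 0.\<close>

lemma potential_gradient:
  fixes R \<phi>' :: "real \<Rightarrow> real"
  assumes R: "continuous_on UNIV R"
    and der: "\<And>r. r > 0 \<Longrightarrow> ((\<lambda>\<xi>. \<xi> ^ n * \<phi>' \<xi>) has_real_derivative - (r ^ n * R r)) (at r)"
    and lim: "((\<lambda>r. r ^ n * \<phi>' r) \<longlongrightarrow> 0) (at_right 0)" and r: "r > 0"
  shows "\<phi>' r = - (integral {0..r} (\<lambda>\<xi>. \<xi> ^ n * R \<xi>) / r ^ n)"
proof -
  define g where "g \<xi> = \<xi> ^ n * R \<xi>" for \<xi>
  define h where "h \<xi> = \<xi> ^ n * \<phi>' \<xi> + integral {0..\<xi>} g" for \<xi>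
  have g: "continuous_on S g" for S
    unfolding g_def by (intro continuous_intros continuous_on_subset[OF R]) auto
  have "(h has_real_derivative 0) (at x within {0<..})" if x: "x \<in> {0<..}" for x
  proof -
    have "((\<lambda>\<xi>. integral {0..\<xi>} g) has_real_derivative g x) (at x within {0..x + 1})"
      using x by (intro integral_has_real_derivative g) auto
    moreover have "at x within {0..x + 1} = at x" using x by (intro at_within_interior) auto
    ultimately have "(h has_real_derivative - (x ^ n * R x) + g x) (at x)"
      unfolding h_def using x by (intro DERIV_add der) auto
    then have "(h has_real_derivative 0) (at x)" by (simp add: g_def)
    then show ?thesis by (rule has_field_derivative_at_within)
  qed
  from has_field_derivative_zero_constant[OF convex_real_interval(3) this]
  obtain c where c: "\<And>x. x \<in> {0<..} \<Longrightarrow> h x = c" by blast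
  have "continuous_on {0..1} (\<lambda>\<xi>. integral {0..\<xi>} g)"
    by (intro indefinite_integral_continuous_1 integrable_continuous_real g)
  then have "\<forall>x\<in>{0..1}. ((\<lambda>\<xi>. integral {0..\<xi>} g) \<longlongrightarrow> integral {0..x} g) (at x within {0..1})"
    by (simp only: continuous_on_def)
  from bspec[OF this, of 0]
  have "((\<lambda>\<xi>. integral {0..\<xi>} g) \<longlongrightarrow> integral {0..0} g) (at 0 within {0..1})" by simp
  moreover have "at (0::real) within {0..1} = at_right 0" by (simp add: at_within_Icc_at_right)
  ultimately have "((\<lambda>\<xi>. integral {0..\<xi>} g) \<longlongrightarrow> 0) (at_right 0)" by simp
  from tendsto_add[OF lim this] have "(h \<longlongrightarrow> 0) (at_right 0)" by (simp add: h_def[abs_def])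
  moreover have "(h \<longlongrightarrow> c) (at_right 0)"
    by (intro tendsto_eventually eventually_at_rightI[of 0 1]) (simp_all add: c)
  ultimately have "c = 0" by (intro tendsto_unique[of "at_right 0" h]) auto
  then have "r ^ n * \<phi>' r = - integral {0..r} g" using c[of r] r by (simp add: h_def)
  then have "\<phi>' r = - integral {0..r} g / r ^ n" using r by (simp add: field_simps)
  then show ?thesis by (simp add: g_def[abs_def])
qed

section \<open>The gradient of a radial field\<close>

lemma onorm_le_of_lipschitz:
  fixes f :: "'a::real_normed_vector \<Rightarrow> 'b::real_normed_vector"
  assumes f: "(f has_derivative D) (at x)" and L: "\<And>y. norm (f y - f x) \<le> L * norm (y - x)" "L \<ge> 0"
  shows "onorm D \<le> L"
proof (rule onorm_bound[OF L(2)])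
  fix h
  have D: "bounded_linear D" using f by (rule has_derivative_bounded_linear)
  show "norm (D h) \<le> L * norm h"
  proof (cases "h = 0")
    case True
    then show ?thesis by (simp add: linear_0 bounded_linear.linear[OF D])
  next
    case False
    have "norm (D h) \<le> L * norm h + e * norm h" if e: "e > 0" for e
    proof -
      obtain d where d: "d > 0" "\<And>y. norm (y - x) < d \<Longrightarrow> norm (f y - f x - D (y - x)) \<le> e * norm (y - x)"
        using f e unfolding has_derivative_at_alt by blast
      define s where "s = d / (2 * norm h)"
      have s: "s > 0" using d(1) False by (simp add: s_def)
      define y where "y = x + s *\<^sub>R h"
      have y: "y - x = s *\<^sub>R h" by (simp add: y_def)
      have ny: "norm (y - x) = s * norm h" using s by (simp add: y)
      have "norm (y - x) < d" unfolding ny s_def using False d(1) by simp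
      then have 1: "norm (f y - f x - D (y - x)) \<le> e * (s * norm h)" using d(2)[of y] by (simp only: ny)
      have 2: "norm (f y - f x) \<le> L * (s * norm h)" using L(1)[of y] by (simp only: ny)
      have "norm (D (y - x)) \<le> norm (f y - f x) + norm (f y - f x - D (y - x))"
        using norm_triangle_ineq4[of "f y - f x" "f y - f x - D (y - x)"] by simp
      also have "\<dots> \<le> L * (s * norm h) + e * (s * norm h)" using 1 2 by linarith
      also have "\<dots> = s * (L * norm h + e * norm h)" by (simp add: algebra_simps)
      also have "D (y - x) = s *\<^sub>R D h" unfolding y by (rule linear_cmul[OF bounded_linear.linear[OF D]])
      finally show ?thesis using s by simp
    qed
    then have "norm (D h) \<le> L * norm h + e" if "e > 0" for e
      using that False \<open>\<And>e. 0 < e \<Longrightarrow> norm (D h) \<le> L * norm h + e * norm h\<close>[of "e / norm h"] by simp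
    then show ?thesis by (rule field_le_epsilon)
  qed
qed

text \<open>Going from \<open>x\<close> to \<open>y\<close> is split into a change of speed, which
  costs \<open>B\<close>, and a change of direction at the fixed radius \<open>norm x\<close>. The
  latter costs \<open>2 * B\<close>, as \<open>\<bar>u r\<bar> \<le> B * r\<close> and rescaling
  \<open>y\<close> to radius \<open>norm x\<close> moves it by at most
  \<open>norm (y - x)\<close>.\<close>

lemma radial_field_lipschitz:
  fixes x y :: "real ^ 'n::finite"
  assumes u: "\<And>r s. r \<ge> 0 \<Longrightarrow> s \<ge> 0 \<Longrightarrow> \<bar>u r - u s\<bar> \<le> B * \<bar>r - s\<bar>" and u0: "u 0 = 0" and B: "B \<ge> 0"
  shows "norm (radial_field u y - radial_field u x) \<le> 3 * B * norm (y - x)"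
proof -
  have u1: "\<bar>u r\<bar> \<le> B * r" if "r \<ge> 0" for r using u[OF that order_refl] that u0 by simp
  have nF: "norm (radial_field u z) \<le> B * norm z" for z :: "real ^ 'n"
    using u1[of "norm z"] B by (cases "z = 0") (simp_all add: radial_field_def)
  show ?thesis
  proof (cases "x = 0 \<or> y = 0")
    case True
    then have "norm (radial_field u y - radial_field u x) \<le> B * norm (y - x)"
      using nF[of y] nF[of x] by (auto simp: radial_field_def)
    also have "\<dots> \<le> 3 * B * norm (y - x)" using B by (simp add: mult_right_mono)
    finally show ?thesis .
  next
    case False
    then have nz: "norm x > 0" "norm y > 0" by auto
    have "radial_field u y - radial_field u x
        = ((u (norm y) - u (norm x)) / norm y) *\<^sub>R y + (u (norm x) / norm x) *\<^sub>R ((norm x / norm y) *\<^sub>R y - x)"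
      using nz by (simp add: radial_field_def scaleR_diff_right scaleR_diff_left diff_divide_distrib)
    also have "norm \<dots> \<le> \<bar>u (norm y) - u (norm x)\<bar> + \<bar>u (norm x)\<bar> / norm x * norm ((norm x / norm y) *\<^sub>R y - x)"
      by (rule order_trans[OF norm_triangle_ineq]) (use nz in simp)
    also have "\<dots> \<le> B * norm (y - x) + B * (2 * norm (y - x))"
    proof (intro add_mono mult_mono)
      have "\<bar>norm y - norm x\<bar> \<le> norm (y - x)" by (rule norm_triangle_ineq3)
      then have "B * \<bar>norm y - norm x\<bar> \<le> B * norm (y - x)" using B by (rule mult_left_mono)
      with u[of "norm y" "norm x"] show "\<bar>u (norm y) - u (norm x)\<bar> \<le> B * norm (y - x)" by simp
      show "\<bar>u (norm x)\<bar> / norm x \<le> B" using u1[of "norm x"] nz by (simp add: pos_divide_le_eq)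
      have "(norm x / norm y) *\<^sub>R y - x = ((norm x - norm y) / norm y) *\<^sub>R y + (y - x)"
        using nz by (simp add: diff_divide_distrib scaleR_diff_left)
      also have "norm \<dots> \<le> \<bar>norm x - norm y\<bar> + norm (y - x)"
        by (rule order_trans[OF norm_triangle_ineq]) (use nz in simp)
      also have "\<dots> \<le> 2 * norm (y - x)" using norm_triangle_ineq3[of x y] by (simp add: norm_minus_commute)
      finally show "norm ((norm x / norm y) *\<^sub>R y - x) \<le> 2 * norm (y - x)" .
    qed (use B nz in auto)
    finally show ?thesis by (simp add: algebra_simps)
  qed
qed

text \<open>Restriction to the full line spanned by \<open>e\<close>. The line runs through the
  origin to negative parameters, so the spatial derivative is two-sided at 0; \<open>l\<close>
  selects the component to be kept.\<close>

lemma C1_on_axis: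
  fixes G :: "real \<times> (real ^ 'n::finite) \<Rightarrow> 'b::real_normed_vector" and l :: "'b \<Rightarrow> real"
  assumes G: "C1_on G (S \<times> UNIV)" and l: "bounded_linear l"
  shows "\<exists>gt gx. (\<forall>t\<in>S. \<forall>x. ((\<lambda>p. l (G (fst p, snd p *\<^sub>R e))) has_derivative (\<lambda>h. gt t x * fst h + gx t x * snd h)) (at (t, x) within S \<times> UNIV))
    \<and> continuous_on (S \<times> UNIV) (\<lambda>(t, x). gt t x :: real) \<and> continuous_on (S \<times> UNIV) (\<lambda>(t, x). gx t x :: real)"
proof -
  obtain G' where G': "\<And>z. z \<in> S \<times> UNIV \<Longrightarrow> (G has_derivative blinfun_apply (G' z)) (at z within S \<times> UNIV)"
    and cont: "continuous_on (S \<times> UNIV) G'"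
    using G unfolding C1_on_def by blast
  define gt where "gt t x = l (blinfun_apply (G' (t, x *\<^sub>R e)) (1, 0))" for t x
  define gx where "gx t x = l (blinfun_apply (G' (t, x *\<^sub>R e)) (0, e))" for t x
  have c: "continuous_on (S \<times> UNIV) (\<lambda>p. l (blinfun_apply (G' (fst p, snd p *\<^sub>R e)) w))" for w
    by (intro bounded_linear.continuous_on[OF l] blinfun.continuous_on continuous_on_const
        continuous_on_compose2[OF cont] continuous_intros) auto
  have "((\<lambda>p. l (G (fst p, snd p *\<^sub>R e))) has_derivative (\<lambda>h. gt t x * fst h + gx t x * snd h)) (at (t, x) within S \<times> UNIV)"
    if t: "t \<in> S" for t x
  proof -
    have p: "((\<lambda>p::real \<times> real. (fst p, snd p *\<^sub>R e)) has_derivative (\<lambda>h. (fst h, snd h *\<^sub>R e))) (at (t, x) within S \<times> UNIV)"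
      by (auto intro!: derivative_eq_intros)
    have im: "(\<lambda>p. (fst p, snd p *\<^sub>R e)) ` (S \<times> UNIV) \<subseteq> S \<times> UNIV" by auto
    have "(t, x *\<^sub>R e) \<in> S \<times> UNIV" using t by simp
    from has_derivative_in_compose[OF p] has_derivative_subset[OF G'[OF this] im]
    have "((\<lambda>p. G (fst p, snd p *\<^sub>R e)) has_derivative (\<lambda>h. blinfun_apply (G' (t, x *\<^sub>R e)) (fst h, snd h *\<^sub>R e))) (at (t, x) within S \<times> UNIV)"
      by simp
    from bounded_linear.has_derivative[OF l this]
    have d: "((\<lambda>p. l (G (fst p, snd p *\<^sub>R e))) has_derivative (\<lambda>h. l (blinfun_apply (G' (t, x *\<^sub>R e)) (fst h, snd h *\<^sub>R e)))) (at (t, x) within S \<times> UNIV)" .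
    have "l (blinfun_apply (G' (t, x *\<^sub>R e)) (fst h, snd h *\<^sub>R e)) = gt t x * fst h + gx t x * snd h" for h :: "real \<times> real"
    proof -
      have "(fst h, snd h *\<^sub>R e) = fst h *\<^sub>R (1, 0) + snd h *\<^sub>R (0, e)" by simp
      then have "blinfun_apply (G' (t, x *\<^sub>R e)) (fst h, snd h *\<^sub>R e)
          = fst h *\<^sub>R blinfun_apply (G' (t, x *\<^sub>R e)) (1, 0) + snd h *\<^sub>R blinfun_apply (G' (t, x *\<^sub>R e)) (0, e)"
        by (simp only: blinfun.add_right blinfun.scaleR_right)
      then show ?thesis
        by (simp add: gt_def gx_def linear_add linear_cmul bounded_linear.linear[OF l] mult.commute)
    qed
    with d show ?thesis by simp
  qed
  moreover have "continuous_on (S \<times> UNIV) (\<lambda>(t, x). gt t x)" "continuous_on (S \<times> UNIV) (\<lambda>(t, x). gx t x)"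
    using c by (simp_all add: gt_def gx_def case_prod_unfold)
  ultimately show ?thesis by blast
qed

lemma time_domain_time_interval: "T > 0 \<Longrightarrow> time_domain (time_interval T)"
proof
  assume T: "T > 0"
  show "0 \<in> time_interval T" using T by (simp add: time_interval_def zero_ereal_def)
  show "{0..t} \<subseteq> time_interval T" if "t \<in> time_interval T" for t
  proof
    fix x assume x: "x \<in> {0..t}"
    then have "ereal x \<le> ereal t" by simp
    also have "ereal t < T" using that by (simp add: time_interval_def)
    finally show "x \<in> time_interval T" using x by (simp add: time_interval_def)
  qed
  show "0 \<le> t" if "t \<in> time_interval T" for t using that by (simp add: time_interval_def)
  show "\<exists>\<sigma>\<in>time_interval T. t < \<sigma>" if "t \<in> time_interval T" for t
  proof -
    have "ereal t < T" using that by (simp add: time_interval_def)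
    then obtain z where z: "ereal t < z" "z < T" using dense by blast
    then obtain \<sigma> where "z = ereal \<sigma>" by (cases z) auto
    then show ?thesis using z that by (intro bexI[of _ \<sigma>]) (auto simp: time_interval_def)
  qed
qed

lemma radial_deriv_eq:
  assumes v: "(v has_real_derivative D) (at r)" and w: "\<And>x. x \<ge> 0 \<Longrightarrow> v x = w x" and r: "r \<ge> 0"
  shows "radial_deriv w r = D"
  unfolding radial_deriv_def
proof (rule vector_derivative_within)
  have "at_right r \<le> at r within {0..}" using r by (intro at_le) auto
  then show "at r within {0..} \<noteq> bot" using trivial_limit_at_right_real[of r] by (metis bot.extremum_uniqueI)
  have "(v has_vector_derivative D) (at r within {0..})"
    using has_field_derivative_at_within[OF v] by (simp add: has_real_derivative_iff_has_vector_derivative)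
  then show "(w has_vector_derivative D) (at r within {0..})"
    by (rule has_vector_derivative_transform_within[OF _ zero_less_one]) (use r w in auto)
qed

lemma gradient_sup_le:
  fixes u :: "real \<Rightarrow> real"
  assumes diff: "\<And>x :: real ^ 'n. radial_field u differentiable (at x)"
    and v: "\<And>x. (v has_real_derivative v' x) (at x)" "\<And>x. x \<ge> 0 \<Longrightarrow> v x = u x" and u0: "u 0 = 0"
    and B: "\<And>x. x \<ge> 0 \<Longrightarrow> \<bar>v' x\<bar> \<le> B" "B \<ge> 0"
  shows "gradient_sup TYPE('n::finite) u \<le> ennreal (3 * B)"
  unfolding gradient_sup_def
proof (rule SUP_least)
  fix x :: "real ^ 'n"
  have lip: "\<bar>u r - u s\<bar> \<le> B * \<bar>r - s\<bar>" if "r \<ge> 0" "s \<ge> 0" for r s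
  proof -
    have "norm (v r - v s) \<le> B * norm (r - s)"
    proof (rule field_differentiable_bound[of "{0..}" v v' B])
      fix z :: real assume "z \<in> {0..}"
      then show "norm (v' z) \<le> B" using B(1)[of z] by simp
      show "(v has_field_derivative v' z) (at z within {0..})" by (rule has_field_derivative_at_within[OF v(1)])
    qed (use that in auto)
    then show ?thesis using v(2) that by simp
  qed
  have "(radial_field u has_derivative frechet_derivative (radial_field u) (at x)) (at x)"
    using diff by (simp add: frechet_derivative_works)
  from onorm_le_of_lipschitz[OF this radial_field_lipschitz[OF lip u0 B(2)]] B(2)
  show "ennreal (onorm (frechet_derivative (radial_field u) (at x))) \<le> ennreal (3 * B)"
    by (intro ennreal_leI) simp
qed

lemma radial_field_axis:
  assumes "x \<ge> 0" and "u 0 = 0"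
  shows "radial_field u (x *\<^sub>R axis i 1 :: real ^ 'n::finite) $ i = u x"
  using assms by (cases "x = 0") (simp_all add: radial_field_def)

lemma time_interval_interior: "t \<in> time_interval T \<Longrightarrow> t > 0 \<Longrightarrow> at t within time_interval T = at t"
proof -
  assume t: "t \<in> time_interval T" "t > 0"
  have "0 < ereal t" using t(2) by simp
  also have "ereal t < T" using t(1) by (simp add: time_interval_def)
  finally have "T > 0" .
  then interpret time_domain "time_interval T" by (rule time_domain_time_interval)
  obtain \<sigma> where \<sigma>: "\<sigma> \<in> time_interval T" "t < \<sigma>" using later[OF t(1)] by blast
  show ?thesis unfolding at_within_Icc[OF \<sigma>] using t \<sigma> by (intro at_within_interior) auto
qed

text \<open>The profiles are meaningful for nonnegative radii only. Along an axis the fields provide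
  continuously differentiable extensions to the whole line, odd for the velocity and even for the
  density, and these satisfy the assumptions of \<open>euler_poisson_radial\<close>. The second
  claim includes \<open>t = 0\<close>, where it evaluates the potential term in
  \<open>A0\<close>.\<close>

lemma solution_axis_profiles:
  fixes i :: "'n::finite" and u \<rho> :: "real \<Rightarrow> real \<Rightarrow> real"
  assumes dim: "CARD('n) \<ge> 3" and k: "k > 0"
    and sol: "euler_poisson_solution TYPE('n) k T \<rho> u \<phi>"
    and nonneg: "\<And>r. r \<ge> 0 \<Longrightarrow> \<rho> 0 r \<ge> 0"
  defines "v \<equiv> \<lambda>t x. radial_field (u t) (x *\<^sub>R axis i 1 :: real ^ 'n) $ i"
    and "R \<equiv> \<lambda>t x. \<rho> t \<bar>x\<bar>"
  shows "\<exists>vx vt Rx Rt. euler_poisson_radial (time_interval T) v vx vt R Rx Rt k CARD('n)"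
    and "\<And>t r. t \<in> time_interval T \<Longrightarrow> r > 0 \<Longrightarrow>
      deriv (\<phi> t) r = - (r * integral {0..1} (\<lambda>\<theta>. \<theta> ^ (CARD('n) - 1) * R t (\<theta> * r)))"
proof -
  define I where "I = time_interval T"
  define N where "N = CARD('n)"
  define e :: "real ^ 'n" where "e = axis i 1"
  have e: "norm e = 1" by (simp add: e_def)
  have T: "T > 0"
    and C1\<rho>: "C1_on (\<lambda>(t, x :: real ^ 'n). radial_scalar (\<rho> t) x) (I \<times> UNIV)"
    and C1u: "C1_on (\<lambda>(t, x :: real ^ 'n). radial_field (u t) x) (I \<times> UNIV)"
    and u0: "\<And>t. t \<in> I \<Longrightarrow> u t 0 = 0"
    and pde: "\<And>t r. t \<in> I \<Longrightarrow> r > 0 \<Longrightarrow> t > 0 \<Longrightarrow>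
        deriv (\<lambda>\<tau>. \<rho> \<tau> r) t + deriv (\<lambda>\<xi>. \<rho> t \<xi> * u t \<xi> * \<xi> ^ (N - 1)) r / r ^ (N - 1) = 0"
        "\<And>t r. t \<in> I \<Longrightarrow> r > 0 \<Longrightarrow> t > 0 \<Longrightarrow>
        deriv (\<lambda>\<tau>. u \<tau> r) t + u t r * deriv (u t) r = - k * deriv (\<phi> t) r"
    and pot: "\<And>t r. t \<in> I \<Longrightarrow> r > 0 \<Longrightarrow>
        ((\<lambda>\<xi>. \<xi> ^ (N - 1) * deriv (\<phi> t) \<xi>) has_real_derivative - (r ^ (N - 1) * \<rho> t r)) (at r)"
    and pot0: "\<And>t. t \<in> I \<Longrightarrow> ((\<lambda>r. r ^ (N - 1) * deriv (\<phi> t) r) \<longlongrightarrow> 0) (at_right 0)"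
    using sol unfolding euler_poisson_solution_def I_def N_def by blast+
  interpret td: time_domain I unfolding I_def by (rule time_domain_time_interval[OF T])
  have v_eq: "v t x = u t x" if "t \<in> I" "x \<ge> 0" for t x
    unfolding v_def using radial_field_axis[where u = "u t", OF that(2) u0[OF that(1)]] .
  have R_eq: "R t x = radial_scalar (\<rho> t) (x *\<^sub>R e)" for t x by (simp add: R_def radial_scalar_def e)
  obtain vt vx where v_der: "\<And>t x. t \<in> I \<Longrightarrow>
      ((\<lambda>p. v (fst p) (snd p)) has_derivative (\<lambda>h. vt t x * fst h + vx t x * snd h)) (at (t, x) within I \<times> UNIV)"
    and vc: "continuous_on (I \<times> UNIV) (\<lambda>(t, x). vt t x)" "continuous_on (I \<times> UNIV) (\<lambda>(t, x). vx t x)"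
    using C1_on_axis[OF C1u bounded_linear_vec_nth[of i], of e] unfolding v_def e_def by auto
  obtain Rt Rx where R_der: "\<And>t x. t \<in> I \<Longrightarrow>
      ((\<lambda>p. R (fst p) (snd p)) has_derivative (\<lambda>h. Rt t x * fst h + Rx t x * snd h)) (at (t, x) within I \<times> UNIV)"
    and Rc: "continuous_on (I \<times> UNIV) (\<lambda>(t, x). Rt t x)" "continuous_on (I \<times> UNIV) (\<lambda>(t, x). Rx t x)"
    using C1_on_axis[OF C1\<rho> bounded_linear_ident, of e] unfolding R_eq by auto
  have vdx: "(v t has_real_derivative vx t x) (at x)" if "t \<in> I" for t x
    by (rule has_real_derivative_slice[OF v_der[OF that] that])
  have Rdx: "(R t has_real_derivative Rx t x) (at x)" if "t \<in> I" for t x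
    by (rule has_real_derivative_slice[OF R_der[OF that] that])
  have Rcont: "continuous_on S (R t)" if "t \<in> I" for t S
    by (rule DERIV_continuous_on[OF has_field_derivative_at_within[OF Rdx[OF that]]])
  have grad: "deriv (\<phi> t) r = - (integral {0..r} (\<lambda>\<xi>. \<xi> ^ (N - 1) * R t \<xi>) / r ^ (N - 1))"
    if t: "t \<in> I" and r: "r > 0" for t r
  proof (rule potential_gradient[OF Rcont[OF t] _ pot0[OF t] r])
    fix r :: real assume "r > 0"
    then show "((\<lambda>\<xi>. \<xi> ^ (N - 1) * deriv (\<phi> t) \<xi>) has_real_derivative - (r ^ (N - 1) * R t r)) (at r)"
      using pot[OF t, of r] by (simp add: R_def)
  qed
  have mass: "integral {0..r} (\<lambda>\<xi>. \<xi> ^ (N - 1) * R t \<xi>) = r ^ N * integral {0..1} (\<lambda>\<theta>. \<theta> ^ (N - 1) * R t (\<theta> * r))"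
    if "t \<in> I" "r > 0" for t r
    using that dim by (intro radial_mass_scaled[symmetric] Rcont) (auto simp: N_def)
  obtain n where n: "N = Suc (Suc n)" using dim by (intro that[of "N - 2"]) (simp add: N_def)
  show "deriv (\<phi> t) r = - (r * integral {0..1} (\<lambda>\<theta>. \<theta> ^ (CARD('n) - 1) * R t (\<theta> * r)))"
    if "t \<in> time_interval T" "r > 0" for t r
  proof -
    have "t \<in> I" using that(1) by (simp add: I_def)
    have "r ^ N * y / r ^ (N - 1) = r * y" for y using that(2) by (simp add: n)
    then show ?thesis unfolding N_def[symmetric] grad[OF \<open>t \<in> I\<close> that(2)] mass[OF \<open>t \<in> I\<close> that(2)] by simp
  qed
  have "euler_poisson_radial I v vx vt R Rx Rt k N"
  proof unfold_locales
    show "v t 0 = 0" if "t \<in> I" for t using v_eq[OF that order_refl] u0[OF that] by simp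
    show "R 0 r \<ge> 0" if "r \<ge> 0" for r using nonneg[OF that] that by (simp add: R_def)
    show "N \<ge> 3" using dim by (simp add: N_def)
    fix t r :: real assume t: "t \<in> I" "t > 0" and r: "r > 0"
    \<comment> \<open>A positive time is interior to \<open>I\<close>, so the derivatives within
      \<open>I\<close> are the ones denoted by \<open>deriv\<close> in the equations.\<close>
    have at: "at t within I = at t" unfolding I_def using t by (intro time_interval_interior) (auto simp: I_def)
    have "((\<lambda>s. v s r) has_real_derivative vt t r + vx t r * 0) (at t within I)"
      by (rule has_real_derivative_along_path[OF v_der[OF t(1)]]) auto
    then have "((\<lambda>s. v s r) has_real_derivative vt t r) (at t within I)" by simp
    then have "((\<lambda>s. u s r) has_real_derivative vt t r) (at t within I)"
      by (rule has_field_derivative_transform_within[OF _ zero_less_one t(1)]) (use v_eq r in auto)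
    then have ut: "deriv (\<lambda>s. u s r) t = vt t r" unfolding at by (rule DERIV_imp_deriv)
    have "((\<lambda>s. R s r) has_real_derivative Rt t r + Rx t r * 0) (at t within I)"
      by (rule has_real_derivative_along_path[OF R_der[OF t(1)]]) auto
    then have "((\<lambda>s. \<rho> s r) has_real_derivative Rt t r) (at t)" unfolding at R_def using r by simp
    then have \<rho>t: "deriv (\<lambda>s. \<rho> s r) t = Rt t r" by (rule DERIV_imp_deriv)
    have "(u t has_real_derivative vx t r) (at r)"
      by (rule has_field_derivative_transform_within_open[OF vdx[OF t(1)] open_greaterThan[of 0]]) (use r v_eq t in auto)
    then have ux: "deriv (u t) r = vx t r" by (rule DERIV_imp_deriv)
    have pw: "((\<lambda>\<xi>. \<xi> ^ (N - 1)) has_real_derivative real (N - 1) * r ^ n) (at r)"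
      using DERIV_pow[of "N - 1" r] by (simp add: n)
    have "((\<lambda>\<xi>. \<rho> t \<xi> * u t \<xi> * \<xi> ^ (N - 1)) has_real_derivative
        (Rx t r * v t r + vx t r * R t r) * r ^ (N - 1) + real (N - 1) * r ^ n * (R t r * v t r)) (at r)"
      by (rule has_field_derivative_transform_within_open[OF DERIV_mult[OF DERIV_mult[OF Rdx[OF t(1)] vdx[OF t(1)]] pw] open_greaterThan[of 0]])
        (use r v_eq t in \<open>auto simp: R_def\<close>)
    then have flux: "deriv (\<lambda>\<xi>. \<rho> t \<xi> * u t \<xi> * \<xi> ^ (N - 1)) r
        = (Rx t r * v t r + vx t r * R t r) * r ^ (N - 1) + real (N - 1) * r ^ n * (R t r * v t r)"
      by (rule DERIV_imp_deriv)
    have "(A * r ^ (N - 1) + c * r ^ n * B) / r ^ (N - 1) = A + c * B / r" for A B c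
      using r by (simp add: n field_simps)
    from this[of "Rx t r * v t r + vx t r * R t r" "real (N - 1)" "R t r * v t r"]
    show "Rt t r + Rx t r * v t r + R t r * vx t r + real (N - 1) * R t r * v t r / r = 0"
      using pde(1)[OF t(1) r t(2)] unfolding \<rho>t flux by (simp add: mult_ac add_ac)
    show "vt t r + v t r * vx t r = k * (r ^ N * integral {0..1} (\<lambda>\<theta>. \<theta> ^ (N - 1) * R t (\<theta> * r))) / r ^ (N - 1)"
      using pde(2)[OF t(1) r t(2)] v_eq[OF t(1) less_imp_le[OF r]]
      unfolding ut ux grad[OF t(1) r] mass[OF t(1) r] by simp
  qed (use v_der vc R_der Rc k in auto)
  then show "\<exists>vx vt Rx Rt. euler_poisson_radial (time_interval T) v vx vt R Rx Rt k CARD('n)"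
    unfolding I_def N_def by blast
qed

theorem theorem2p3:
  fixes k s r\<^sub>c :: real and T :: ereal
    and \<rho>\<^sub>0 u\<^sub>0 :: "real \<Rightarrow> real" and \<rho> u \<phi> :: "real \<Rightarrow> real \<Rightarrow> real"
  assumes dim: "CARD('n::finite) \<ge> 3"
    and k: "k > 0"
    and s: "s > real CARD('n) / 2"
    and data: "admissible_data TYPE('n) s \<rho>\<^sub>0 u\<^sub>0"
    and sol: "maximal_solution TYPE('n) k T \<rho> u \<phi>"
    and init: "\<And>r. r \<ge> 0 \<Longrightarrow> \<rho> 0 r = \<rho>\<^sub>0 r \<and> u 0 r = u\<^sub>0 r"
    and r\<^sub>c: "r\<^sub>c > 0" "\<rho>\<^sub>0 r\<^sub>c > 0"
    and A0: "A0 k \<rho>\<^sub>0 u\<^sub>0 (\<phi> 0) r\<^sub>c \<le> - k / (real CARD('n) - 2)"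
  shows "finite_time_breakdown T \<rho> u"
proof -
  \<comment> \<open>Fixes an arbitrary coordinate axis, on which the profiles are read off.\<close>
  obtain i :: 'n where True by blast
  define I where "I = time_interval T"
  define N where "N = CARD('n)"
  define v where "v = (\<lambda>t x. radial_field (u t) (x *\<^sub>R axis i 1 :: real ^ 'n) $ i)"
  define R where "R = (\<lambda>t x. \<rho> t \<bar>x\<bar>)"
  have eps: "euler_poisson_solution TYPE('n) k T \<rho> u \<phi>" using sol by (simp add: maximal_solution_def)
  have \<rho>0: "\<rho> 0 r \<ge> 0" if "r \<ge> 0" for r using data init[OF that] that by (simp add: admissible_data_def)
  obtain vx vt Rx Rt where "euler_poisson_radial I v vx vt R Rx Rt k N"
    using solution_axis_profiles(1)[OF dim k eps \<rho>0, of i] unfolding v_def R_def I_def N_def by blast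
  then interpret ep: euler_poisson_radial I v vx vt R Rx Rt k N .
  have u0: "u t 0 = 0" if "t \<in> I" for t
    using eps that unfolding euler_poisson_solution_def I_def by blast
  have v_eq: "v t x = u t x" if "t \<in> I" "x \<ge> 0" for t x
    unfolding v_def using radial_field_axis[where u = "u t", OF that(2) u0[OF that(1)]] .
  have v0: "v 0 = (\<lambda>x. radial_field u\<^sub>0 (x *\<^sub>R axis i 1 :: real ^ 'n) $ i)"
    using init by (simp add: v_def radial_field_def)
  have R0: "R 0 = (\<lambda>x. \<rho>\<^sub>0 \<bar>x\<bar>)" using init by (simp add: R_def)
  have R0_lim: "(R 0 \<longlongrightarrow> 0) at_top" unfolding R0 by (rule admissible_data_decay(1)[OF s data])
  have v0_lim: "(v 0 \<longlongrightarrow> 0) at_top" unfolding v0 by (rule admissible_data_decay(2)[OF s data])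
  have vx0_lim: "(vx 0 \<longlongrightarrow> 0) at_top"
    by (rule admissible_data_decay(3)[OF s data, of i]) (use ep.v_deriv_x[OF ep.zero_mem] v0 in simp)
  obtain C where C: "\<And>a. a \<ge> 0 \<Longrightarrow> integral {0..a} (\<lambda>r. r ^ (N - 1) * (R 0 r)\<^sup>2) \<le> C"
    using admissible_data_decay(4)[OF s data] unfolding N_def R0 by blast
  interpret dd: decaying_data I v vx vt R Rx Rt k N C
    using R0_lim v0_lim vx0_lim C by unfold_locales
  have "I \<noteq> {0..}"
  proof (rule dd.lifespan_finite[OF r\<^sub>c(1)])
    show "R 0 r\<^sub>c > 0" using r\<^sub>c by (simp add: R0)
    have "(u\<^sub>0 has_real_derivative vx 0 r\<^sub>c) (at r\<^sub>c)"
      by (rule has_field_derivative_transform_within_open[OF ep.v_deriv_x[OF ep.zero_mem] open_greaterThan[of 0]])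
        (use r\<^sub>c v_eq[OF ep.zero_mem] init in auto)
    then have d: "deriv u\<^sub>0 r\<^sub>c = vx 0 r\<^sub>c" by (rule DERIV_imp_deriv)
    have p: "deriv (\<phi> 0) r\<^sub>c = - (r\<^sub>c * ep.\<mu> 0 r\<^sub>c)"
      unfolding ep.\<mu>_def unfolding R_def N_def
      by (rule solution_axis_profiles(2)[OF dim k eps \<rho>0]) (use ep.zero_mem r\<^sub>c in \<open>simp_all add: I_def\<close>)
    have v: "v 0 r\<^sub>c = u\<^sub>0 r\<^sub>c" using v_eq[OF ep.zero_mem] init r\<^sub>c by simp
    define \<rho> where "\<rho> = \<rho>\<^sub>0 r\<^sub>c"
    define x where "x = v 0 r\<^sub>c * vx 0 r\<^sub>c"
    define m where "m = ep.\<mu> 0 r\<^sub>c"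
    define M where "M = real CARD('n) - 2"
    have M: "real (N - 2) = M" "M > 0" using dim by (auto simp: N_def M_def)
    \<comment> \<open>The hypothesis on \<open>A0\<close> with the potential evaluated.
      Multiplication by \<open>r\<^sub>c * \<rho>\<close> and division by \<open>r\<^sub>c\<close>
      turn it into \<open>Q \<le> 0\<close> for the shell starting at
      \<open>r\<^sub>c\<close>.\<close>
    have "(x - k * (r\<^sub>c * m)) / (r\<^sub>c * \<rho>) \<le> - k / M"
      using A0 unfolding A0_def d p v[symmetric] x_def \<rho>_def m_def M_def by simp
    then have "x - k * (r\<^sub>c * m) \<le> - k / M * (r\<^sub>c * \<rho>)"
      using r\<^sub>c by (simp add: pos_divide_le_eq \<rho>_def)
    then have "(x - k * (r\<^sub>c * m)) / r\<^sub>c \<le> (- k / M * (r\<^sub>c * \<rho>)) / r\<^sub>c"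
      using r\<^sub>c by (intro divide_right_mono) auto
    moreover have "(x - k * (r\<^sub>c * m)) / r\<^sub>c = x / r\<^sub>c - k * m" "(- k / M * (r\<^sub>c * \<rho>)) / r\<^sub>c = - (k * \<rho> / M)"
      using r\<^sub>c by (simp_all add: diff_divide_distrib)
    ultimately have "x / r\<^sub>c - k * m + k * \<rho> / M \<le> 0" by simp
    then show "v 0 r\<^sub>c / r\<^sub>c * vx 0 r\<^sub>c - k * ep.\<mu> 0 r\<^sub>c + k * R 0 r\<^sub>c / real (N - 2) \<le> 0"
      using r\<^sub>c by (simp add: x_def m_def \<rho>_def M(1) R0)
  qed
  moreover have "time_interval \<infinity> = {0..}" by (auto simp: time_interval_def)
  ultimately have Tfin: "T \<noteq> \<infinity>" by (auto simp: I_def)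
  have Tpos: "T > 0" using eps by (simp add: euler_poisson_solution_def)
  then obtain t\<^sub>c where T: "T = ereal t\<^sub>c" using Tfin by (cases T) auto
  have tc: "t\<^sub>c > 0" using Tpos by (simp add: T)
  have I: "I = {0..<t\<^sub>c}" by (auto simp: I_def T time_interval_def)
  interpret fd: finite_decaying I v vx vt R Rx Rt k N C t\<^sub>c
    using I tc by unfold_locales auto
  have diff: "radial_field (u t) differentiable (at (x :: real ^ 'n))" if t: "t \<in> I" for t x
  proof -
    have "C1_on (\<lambda>(t, x :: real ^ 'n). radial_field (u t) x) (I \<times> UNIV)"
      using eps by (simp add: euler_poisson_solution_def I_def)
    then obtain G' where G': "\<And>z. z \<in> I \<times> UNIV \<Longrightarrow>
        ((\<lambda>(t, x :: real ^ 'n). radial_field (u t) x) has_derivative blinfun_apply (G' z)) (at z within I \<times> UNIV)"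
      unfolding C1_on_def by (elim exE conjE) (rule that, erule bspec)
    have p: "((\<lambda>x :: real ^ 'n. (t, x)) has_derivative (\<lambda>h. (0, h))) (at x)"
      by (intro has_derivative_Pair has_derivative_ident has_derivative_const)
    have im: "range (\<lambda>x :: real ^ 'n. (t, x)) \<subseteq> I \<times> UNIV" using t by auto
    have "(t, x) \<in> I \<times> UNIV" using t by simp
    from has_derivative_in_compose[OF p has_derivative_subset[OF G'[OF this] im]]
    have "(radial_field (u t) has_derivative (\<lambda>h. blinfun_apply (G' (t, x)) (0, h))) (at x)" by simp
    then show ?thesis by (rule differentiableI)
  qed
  \<comment> \<open>A bound on \<open>vx\<close> bounds the gradient of the field on space by
    \<open>3 * B\<close>, so its integral over the finite lifespan is finite, against
    maximality.\<close>
  have "\<not> (\<exists>B. \<forall>t\<in>I. \<forall>x\<ge>0. \<bar>vx t x\<bar> \<le> B)"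
  proof
    assume "\<exists>B. \<forall>t\<in>I. \<forall>x\<ge>0. \<bar>vx t x\<bar> \<le> B"
    then obtain B where B: "\<And>t x. t \<in> I \<Longrightarrow> x \<ge> 0 \<Longrightarrow> \<bar>vx t x\<bar> \<le> B" by blast
    have B0: "B \<ge> 0" using B[OF ep.zero_mem order_refl] by linarith
    have "gradient_sup TYPE('n) (u t) \<le> ennreal (3 * B)" if t: "t \<in> I" for t
      by (rule gradient_sup_le[OF diff[OF t] ep.v_deriv_x[OF t] v_eq[OF t] u0[OF t] B[OF t] B0])
    then have "(\<integral>\<^sup>+ t\<in>I. gradient_sup TYPE('n) (u t) \<partial>lborel) \<le> (\<integral>\<^sup>+ t. ennreal (3 * B) * indicator I t \<partial>lborel)"
      by (intro nn_integral_mono) (auto simp: indicator_def)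
    also have "\<dots> = ennreal (3 * B) * emeasure lborel I" unfolding I by (intro nn_integral_cmult_indicator) simp
    also have "\<dots> < \<infinity>" unfolding I using tc by (simp add: ennreal_mult_less_top)
    finally show False using sol Tfin by (simp add: maximal_solution_def I_def)
  qed
  note unb = this
  obtain a r where a: "a \<ge> 0"
    and lim: "((\<lambda>t. ep.flow t a) \<longlongrightarrow> r) (at_left t\<^sub>c)"
    and r: "r > 0 \<or> r = 0 \<and> (\<forall>\<xi>\<in>{0..a}. R 0 \<xi> = 0)"
    and grad: "filterlim (\<lambda>t. \<bar>vx t (ep.flow t a)\<bar>) at_top (at_left t\<^sub>c)"
    and dens: "filterlim (\<lambda>t. R t (ep.flow t a)) at_top (at_left t\<^sub>c) \<or> ((\<lambda>t. R t (ep.flow t a)) \<longlongrightarrow> 0) (at_left t\<^sub>c)"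
    using fd.breakdown[OF unb] by (elim exE conjE) (rule that)
  have ev: "eventually (\<lambda>t. t \<in> I) (at_left t\<^sub>c)"
    using fd.eventually_in_I[OF tc] by (rule eventually_mono) simp
  have "eventually (\<lambda>t. \<bar>vx t (ep.flow t a)\<bar> = \<bar>radial_deriv (u t) (ep.flow t a)\<bar>) (at_left t\<^sub>c)"
    using ev
  proof (rule eventually_mono)
    fix t assume t: "t \<in> I"
    show "\<bar>vx t (ep.flow t a)\<bar> = \<bar>radial_deriv (u t) (ep.flow t a)\<bar>"
      by (simp only: radial_deriv_eq[OF ep.v_deriv_x[OF t] v_eq[OF t] ep.flow_nonneg[OF t a]])
  qed
  from filterlim_cong[OF refl refl this] grad
  have grad': "filterlim (\<lambda>t. \<bar>radial_deriv (u t) (ep.flow t a)\<bar>) at_top (at_left t\<^sub>c)" by blast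
  have Req: "eventually (\<lambda>t. R t (ep.flow t a) = \<rho> t (ep.flow t a)) (at_left t\<^sub>c)"
    using ev by (rule eventually_mono) (simp add: R_def ep.flow_nonneg a)
  have dens': "filterlim (\<lambda>t. \<rho> t (ep.flow t a)) at_top (at_left t\<^sub>c) \<or> ((\<lambda>t. \<rho> t (ep.flow t a)) \<longlongrightarrow> 0) (at_left t\<^sub>c)"
    using dens unfolding filterlim_cong[OF refl refl Req] .
  have path: "\<forall>t\<in>{0..<t\<^sub>c}. ep.flow t a \<ge> 0 \<and>
      ((\<lambda>t. ep.flow t a) has_real_derivative u t (ep.flow t a)) (at t within {0..<t\<^sub>c})"
  proof
    fix t assume "t \<in> {0..<t\<^sub>c}"
    then have t: "t \<in> I" by (simp add: I)
    show "ep.flow t a \<ge> 0 \<and> ((\<lambda>t. ep.flow t a) has_real_derivative u t (ep.flow t a)) (at t within {0..<t\<^sub>c})"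
      using ep.flow_deriv[OF t a] ep.flow_nonneg[OF t a] v_eq[OF t ep.flow_nonneg[OF t a]] by (simp add: I)
  qed
  have loc: "r > 0 \<or> r = 0 \<and> (\<forall>\<xi>\<in>{0..ep.flow 0 a}. \<rho> 0 \<xi> = 0)"
    using r ep.flow_0[OF a] by (auto simp: R_def)
  show ?thesis
    unfolding finite_time_breakdown_def
    by (rule exI[of _ t\<^sub>c], rule exI[of _ "\<lambda>t. ep.flow t a"], rule exI[of _ r])
      (intro conjI tc T path lim loc grad' dens')
qed

end
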